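(* There exists a constant $C'>0$ such that for every $k$, every real $m$ with $C'\leq m\leq k^{22}$, every complete $k$-partite graph $H$ on $mk$ vertices, and every integer $n\geq10^{60}mk\log^4k$, the cycle $C_n$ is $H$-good, i.e. $R(C_n,H)=(\chi(H)-1)(n-1)+\sigma(H)$.
   Context: Logarithms are natural. $R(F,H)$ is the minimum $N$ such that every $N$-vertex graph either contains $F$ or its complement contains $H$. $C_n$ is the $n$-vertex cycle; $\chi(H)$ is the chromatic number and $\sigma(H)$ is the minimum size of a colour class over all proper $\chi(H)$-colourings of $H$. *)

theory Defs
  imports Complex_Main
begin

definition is_graph :: "'a set \<Rightarrow> 'a set set \<Rightarrow> bool" where
  "is_graph V E \<longleftrightarrow> finite V \<and> (\<forall>e\<in>E. e \<subseteq> V \<and> card e = 2)"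

definition contains_graph :: "'a set \<Rightarrow> 'a set set \<Rightarrow> 'b set \<Rightarrow> 'b set set \<Rightarrow> bool" where
  "contains_graph V E V' E' \<longleftrightarrow>
     (\<exists>f. inj_on f V' \<and> f ` V' \<subseteq> V \<and> (\<forall>e\<in>E'. f ` e \<in> E))"

definition compl_edges :: "'a set \<Rightarrow> 'a set set \<Rightarrow> 'a set set" where
  "compl_edges V E = {e. e \<subseteq> V \<and> card e = 2 \<and> e \<notin> E}"

definition ramsey_number :: "'a set \<Rightarrow> 'a set set \<Rightarrow> 'b set \<Rightarrow> 'b set set \<Rightarrow> nat" where
  "ramsey_number VF EF VH EH =
     (LEAST N. \<forall>E. is_graph {0..<N::nat} E \<longrightarrow>
        contains_graph {0..<N} E VF EF \<or> contains_graph {0..<N} (compl_edges {0..<N} E) VH EH)"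

definition cycle_edges :: "nat \<Rightarrow> nat set set" where
  "cycle_edges n = {{i, (i + 1) mod n} | i. i < n}"

definition proper_colouring :: "'a set \<Rightarrow> 'a set set \<Rightarrow> nat \<Rightarrow> ('a \<Rightarrow> nat) \<Rightarrow> bool" where
  "proper_colouring V E q c \<longleftrightarrow>
     (\<forall>v\<in>V. c v < q) \<and> (\<forall>u\<in>V. \<forall>v\<in>V. {u, v} \<in> E \<longrightarrow> c u \<noteq> c v)"

definition chromatic_number :: "'a set \<Rightarrow> 'a set set \<Rightarrow> nat" where
  "chromatic_number V E = (LEAST q. \<exists>c. proper_colouring V E q c)"

definition sigma_graph :: "'a set \<Rightarrow> 'a set set \<Rightarrow> nat" where
  "sigma_graph V E = Min {card {v\<in>V. c v = i} | c i.
       proper_colouring V E (chromatic_number V E) c \<and> i < chromatic_number V E}"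

definition complete_k_partite :: "nat \<Rightarrow> 'a set \<Rightarrow> 'a set set \<Rightarrow> bool" where
  "complete_k_partite k V E \<longleftrightarrow> finite V \<and>
     (\<exists>p. p ` V = {0..<k} \<and> E = {{u, v} | u v. u \<in> V \<and> v \<in> V \<and> p u \<noteq> p v})"

end

theory Submission
  imports Defs
begin

text \<open>
  Let \<open>h = |H|\<close>, let \<open>G\<close> be a graph on \<open>(k - 1) (n - 1) + \<sigma>\<close> vertices whose complement
  does not contain \<open>H\<close>, and argue by induction on the number \<open>k\<close> of parts. Then every \<open>h\<close>
  vertices span an edge, there are no \<open>k\<close> pairwise non-adjacent \<open>h\<close>-sets, and, by induction,
  every set \<open>X\<close> of at least \<open>h\<close> vertices satisfies \<open>|X \<union> N(X)| \<ge> n\<close>.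

  Let the rank of a set be the largest number of pairwise non-adjacent \<open>h\<close>-sets in it. A smallest
  set \<open>S\<close> of about \<open>r n\<close> or more vertices and rank \<open>r\<close> cannot be split into two non-adjacent
  sets by deleting few vertices. In such a set a longest path between two fixed vertices misses only
  \<open>O(r h)\<close> vertices: by the Chvatal--Erdos argument a component of the rest has at most \<open>h\<close> neighbours
  on the path. A suffix of the path may be replaced by an induced path, which has fewer than
  \<open>2 h\<close> vertices, so one obtains paths whose length is prescribed up to \<open>2 h\<close>. This error is removed
  by a chain of \<open>2 h\<close> odd cycles of length \<open>O(log h)\<close>, each of which can be traversed in two ways
  whose lengths differ by one; any \<open>4 h\<close> vertices contain such an odd cycle.

  This settles \<open>r \<ge> 2\<close>, where \<open>S\<close> has almost \<open>2 n\<close> vertices. If \<open>r = 1\<close>, any two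
  \<open>h\<close>-sets in \<open>S\<close> are joined by an edge. Either a large matching leaves \<open>S\<close>, and
  detours \<open>s - y - y' - s'\<close> outside \<open>S\<close> provide the missing vertices, or \<open>S\<close> has a small boundary.
  In the latter case the subset \<open>X\<close> minimizing \<open>9 |X \<union> N(X)| - |X|\<close> has the property that all small sets in
  \<open>X \<union> N(X)\<close> expand into \<open>X\<close>, and Posa rotations performed independently at both
  ends of a longest path give a Hamilton cycle on any \<open>n\<close> vertices that contain \<open>X\<close>.
\<close>

section \<open>Paths, packings and joined sets\<close>

text \<open>The logarithms have two sources; let \<open>lam\<close> be about log h. An odd cycle
  used as adjuster costs O(\<open>lam\<close>) vertices, and O(h) of them are needed, so the
  construction loses O(h \<open>lam\<close>) vertices; the slack t = 30 h l with l = 2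
  \<open>lam\<close> + 2 dominates all these losses. The rotation argument needs
  O(\<open>lam\<close>) disjoint blocks of O(h \<open>lam\<close>) vertices each. This leads to the
  condition that n is at least of order h \<open>lam\<close>^2.

  Rank one is the delicate case, since S may then have fewer than n vertices. The slack in the size
  of S cannot be avoided: when S is split, the defects of both pieces add up. With a small boundary
  there may be just n vertices available, so no loss is allowed any more and a spanning cycle has to
  be found; chains of adjusters do not help there.

  The obstacle to rotating at both ends is that the reversals at one end disturb the segments on
  which the rotations at the other end rely. Therefore two blocks of the path are found that no
  rotation has damaged so far, the path is cut between them, and each half is rotated using only the
  expansion inside its own block.\<close>

locale sgraph =
  fixes adj :: "'a \<Rightarrow> 'a \<Rightarrow> bool"
  assumes adj_sym: "adj x y \<Longrightarrow> adj y x"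
    and adj_irrefl: "\<not> adj x x"
begin

definition nonadj :: "'a set \<Rightarrow> 'a set \<Rightarrow> bool" where
  "nonadj A B \<longleftrightarrow> (\<forall>a\<in>A. \<forall>b\<in>B. \<not> adj a b)"

text \<open>The number of vertices, \<open>length xs\<close>, serves as the length of a path; all
  arithmetic about cycle lengths is done in these terms.\<close>

definition pth :: "'a set \<Rightarrow> 'a \<Rightarrow> 'a \<Rightarrow> 'a list \<Rightarrow> bool" where
  "pth S a b xs \<longleftrightarrow> xs \<noteq> [] \<and> distinct xs \<and> successively adj xs \<and> set xs \<subseteq> S \<and> hd xs = a \<and> last xs = b"

definition edgy :: "nat \<Rightarrow> 'a set \<Rightarrow> bool" where
  "edgy h U \<longleftrightarrow> (\<forall>A\<subseteq>U. h \<le> card A \<longrightarrow> (\<exists>x\<in>A. \<exists>y\<in>A. adj x y))"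

definition cyc :: "nat \<Rightarrow> 'a set \<Rightarrow> bool" where
  "cyc n U \<longleftrightarrow> (\<exists>xs. length xs = n \<and> distinct xs \<and> set xs \<subseteq> U \<and> successively adj xs \<and> adj (last xs) (hd xs))"

lemma nonadj_sym: "nonadj A B \<Longrightarrow> nonadj B A"
  unfolding nonadj_def using adj_sym by blast

lemma nonadj_mono: "nonadj A B \<Longrightarrow> A' \<subseteq> A \<Longrightarrow> B' \<subseteq> B \<Longrightarrow> nonadj A' B'"
  unfolding nonadj_def by blast

lemma edgy_mono: "edgy h U \<Longrightarrow> W \<subseteq> U \<Longrightarrow> edgy h W"
  unfolding edgy_def by (meson order_trans)

lemma edgyD: "edgy h U \<Longrightarrow> A \<subseteq> U \<Longrightarrow> h \<le> card A \<Longrightarrow> \<exists>x y. x \<in> A \<and> y \<in> A \<and> adj x y"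
  unfolding edgy_def by meson

lemma cyc_mono: "cyc n U \<Longrightarrow> U \<subseteq> W \<Longrightarrow> cyc n W"
  unfolding cyc_def by blast

lemma successively_adj_rev: "successively adj (rev xs) = successively adj xs"
proof -
  have "adj y x = adj x y" for x y using adj_sym by blast
  then show ?thesis by (simp add: successively_rev)
qed

lemma pth_mono: "pth S a b xs \<Longrightarrow> S \<subseteq> T \<Longrightarrow> pth T a b xs"
  unfolding pth_def by blast

lemma pth_rev: "pth S a b xs \<Longrightarrow> pth S b a (rev xs)"
  unfolding pth_def by (auto simp: hd_rev last_rev successively_adj_rev simp del: successively_rev)

lemma pth_single: "a \<in> S \<Longrightarrow> pth S a a [a]"
  unfolding pth_def by simp

lemma pth_append:
  assumes "pth S a b xs" "pth T c d ys" "adj b c" "set xs \<inter> set ys = {}"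
  shows "pth (S \<union> T) a d (xs @ ys)"
  using assms unfolding pth_def by (auto simp: successively_append_iff)

lemma cyc_of_pths:
  assumes "pth S a b xs" "pth T c d ys" "adj b c" "adj d a" "S \<inter> T = {}"
    and "length xs + length ys = n"
  shows "cyc n (S \<union> T)"
proof -
  have "pth (S \<union> T) a d (xs @ ys)"
    using assms by (intro pth_append[of S a b xs T c d ys]) (auto simp: pth_def)
  then show ?thesis
    unfolding cyc_def pth_def using assms by (intro exI[of _ "xs @ ys"]) auto
qed

lemma pth_append_left:
  assumes "pth S a b (us @ ws)" "us \<noteq> []"
  shows "pth S a (last us) us"
  using assms unfolding pth_def by (auto simp: successively_append_iff)

lemma pth_append_right:
  assumes "pth S a b (us @ ws)" "ws \<noteq> []"
  shows "pth S (hd ws) b ws"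
  using assms unfolding pth_def by (auto simp: successively_append_iff)

lemma pth_take:
  assumes "pth S a b xs" "i < length xs"
  shows "pth S a (xs ! i) (take (Suc i) xs)"
proof -
  have "xs = take (Suc i) xs @ drop (Suc i) xs" by simp
  then have "pth S a b (take (Suc i) xs @ drop (Suc i) xs)" using assms by simp
  then have "pth S a (last (take (Suc i) xs)) (take (Suc i) xs)"
    by (rule pth_append_left) (use assms in auto)
  then show ?thesis using assms by (simp add: take_Suc_conv_app_nth)
qed

lemma pth_drop:
  assumes "pth S a b xs" "i < length xs"
  shows "pth S (xs ! i) b (drop i xs)"
proof -
  have "xs = take i xs @ drop i xs" by simp
  then have "pth S a b (take i xs @ drop i xs)" using assms by simp
  then have "pth S (hd (drop i xs)) b (drop i xs)"
    by (rule pth_append_right) (use assms in auto)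
  then show ?thesis using assms by (simp add: hd_drop_conv_nth)
qed

lemma pth_restrict: "pth S a b xs \<Longrightarrow> pth (set xs) a b xs"
  unfolding pth_def by simp

lemma pth_in:
  assumes "pth S a b xs" shows "a \<in> set xs" "b \<in> set xs" "set xs \<subseteq> S" "a \<in> S" "b \<in> S" "distinct xs"
  using assms unfolding pth_def by auto

lemma pth_take_drop_disj: "pth S a b xs \<Longrightarrow> i \<le> j \<Longrightarrow> set (take i xs) \<inter> set (drop j xs) = {}"
  unfolding pth_def by (auto dest: set_take_disj_set_drop_if_distinct)

lemma pth_extend:
  assumes "pth S a b xs" "adj b c" "c \<in> S"
  shows "\<exists>ys. pth S a c ys"
proof (cases "c \<in> set xs")
  case True
  then obtain i where "i < length xs" "xs ! i = c" by (metis in_set_conv_nth)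
  then show ?thesis using pth_take[OF assms(1)] by blast
next
  case False
  have "pth (S \<union> S) a c (xs @ [c])"
    using False assms by (intro pth_append[of S a b xs S c c]) (auto simp: pth_single)
  then show ?thesis by auto
qed

text \<open>If there is no path, the set of vertices reachable from X inside S has no edge to the
  rest of S.\<close>

lemma path_or_cut:
  assumes "X \<subseteq> S"
  shows "(\<exists>a\<in>X. \<exists>b\<in>Y. \<exists>xs. pth S a b xs) \<or> (\<exists>A. X \<subseteq> A \<and> A \<subseteq> S \<and> A \<inter> Y = {} \<and> nonadj A (S - A))"
proof (cases "\<exists>a\<in>X. \<exists>b\<in>Y. \<exists>xs. pth S a b xs")
  case False
  define A where "A = {y. \<exists>a\<in>X. \<exists>xs. pth S a y xs}"
  have "X \<subseteq> A" unfolding A_def using assms pth_single by blast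
  moreover have "A \<subseteq> S" unfolding A_def using pth_in(5) by blast
  moreover have "A \<inter> Y = {}" using False unfolding A_def by blast
  moreover have "nonadj A (S - A)"
    unfolding nonadj_def A_def using pth_extend by blast
  ultimately show ?thesis by blast
qed simp

text \<open>A path from X to Y of minimum length has no chords, so its vertices at even positions
  are pairwise non-adjacent; 2 h vertices would yield h independent ones. Minimality also prevents
  further visits to X and Y.\<close>

lemma shortest_path:
  assumes "\<exists>a\<in>X. \<exists>b\<in>Y. \<exists>xs. pth S a b xs" and ed: "edgy h S"
  obtains a b xs where "a \<in> X" "b \<in> Y" "pth S a b xs" "set xs \<inter> X = {a}" "set xs \<inter> Y = {b}"
    "length xs < 2 * h"
proof -
  define Q where "Q = (\<lambda>xs. \<exists>a\<in>X. \<exists>b\<in>Y. pth S a b xs)"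
  have ex: "\<exists>xs. Q xs" using assms unfolding Q_def by blast
  define xs where "xs = arg_min length Q"
  have Qxs: "Q xs" and mn: "\<And>ys. Q ys \<Longrightarrow> length xs \<le> length ys"
    using ex unfolding xs_def by (auto intro: arg_min_natI arg_min_nat_le)
  then obtain a b where ab: "a \<in> X" "b \<in> Y" and p: "pth S a b xs" unfolding Q_def by blast
  have pne: "xs \<noteq> []" and dx: "distinct xs" and hx: "hd xs = a" "last xs = b"
    using p unfolding pth_def by auto
  have X1: "xs ! i \<in> X \<Longrightarrow> i < length xs \<Longrightarrow> i = 0" for i
  proof -
    assume "xs ! i \<in> X" "i < length xs"
    then have "Q (drop i xs)" using pth_drop[OF p, of i] ab unfolding Q_def by blast
    then show "i = 0" using mn[of "drop i xs"] \<open>i < length xs\<close> by simp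
  qed
  have Y1: "xs ! i \<in> Y \<Longrightarrow> i < length xs \<Longrightarrow> Suc i = length xs" for i
  proof -
    assume "xs ! i \<in> Y" "i < length xs"
    then have "Q (take (Suc i) xs)" using pth_take[OF p, of i] ab unfolding Q_def by blast
    then show "Suc i = length xs" using mn[of "take (Suc i) xs"] \<open>i < length xs\<close> by simp
  qed
  have sX: "set xs \<inter> X = {a}"
  proof -
    have "x = a" if xx: "x \<in> set xs" "x \<in> X" for x
    proof -
      obtain i where i: "i < length xs" "xs ! i = x" using xx by (auto simp: in_set_conv_nth)
      then show ?thesis using X1[of i] that hx pne by (auto simp: hd_conv_nth)
    qed
    then show ?thesis using pth_in(1)[OF p] ab by blast
  qed
  have sY: "set xs \<inter> Y = {b}"
  proof -
    have "x = b" if xx: "x \<in> set xs" "x \<in> Y" for x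
    proof -
      obtain i where i: "i < length xs" "xs ! i = x" using xx by (auto simp: in_set_conv_nth)
      then have "i = length xs - 1" using Y1[of i] that by simp
      then show ?thesis using i hx pne by (auto simp: last_conv_nth)
    qed
    then show ?thesis using pth_in(2)[OF p] ab by blast
  qed
  have ind: "\<not> adj (xs ! i) (xs ! j)" if "Suc i < j" "j < length xs" for i j
  proof
    assume a: "adj (xs ! i) (xs ! j)"
    have "pth (S \<union> S) a b (take (Suc i) xs @ drop j xs)"
      using that by (intro pth_append[OF pth_take[OF p] pth_drop[OF p] a] pth_take_drop_disj[OF p]) auto
    then have "Q (take (Suc i) xs @ drop j xs)" using ab unfolding Q_def by auto
    then have "length xs \<le> length (take (Suc i) xs @ drop j xs)" by (rule mn)
    then show False using that by simp
  qed
  have "length xs < 2 * h"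
  proof (rule ccontr)
    assume "\<not> length xs < 2 * h"
    then have len: "2 * h \<le> length xs" by simp
    let ?A = "(\<lambda>i. xs ! (2 * i)) ` {..<h}"
    have "inj_on (\<lambda>i. xs ! (2 * i)) {..<h}"
      using len dx by (auto simp: inj_on_def nth_eq_iff_index_eq)
    then have "card ?A = h" by (simp add: card_image)
    moreover have "?A \<subseteq> S" using len pth_in(3)[OF p] by (auto intro!: subsetD[OF _ nth_mem])
    ultimately have "\<exists>x y. x \<in> ?A \<and> y \<in> ?A \<and> adj x y" by (intro edgyD[OF ed]) simp_all
    then obtain x y where xy: "x \<in> ?A" "y \<in> ?A" "adj x y" by blast
    then obtain i j where ij: "i < h" "j < h" "x = xs ! (2 * i)" "y = xs ! (2 * j)" by auto
    have "i \<noteq> j" using xy ij adj_irrefl by auto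
    then consider "i < j" | "j < i" by linarith
    then show False
    proof cases
      case 1 then show ?thesis using ind[of "2*i" "2*j"] xy ij len by auto
    next
      case 2 then show ?thesis using ind[of "2*j" "2*i"] xy ij len adj_sym by auto
    qed
  qed
  then show ?thesis using that ab p sX sY by blast
qed

text \<open>The largest r with \<open>packing h r U\<close> is the rank of U. Peeling off one set A
  with a remainder B not adjacent to it avoids indexed families and suits inductions on the
  rank.\<close>

primrec packing :: "nat \<Rightarrow> nat \<Rightarrow> 'a set \<Rightarrow> bool" where
  "packing h 0 U = True"
| "packing h (Suc r) U = (\<exists>A B. A \<subseteq> U \<and> B \<subseteq> U \<and> A \<inter> B = {} \<and> nonadj A B \<and> h \<le> card A \<and> packing h r B)"

lemma packing_mono: "packing h r U \<Longrightarrow> U \<subseteq> W \<Longrightarrow> packing h r W"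
proof (cases r)
  case (Suc s)
  assume "packing h r U" "U \<subseteq> W"
  then show ?thesis unfolding Suc by simp (meson order_trans)
qed simp

lemma packing_add:
  "packing h a A \<Longrightarrow> packing h b B \<Longrightarrow> A \<inter> B = {} \<Longrightarrow> nonadj A B \<Longrightarrow> A \<subseteq> U \<Longrightarrow> B \<subseteq> U \<Longrightarrow> packing h (a + b) U"
proof (induction a arbitrary: A U)
  case 0
  then show ?case using packing_mono by auto
next
  case (Suc a)
  then obtain C D where CD: "C \<subseteq> A" "D \<subseteq> A" "C \<inter> D = {}" "nonadj C D" "h \<le> card C" "packing h a D" by auto
  have "packing h (a + b) (D \<union> B)"
    using Suc.IH[of D "D \<union> B"] CD Suc.prems nonadj_mono[of A B D B] by auto
  moreover have "nonadj C (D \<union> B)" using CD Suc.prems unfolding nonadj_def by blast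
  moreover have "C \<subseteq> U" "D \<union> B \<subseteq> U" "C \<inter> (D \<union> B) = {}" using CD Suc.prems by blast+
  ultimately have "\<exists>A B. A \<subseteq> U \<and> B \<subseteq> U \<and> A \<inter> B = {} \<and> nonadj A B \<and> h \<le> card A \<and> packing h (a + b) B"
    using CD(5) by blast
  then show ?case by simp
qed

lemma packing_one: "packing h (Suc 0) U \<longleftrightarrow> (\<exists>A\<subseteq>U. h \<le> card A)"
  by (auto simp: nonadj_def intro: exI[of _ "{}"])

lemma packing_card: "packing h r U \<Longrightarrow> finite U \<Longrightarrow> r * h \<le> card U"
proof (induction r arbitrary: U)
  case (Suc r)
  then obtain A B where AB: "A \<subseteq> U" "B \<subseteq> U" "A \<inter> B = {}" "h \<le> card A" "packing h r B" by auto
  have fin: "finite A" "finite B" using AB Suc.prems finite_subset by blast+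
  then have "r * h \<le> card B" using Suc.IH AB by blast
  moreover have "card (A \<union> B) = card A + card B" using AB fin by (simp add: card_Un_disjoint)
  moreover have "card (A \<union> B) \<le> card U" using AB Suc.prems by (intro card_mono) auto
  ultimately show ?case using AB by simp
qed simp

text \<open>In terms of packings: the rank is at most one.\<close>

definition joined :: "nat \<Rightarrow> 'a set \<Rightarrow> bool" where
  "joined h S \<longleftrightarrow> (\<forall>A B. A \<subseteq> S \<longrightarrow> B \<subseteq> S \<longrightarrow> A \<inter> B = {} \<longrightarrow> h \<le> card A \<longrightarrow> h \<le> card B \<longrightarrow> \<not> nonadj A B)"

lemma joined_iff: "joined h S \<longleftrightarrow> \<not> packing h 2 S"
proof -
  have "packing h 2 S \<longleftrightarrow> (\<exists>A B. A \<subseteq> S \<and> B \<subseteq> S \<and> A \<inter> B = {} \<and> nonadj A B \<and> h \<le> card A \<and> (\<exists>C\<subseteq>B. h \<le> card C))"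
    unfolding numeral_2_eq_2 packing.simps(2)[of h "Suc 0"] packing_one ..
  also have "\<dots> \<longleftrightarrow> (\<exists>A B. A \<subseteq> S \<and> B \<subseteq> S \<and> A \<inter> B = {} \<and> nonadj A B \<and> h \<le> card A \<and> h \<le> card B)"
  proof
    assume "\<exists>A B. A \<subseteq> S \<and> B \<subseteq> S \<and> A \<inter> B = {} \<and> nonadj A B \<and> h \<le> card A \<and> (\<exists>C\<subseteq>B. h \<le> card C)"
    then obtain A B C where "A \<subseteq> S" "B \<subseteq> S" "A \<inter> B = {}" "nonadj A B" "h \<le> card A" "C \<subseteq> B" "h \<le> card C"
      by blast
    moreover from this have "nonadj A C" "A \<inter> C = {}" "C \<subseteq> S" using nonadj_mono[of A B A C] by blast+
    ultimately show "\<exists>A B. A \<subseteq> S \<and> B \<subseteq> S \<and> A \<inter> B = {} \<and> nonadj A B \<and> h \<le> card A \<and> h \<le> card B"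
      by blast
  qed blast
  finally show ?thesis unfolding joined_def by blast
qed

lemma joined_mono: "joined h S \<Longrightarrow> T \<subseteq> S \<Longrightarrow> joined h T"
  unfolding joined_def by (meson order_trans)

end

section \<open>Odd cycles as length adjusters\<close>

context sgraph
begin

text \<open>The measure of adjustability: an odd cycle provides \<open>hi\<close> =
  \<open>lo\<close> + 1, and linking such pieces adds up the intervals.\<close>

definition flex :: "'a \<Rightarrow> 'a \<Rightarrow> 'a set \<Rightarrow> nat \<Rightarrow> nat \<Rightarrow> bool" where
  "flex a b W lo hi \<longleftrightarrow> (\<forall>c. lo \<le> c \<longrightarrow> c \<le> hi \<longrightarrow> (\<exists>xs. pth W a b xs \<and> length xs = c))"

lemma flex_rev: "flex a b W lo hi \<Longrightarrow> flex b a W lo hi"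
  unfolding flex_def by (metis pth_rev length_rev)

lemma flex_mono: "flex a b W lo hi \<Longrightarrow> W \<subseteq> W' \<Longrightarrow> lo \<le> lo' \<Longrightarrow> flex a b W' lo' hi"
  unfolding flex_def by (meson order_trans pth_mono)

lemma flex_append:
  assumes f: "flex a b W lo hi" and g: "flex c d W' lo' hi'" and adj: "adj b c" and dis: "W \<inter> W' = {}"
    and le: "lo \<le> hi" "lo' \<le> hi'"
  shows "flex a d (W \<union> W') (lo + lo') (hi + hi')"
  unfolding flex_def
proof (intro allI impI)
  fix e assume e: "lo + lo' \<le> e" "e \<le> hi + hi'"
  \<comment> \<open>Sum of two intervals: the second summand stays minimal as long as the first can
    make up the rest, afterwards the first is maximal.\<close>
  obtain x y where xy: "lo \<le> x" "x \<le> hi" "lo' \<le> y" "y \<le> hi'" "e = x + y"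
  proof (cases "e \<le> hi + lo'")
    case True
    then show ?thesis using e le by (intro that[of "e - lo'" lo']) auto
  next
    case False
    then show ?thesis using e le by (intro that[of hi "e - hi"]) auto
  qed
  obtain xs where xs: "pth W a b xs" "length xs = x" using f xy unfolding flex_def by blast
  obtain ys where ys: "pth W' c d ys" "length ys = y" using g xy unfolding flex_def by blast
  have "set xs \<inter> set ys = {}" using pth_in(3)[OF xs(1)] pth_in(3)[OF ys(1)] dis by blast
  then have "pth (W \<union> W') a d (xs @ ys)" by (rule pth_append[OF xs(1) ys(1) adj])
  then show "\<exists>zs. pth (W \<union> W') a d zs \<and> length zs = e" using xs ys xy by (intro exI[of _ "xs @ ys"]) simp
qed

section \<open>Breadth-first layers and short odd cycles\<close>

primrec ball :: "'a set \<Rightarrow> 'a \<Rightarrow> nat \<Rightarrow> 'a set" where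
  "ball X v 0 = {v}"
| "ball X v (Suc i) = ball X v i \<union> {y \<in> X. \<exists>x \<in> ball X v i. adj x y}"

definition level :: "'a set \<Rightarrow> 'a \<Rightarrow> nat \<Rightarrow> 'a set" where
  "level X v i = ball X v i - (if i = 0 then {} else ball X v (i - 1))"

lemma ball_mono: "i \<le> j \<Longrightarrow> ball X v i \<subseteq> ball X v j"
  by (rule lift_Suc_mono_le[of "ball X v"]) auto

lemma ball_sub: "v \<in> X \<Longrightarrow> ball X v i \<subseteq> X"
  by (induction i) auto

lemma level_less:
  assumes "x \<in> level X v i" "i < j" shows "x \<notin> level X v j"
proof -
  have "i \<le> j - 1" using assms by simp
  then have "ball X v i \<subseteq> ball X v (j - 1)" by (rule ball_mono)
  then show ?thesis using assms unfolding level_def by auto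
qed

lemma level_inj: "x \<in> level X v i \<Longrightarrow> x \<in> level X v j \<Longrightarrow> i = j"
  using level_less by (metis linorder_neqE_nat)

lemma ball_level: "x \<in> ball X v i \<Longrightarrow> \<exists>j\<le>i. x \<in> level X v j"
proof (induction i)
  case (Suc i)
  then show ?case
  proof (cases "x \<in> ball X v i")
    case True then show ?thesis using Suc by (meson le_SucI)
  next
    case False then show ?thesis using Suc.prems unfolding level_def by (intro exI[of _ "Suc i"]) auto
  qed
qed (auto simp: level_def)

lemma level_far:
  assumes "x \<in> level X v i" "y \<in> level X v j" "Suc i < j" "v \<in> X" shows "\<not> adj x y"
proof
  assume "adj x y"
  moreover have "y \<in> X" using assms ball_sub unfolding level_def by auto
  ultimately have "y \<in> ball X v (Suc i)" using assms(1) unfolding level_def by auto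
  moreover have "ball X v (Suc i) \<subseteq> ball X v (j - 1)" using assms(3) by (intro ball_mono) simp
  ultimately have "y \<in> ball X v (j - 1)" by blast
  then show False using assms unfolding level_def by auto
qed

lemma level_path:
  assumes "v \<in> X" "y \<in> level X v i"
  shows "\<exists>xs. length xs = Suc i \<and> hd xs = v \<and> last xs = y \<and> successively adj xs \<and> (\<forall>j\<le>i. xs ! j \<in> level X v j)"
  using assms(2)
proof (induction i arbitrary: y)
  case 0
  then show ?case by (intro exI[of _ "[y]"]) (auto simp: level_def)
next
  case (Suc i)
  then have "y \<in> ball X v (Suc i)" "y \<notin> ball X v i" unfolding level_def by auto
  then obtain x where x: "x \<in> ball X v i" "adj x y" "y \<in> X" by auto
  have "x \<in> level X v i"
  proof (cases i)
    case (Suc k)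
    have "x \<notin> ball X v k" using x \<open>y \<notin> ball X v i\<close> Suc by auto
    then show ?thesis using x Suc unfolding level_def by auto
  qed (use x in \<open>auto simp: level_def\<close>)
  then obtain xs where xs: "length xs = Suc i" "hd xs = v" "last xs = x" "successively adj xs" "\<forall>j\<le>i. xs ! j \<in> level X v j"
    using Suc.IH by blast
  moreover have "xs \<noteq> []" using xs by auto
  ultimately show ?case using x Suc.prems
    by (intro exI[of _ "xs @ [y]"]) (auto simp: successively_append_iff nth_append le_Suc_eq)
qed

text \<open>Equal vertices have equal levels, so the breadth-first paths to u and w do not meet
  again after their last common index. Together with the edge between u and w the two branches form
  an odd cycle, and its two arcs from the branching vertex to w differ in length by one.\<close>

lemma odd_gadget_of_level_edge:
  assumes v: "v \<in> X" and u: "u \<in> level X v j" and w: "w \<in> level X v j" and uw: "adj u w"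
  shows "\<exists>p q W lo. p \<noteq> q \<and> p \<in> W \<and> q \<in> W \<and> W \<subseteq> X \<and> finite W \<and> card W \<le> 2 * j + 2 \<and> flex p q W lo (Suc lo)"
proof -
  obtain xs where xs: "length xs = Suc j" "hd xs = v" "last xs = u" "successively adj xs" "\<And>i. i \<le> j \<Longrightarrow> xs ! i \<in> level X v i"
    using level_path[OF v u] by blast
  obtain ys where ys: "length ys = Suc j" "hd ys = v" "last ys = w" "successively adj ys" "\<And>i. i \<le> j \<Longrightarrow> ys ! i \<in> level X v i"
    using level_path[OF v w] by blast
  have dis: "distinct xs" "distinct ys"
    unfolding distinct_conv_nth using xs ys level_inj by (metis less_Suc_eq_le)+
  have lX: "level X v i \<subseteq> X" for i using ball_sub[OF v] unfolding level_def by blast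
  have sub: "set xs \<subseteq> X" "set ys \<subseteq> X"
    using xs(1,5) ys(1,5) lX by (metis in_set_conv_nth less_Suc_eq_le subsetD subsetI)+
  have ne: "xs \<noteq> []" "ys \<noteq> []" using xs ys by auto
  have lst: "xs ! j = u" "ys ! j = w" using xs ys ne by (auto simp: last_conv_nth)
  have px: "pth X v u xs" "pth X v w ys" unfolding pth_def using xs ys dis sub ne by auto
  define C where "C = {i. i \<le> j \<and> xs ! i = ys ! i}"
  have C: "finite C" "0 \<in> C" unfolding C_def using xs ys ne by (auto simp: hd_conv_nth)
  define i where "i = Max C"
  have iC: "i \<in> C" unfolding i_def using C by (intro Max_in) auto
  have imax: "k \<le> i" if "k \<in> C" for k unfolding i_def using C that by simp
  have "u \<noteq> w" using uw adj_irrefl by auto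
  then have "j \<notin> C" using lst unfolding C_def by auto
  then have ij: "i < j" using iC unfolding C_def by (metis (mono_tags) le_neq_implies_less mem_Collect_eq)
  let ?p = "xs ! i" and ?A = "drop i xs" and ?B = "drop i ys"
  have A: "pth X ?p u ?A" using pth_drop[OF px(1)] ij xs by simp
  have B: "pth X ?p w ?B" using pth_drop[OF px(2)] ij ys iC unfolding C_def by auto
  \<comment> \<open>The path to u meets level j only in u, which differs from w.\<close>
  have wA: "w \<notin> set ?A"
  proof
    assume "w \<in> set ?A"
    then have "w \<in> set xs" using set_drop_subset by fast
    then obtain k where k: "k \<le> j" "xs ! k = w" using xs(1) by (metis in_set_conv_nth less_Suc_eq_le)
    then have "k = j" using level_inj[OF _ w] xs(5) by metis
    then show False using k lst \<open>u \<noteq> w\<close> by simp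
  qed
  define W where "W = set ?A \<union> set ?B"
  have "card W \<le> card (set ?A) + card (set ?B)" unfolding W_def by (rule card_Un_le)
  also have "\<dots> \<le> length ?A + length ?B" by (intro add_mono card_length)
  also have "\<dots> \<le> 2 * j + 2" using xs ys by simp
  finally have cW: "card W \<le> 2 * j + 2" .
  have l1: "pth W ?p w ?B" using pth_restrict[OF B] pth_mono unfolding W_def by blast
  have wW: "w \<in> W" using pth_in(2)[OF B] unfolding W_def by simp
  have "pth (set ?A) ?p u ?A" using pth_restrict[OF A] .
  then have "pth (set ?A \<union> {w}) ?p w (?A @ [w])"
    using wA uw by (intro pth_append[of _ ?p u ?A "{w}" w w "[w]"]) (auto simp: pth_single)
  then have l2: "pth W ?p w (?A @ [w])" using wW pth_mono[of "set ?A \<union> {w}"] unfolding W_def by auto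
  have "flex ?p w W (length ?B) (Suc (length ?B))"
    unfolding flex_def
  proof (intro allI impI)
    fix c assume "length ?B \<le> c" "c \<le> Suc (length ?B)"
    then have "c = length ?B \<or> c = length (?A @ [w])" using xs ys by auto
    then show "\<exists>zs. pth W ?p w zs \<and> length zs = c" using l1 l2 by blast
  qed
  moreover have "?p \<in> set ?A" using pth_in(1)[OF A] .
  moreover have "?p \<noteq> w" using wA \<open>?p \<in> set ?A\<close> by auto
  moreover have "W \<subseteq> X" using sub set_drop_subset[of i xs] set_drop_subset[of i ys] unfolding W_def by blast
  ultimately show ?thesis using cW wW unfolding W_def
    by (intro exI[of _ ?p] exI[of _ w] exI[of _ "set ?A \<union> set ?B"] exI[of _ "length ?B"]) auto
qed

definition gadget :: "nat \<Rightarrow> 'a \<Rightarrow> 'a \<Rightarrow> 'a set \<Rightarrow> bool" where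
  "gadget l p q W \<longleftrightarrow> p \<noteq> q \<and> p \<in> W \<and> q \<in> W \<and> finite W \<and> card W \<le> l \<and> (\<exists>lo. flex p q W lo (Suc lo))"

text \<open>Ball growing: for some i at most \<open>lam\<close> the ball of radius i + 1 is at most
  twice the ball of radius i, for otherwise X would have 2 ^ (\<open>lam\<close> + 1) vertices.
  Without adjusters all layers up to i are independent, so the even or the odd ones form an
  independent set with half of the ball and thus a quarter of the next ball. The next ball is
  deleted and the induction continues on the rest.\<close>

lemma large_indep_if_no_gadget:
  assumes "finite X" "card X < 2 ^ Suc lam" "\<not> (\<exists>p q W. W \<subseteq> X \<and> gadget (2 * lam + 2) p q W)"
  shows "\<exists>I\<subseteq>X. nonadj I I \<and> card X \<le> 4 * card I"
  using assms
proof (induction "card X" arbitrary: X rule: less_induct)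
  case less
  show ?case
  proof (cases "X = {}")
    case True then show ?thesis by (intro exI[of _ "{}"]) (auto simp: nonadj_def)
  next
    case False
    then obtain v where v: "v \<in> X" by blast
    have fb: "finite (ball X v i)" for i using ball_sub[OF v] less.prems finite_subset by blast
    have "\<exists>i\<le>lam. card (ball X v (Suc i)) \<le> 2 * card (ball X v i)"
    proof (rule ccontr)
      assume "\<not> ?thesis"
      then have g: "2 * card (ball X v i) < card (ball X v (Suc i))" if "i \<le> lam" for i using that by force
      have "i \<le> Suc lam \<Longrightarrow> 2 ^ i \<le> card (ball X v i)" for i
      proof (induction i)
        case (Suc i) then show ?case using g[of i] by simp
      qed simp
      then have "2 ^ Suc lam \<le> card (ball X v (Suc lam))" by blast
      also have "\<dots> \<le> card X" using ball_sub[OF v] less.prems by (intro card_mono) auto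
      finally show False using less.prems by simp
    qed
    then obtain i where i: "i \<le> lam" "card (ball X v (Suc i)) \<le> 2 * card (ball X v i)" by blast
    have lev_ind: "\<not> adj x y" if xy: "x \<in> level X v j" "y \<in> level X v j" "j \<le> i" for x y j
    proof
      assume "adj x y"
      then obtain p q W lo where "p \<noteq> q" "p \<in> W" "q \<in> W" "W \<subseteq> X" "finite W" "card W \<le> 2 * j + 2" "flex p q W lo (Suc lo)"
        using odd_gadget_of_level_edge[OF v xy(1,2)] by blast
      then have "gadget (2 * lam + 2) p q W" unfolding gadget_def using xy i by auto
      then show False using less.prems \<open>W \<subseteq> X\<close> by blast
    qed
    \<comment> \<open>The layers whose index has the parity selected by b. Edges join only equal or
      consecutive layers, so distinct layers of one parity are not adjacent.\<close>
    define P where "P = (\<lambda>b::bool. {x. \<exists>j\<le>i. even j = b \<and> x \<in> level X v j})"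
    have Pind: "nonadj (P b) (P b)" for b
      unfolding nonadj_def
    proof (intro ballI)
      fix x y assume "x \<in> P b" "y \<in> P b"
      then obtain j k where jk: "j \<le> i" "k \<le> i" "even j = even k" "x \<in> level X v j" "y \<in> level X v k"
        unfolding P_def by blast
      consider "j = k" | "Suc j < k" | "Suc k < j"
        using jk(3) by (metis Suc_lessI even_Suc linorder_neqE_nat)
      then show "\<not> adj x y"
        using lev_ind jk level_far[OF _ _ _ v] adj_sym by cases blast+
    qed
    have Psub: "P b \<subseteq> ball X v i" for b
    proof
      fix x assume "x \<in> P b"
      then obtain j where "j \<le> i" "x \<in> ball X v j" unfolding P_def level_def by auto
      then show "x \<in> ball X v i" using ball_mono by blast
    qed
    have "ball X v i \<subseteq> P True \<union> P False" unfolding P_def using ball_level by fastforce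
    then have "card (ball X v i) \<le> card (P True \<union> P False)"
      using finite_subset[OF Psub fb] by (intro card_mono) simp_all
    also have "\<dots> \<le> card (P True) + card (P False)" by (rule card_Un_le)
    finally have "card (ball X v i) \<le> card (P True) + card (P False)" .
    then have "card (ball X v i) \<le> 2 * card (P True) \<or> card (ball X v i) \<le> 2 * card (P False)"
      by linarith
    then obtain b where b: "card (ball X v i) \<le> 2 * card (P b)" by blast
    \<comment> \<open>Radius i + 1 instead of i: this also removes every neighbour of
      \<open>P b\<close>.\<close>
    let ?X = "X - ball X v (Suc i)"
    have vb: "v \<in> ball X v (Suc i)" using ball_mono[of 0 "Suc i" X v] by auto
    have lt: "card ?X < card X" using v vb less.prems by (intro psubset_card_mono) auto
    have "\<exists>I\<subseteq>?X. nonadj I I \<and> card ?X \<le> 4 * card I"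
    proof (rule less.hyps[OF lt])
      show "finite ?X" using less.prems by simp
      show "card ?X < 2 ^ Suc lam" using lt less.prems by simp
      show "\<not> (\<exists>p q W. W \<subseteq> ?X \<and> gadget (2 * lam + 2) p q W)" using less.prems(3) by blast
    qed
    then obtain I where I: "I \<subseteq> ?X" "nonadj I I" "card ?X \<le> 4 * card I" by blast
    have PX: "P b \<subseteq> X" using Psub ball_sub[OF v] by blast
    have "nonadj (P b) I"
      unfolding nonadj_def using Psub I(1) by auto
    then have "nonadj (I \<union> P b) (I \<union> P b)"
      using I Pind nonadj_sym unfolding nonadj_def by blast
    moreover have fin: "finite I" "finite (P b)" using I(1) PX less.prems finite_subset by blast+
    moreover have "I \<inter> P b = {}" using I(1) Psub ball_mono[of i "Suc i" X v] by auto
    then have cI: "card (I \<union> P b) = card I + card (P b)" using fin by (simp add: card_Un_disjoint)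
    have "card X = card ?X + card (ball X v (Suc i))"
      using ball_sub[OF v] fb less.prems by (metis card_Diff_subset card_mono le_add_diff_inverse2)
    then have "card X \<le> 4 * card (I \<union> P b)" using cI I(3) i(2) b by linarith
    ultimately show ?thesis using I(1) PX by (intro exI[of _ "I \<union> P b"]) auto
  qed
qed

text \<open>Restricting to exactly 4 h vertices keeps the size below 2 ^ (\<open>lam\<close> + 1),
  and a quarter of them is an independent set of the size h that \<open>edgy\<close>
  forbids.\<close>

lemma gadget_exists:
  assumes "finite X" "edgy h X" "4 * h \<le> card X" "4 * h < 2 ^ Suc lam"
  shows "\<exists>p q W. W \<subseteq> X \<and> gadget (2 * lam + 2) p q W"
proof (rule ccontr)
  assume no: "\<not> ?thesis"
  obtain Y where Y: "Y \<subseteq> X" "card Y = 4 * h" using assms by (metis obtain_subset_with_card_n)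
  have "finite Y" using Y assms(1) finite_subset by blast
  moreover have "\<not> (\<exists>p q W. W \<subseteq> Y \<and> gadget (2 * lam + 2) p q W)" using no Y(1) by (meson order_trans)
  ultimately have "\<exists>I\<subseteq>Y. nonadj I I \<and> card Y \<le> 4 * card I"
    using Y(2) assms(4) by (intro large_indep_if_no_gadget[of Y lam]) simp_all
  then obtain I where I: "I \<subseteq> Y" "nonadj I I" "card Y \<le> 4 * card I" by meson
  then have "h \<le> card I" "I \<subseteq> X" using Y by auto
  then show False using edgyD[OF assms(2), of I] I(2) unfolding nonadj_def by meson
qed

lemma many_gadgets:
  assumes "finite S" "edgy h S" "4 * h < 2 ^ Suc lam" "T * (2 * lam + 2) + 4 * h \<le> card S"
  shows "\<exists>p q W. (\<forall>i<T. W i \<subseteq> S \<and> gadget (2 * lam + 2) (p i) (q i) (W i)) \<and> (\<forall>i<T. \<forall>j<T. i \<noteq> j \<longrightarrow> W i \<inter> W j = {})"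
  using assms(4)
proof (induction T)
  case (Suc T)
  have "T * (2 * lam + 2) + 4 * h \<le> card S" using Suc.prems by simp
  then obtain p q W where IH: "\<And>i. i < T \<Longrightarrow> W i \<subseteq> S \<and> gadget (2 * lam + 2) (p i) (q i) (W i)"
    "\<And>i j. i < T \<Longrightarrow> j < T \<Longrightarrow> i \<noteq> j \<Longrightarrow> W i \<inter> W j = {}" using Suc.IH by metis
  let ?R = "\<Union> (W ` {..<T})"
  have "card ?R \<le> (\<Sum>i<T. card (W i))" by (rule card_UN_le) simp
  also have "\<dots> \<le> (\<Sum>i<T. 2 * lam + 2)" using IH(1) by (intro sum_mono) (auto simp: gadget_def)
  finally have cR: "card ?R \<le> T * (2 * lam + 2)" by simp
  have "4 * h \<le> card (S - ?R)" using cR Suc.prems diff_card_le_card_Diff[of ?R S] assms(1) IH(1)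
    by (auto simp: gadget_def)
  then obtain p' q' W' where g: "W' \<subseteq> S - ?R" "gadget (2 * lam + 2) p' q' W'"
    using gadget_exists[of "S - ?R" h lam] assms edgy_mono[of h S "S - ?R"] by auto
  show ?case
    using IH g by (intro exI[of _ "p(T := p')"] exI[of _ "q(T := q')"] exI[of _ "W(T := W')"])
      (auto simp: less_Suc_eq)
qed auto

end

section \<open>Depth-first search on chains of beads\<close>

context sgraph
begin

lemma joinedD: "joined h S \<Longrightarrow> A \<subseteq> S \<Longrightarrow> B \<subseteq> S \<Longrightarrow> A \<inter> B = {} \<Longrightarrow> h \<le> card A \<Longrightarrow> h \<le> card B \<Longrightarrow> \<not> nonadj A B"
  unfolding joined_def by simp

text \<open>A bead \<open>i\<close> has two terminals \<open>pt i True\<close> and \<open>pt i False\<close>; the pair \<open>(i, d)\<close> stands for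
  entering it at \<open>pt i d\<close> and leaving it at the other terminal.\<close>

definition chain :: "('b \<Rightarrow> bool \<Rightarrow> 'a) \<Rightarrow> ('b \<times> bool) list \<Rightarrow> bool" where
  "chain pt os \<longleftrightarrow> distinct (map fst os) \<and>
     successively (\<lambda>u v. adj (pt (fst u) (\<not> snd u)) (pt (fst v) (snd v))) os"

text \<open>A snapshot of the search: \<open>os\<close> is the current chain, T the beads given up
  by backtracking, U the untouched beads, and \<open>x\<close> the terminal at which the search got
  stuck in a bead of T. The last clause persists because U only shrinks.\<close>

definition dfs_state :: "('b \<Rightarrow> bool \<Rightarrow> 'a) \<Rightarrow> 'b set \<Rightarrow> ('b \<times> bool) list \<Rightarrow> 'b set \<Rightarrow> 'b set \<Rightarrow> ('b \<Rightarrow> 'a) \<Rightarrow> bool" where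
  "dfs_state pt I os T U x \<longleftrightarrow> chain pt os \<and> fst ` set os \<union> T \<union> U = I \<and> fst ` set os \<inter> T = {} \<and>
     fst ` set os \<inter> U = {} \<and> T \<inter> U = {} \<and> (\<forall>i\<in>T. \<exists>d. x i = pt i d) \<and>
     (\<forall>i\<in>T. \<forall>j\<in>U. \<forall>d. \<not> adj (x i) (pt j d))"

text \<open>Advancing adds a bead to \<open>os\<close>; retreating moves its last bead to T. As T
  counts twice, the measure increases in both cases.\<close>

lemma dfs_step:
  assumes st: "dfs_state pt I os T U x" and fin: "finite I" and lt: "card T < card I"
  shows "\<exists>os' T' U' x'. dfs_state pt I os' T' U' x' \<and> card T' \<le> Suc (card T) \<and>
    2 * card T + length os < 2 * card T' + length os'"
proof (cases "os = []")
  case True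
  have "U \<noteq> {}" using st lt True unfolding dfs_state_def by auto
  then obtain i where i: "i \<in> U" by blast
  have "dfs_state pt I [(i, True)] T (U - {i}) x"
    using st i True unfolding dfs_state_def chain_def by auto
  then show ?thesis using True by (intro exI[of _ "[(i, True)]"] exI[of _ T] exI[of _ "U - {i}"] exI[of _ x]) auto
next
  case False
  then obtain us i d where os: "os = us @ [(i, d)]" by (metis rev_exhaust surj_pair)
  show ?thesis
  proof (cases "\<exists>j\<in>U. \<exists>e. adj (pt i (\<not> d)) (pt j e)")
    case True
    then obtain j e where j: "j \<in> U" "adj (pt i (\<not> d)) (pt j e)" by blast
    have "j \<notin> fst ` set os" using st j(1) unfolding dfs_state_def by blast
    then have "chain pt (os @ [(j, e)])"
      using st j(2) os unfolding dfs_state_def chain_def by (auto simp: successively_append_iff)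
    then have "dfs_state pt I (os @ [(j, e)]) T (U - {j}) x"
      using st j(1) \<open>j \<notin> fst ` set os\<close> unfolding dfs_state_def by auto
    then show ?thesis by (intro exI[of _ "os @ [(j, e)]"] exI[of _ T] exI[of _ "U - {j}"] exI[of _ x]) auto
  next
    case no: False
    have iT: "i \<notin> T" using st os unfolding dfs_state_def by auto
    have iU: "i \<notin> U" using st os unfolding dfs_state_def by auto
    have ius: "i \<notin> fst ` set us" using st os unfolding dfs_state_def chain_def by auto
    have fT: "finite T" using st fin unfolding dfs_state_def by (metis finite_Un)
    have "dfs_state pt I us (insert i T) U (x(i := pt i (\<not> d)))"
      using st os no iT iU ius unfolding dfs_state_def chain_def by (auto simp: successively_append_iff)
    moreover have "card (insert i T) = Suc (card T)" using iT fT by simp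
    ultimately show ?thesis using os
      by (intro exI[of _ us] exI[of _ "insert i T"] exI[of _ U] exI[of _ "x(i := pt i (\<not> d))"]) auto
  qed
qed

text \<open>T grows by at most one bead per step, so the value t cannot be skipped. It is reached,
  because below it the increasing measure is bounded by 2 t + |I|.\<close>

lemma dfs_exists:
  assumes "finite I" "t \<le> card I"
  shows "\<exists>os T U x. dfs_state pt I os T U x \<and> card T = t"
proof -
  have "\<exists>os T U x. dfs_state pt I os T U x \<and> (card T = t \<or> card T < t \<and> m \<le> 2 * card T + length os)" for m
  proof (induction m)
    case 0
    have "dfs_state pt I [] {} I (\<lambda>i. pt i True)" unfolding dfs_state_def chain_def by auto
    then show ?case by (cases t) force+
  next
    case (Suc m)
    then obtain os T U x where s: "dfs_state pt I os T U x" "card T = t \<or> card T < t \<and> m \<le> 2 * card T + length os"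
      by blast
    show ?case
    proof (cases "card T = t")
      case False
      then have lt: "card T < t" using s by simp
      obtain os' T' U' x' where "dfs_state pt I os' T' U' x'" "card T' \<le> Suc (card T)"
        "2 * card T + length os < 2 * card T' + length os'"
        using dfs_step[OF s(1) assms(1)] lt assms(2) by (metis order_less_le_trans)
      then show ?thesis using lt s(2) False
        by (intro exI[of _ os'] exI[of _ T'] exI[of _ U'] exI[of _ x']) auto
    qed (use s in blast)
  qed
  from this[of "Suc (2 * t + card I)"] obtain os T U x where s: "dfs_state pt I os T U x"
    "card T = t \<or> card T < t \<and> Suc (2 * t + card I) \<le> 2 * card T + length os" by blast
  have "length os = card (fst ` set os)" using s(1) unfolding dfs_state_def chain_def
    by (metis distinct_card length_map set_map)
  also have "\<dots> \<le> card I" using s(1) assms(1) unfolding dfs_state_def by (intro card_mono) auto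
  finally show ?thesis using s by auto
qed

lemma chain_take: "chain pt os \<Longrightarrow> chain pt (take m os)"
proof -
  assume "chain pt os"
  then have "chain pt (take m os @ drop m os)" by simp
  then show ?thesis unfolding chain_def successively_append_iff map_append distinct_append by simp
qed

text \<open>Distinct beads have disjoint terminals, so cardinality and disjointness pass from beads
  to the vertices representing them.\<close>

lemma dfs_exits_card:
  assumes "dfs_state pt I os T U x" "\<And>i j d e. i \<in> I \<Longrightarrow> j \<in> I \<Longrightarrow> pt i d = pt j e \<Longrightarrow> i = j"
  shows "card (x ` T) = card T" "x ` T \<inter> (\<lambda>i. pt i True) ` U = {}" "card ((\<lambda>i. pt i True) ` U) = card U"
proof -
  have sub: "T \<subseteq> I" "U \<subseteq> I" and TU: "T \<inter> U = {}" and xT: "\<And>i. i \<in> T \<Longrightarrow> \<exists>d. x i = pt i d"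
    using assms(1) unfolding dfs_state_def by auto
  have "inj_on x T"
  proof (rule inj_onI)
    fix i j assume ij: "i \<in> T" "j \<in> T" "x i = x j"
    obtain d e where "x i = pt i d" "x j = pt j e" using xT ij by blast
    then show "i = j" using assms(2)[of i j d e] ij sub by auto
  qed
  then show "card (x ` T) = card T" by (rule card_image)
  show "x ` T \<inter> (\<lambda>i. pt i True) ` U = {}"
  proof (rule ccontr)
    assume "\<not> ?thesis"
    then obtain i j where ij: "i \<in> T" "j \<in> U" "x i = pt j True" by blast
    obtain d where "x i = pt i d" using xT ij by blast
    then have "i = j" using assms(2)[of i j d True] ij sub by auto
    then show False using ij TU by blast
  qed
  have "inj_on (\<lambda>i. pt i True) U" using assms(2) sub unfolding inj_on_def by blast
  then show "card ((\<lambda>i. pt i True) ` U) = card U" by (rule card_image)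
qed

lemma dfs_card:
  assumes "dfs_state pt I os T U x" "finite I"
  shows "card I = length os + card T + card U"
proof -
  have f: "finite T" "finite U" using assms unfolding dfs_state_def by (metis finite_Un)+
  have "length os = card (fst ` set os)" using assms(1) unfolding dfs_state_def chain_def
    by (metis distinct_card length_map set_map)
  moreover have I: "I = (fst ` set os \<union> T) \<union> U" "(fst ` set os \<union> T) \<inter> U = {}"
    using assms(1) unfolding dfs_state_def by auto
  have "card I = card (fst ` set os \<union> T) + card U"
    unfolding I(1) by (rule card_Un_disjoint[OF _ _ I(2)]) (use f in auto)
  moreover have "card (fst ` set os \<union> T) = card (fst ` set os) + card T" using assms f
    unfolding dfs_state_def by (intro card_Un_disjoint) auto
  ultimately show ?thesis by simp
qed

text \<open>The search is stopped with h abandoned beads. If its chain has fewer than m beads, then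
  U has lost fewer than h + m beads, and the h exits of the abandoned beads are not adjacent to any
  terminal in U. Hence the rank available in U has dropped by one.\<close>

lemma chain_of_rank:
  assumes "finite I" "Suc r * (h + m) \<le> card I" "\<not> packing h (Suc r) {pt i d | i d. i \<in> I}"
    and inj: "\<And>i j d e. i \<in> I \<Longrightarrow> j \<in> I \<Longrightarrow> pt i d = pt j e \<Longrightarrow> i = j"
  shows "\<exists>os. chain pt os \<and> fst ` set os \<subseteq> I \<and> length os = m"
  using assms
proof (induction r arbitrary: I)
  case 0
  have "inj_on (\<lambda>i. pt i True) I" using 0(4) unfolding inj_on_def by blast
  then have "card ((\<lambda>i. pt i True) ` I) = card I" by (rule card_image)
  moreover have "(\<lambda>i. pt i True) ` I \<subseteq> {pt i d | i d. i \<in> I}" by blast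
  moreover have "h \<le> card I" using 0(2) by simp
  ultimately have "packing h (Suc 0) {pt i d | i d. i \<in> I}"
    unfolding packing_one by (intro exI[of _ "(\<lambda>i. pt i True) ` I"]) simp
  then show ?case using 0(3) by blast
next
  case (Suc r)
  have "h \<le> card I" using Suc.prems(2) by simp
  then obtain os T U x where s: "dfs_state pt I os T U x" "card T = h"
    using dfs_exists[OF Suc.prems(1), of h pt] by blast
  show ?case
  proof (cases "m \<le> length os")
    case True
    then show ?thesis using s(1) chain_take[of pt os m] unfolding dfs_state_def
      by (intro exI[of _ "take m os"]) (auto dest: in_set_takeD)
  next
    case False
    have UI: "U \<subseteq> I" "T \<subseteq> I" using s(1) unfolding dfs_state_def by auto
    have "Suc r * (h + m) \<le> card U" using dfs_card[OF s(1) Suc.prems(1)] s(2) False Suc.prems(2) by simp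
    moreover have "\<not> packing h (Suc r) {pt i d | i d. i \<in> U}"
    proof
      assume packing: "packing h (Suc r) {pt i d | i d. i \<in> U}"
      have xT: "\<And>i. i \<in> T \<Longrightarrow> \<exists>d. x i = pt i d" using s(1) unfolding dfs_state_def by blast
      have TU: "T \<inter> U = {}" using s(1) unfolding dfs_state_def by blast
      have "x ` T \<inter> {pt i d | i d. i \<in> U} = {}"
      proof (rule ccontr)
        assume "\<not> ?thesis"
        then obtain i j d where ij: "i \<in> T" "j \<in> U" "x i = pt j d" by blast
        obtain e where "x i = pt i e" using xT ij by blast
        then have "i = j" using Suc.prems(4)[of i j e d] UI ij by auto
        then show False using ij TU by blast
      qed
      moreover have "nonadj (x ` T) {pt i d | i d. i \<in> U}"
        using s(1) unfolding dfs_state_def nonadj_def by blast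
      moreover have "h \<le> card (x ` T)" using dfs_exits_card(1)[OF s(1) Suc.prems(4)] s(2) by simp
      moreover have "x ` T \<subseteq> {pt i d | i d. i \<in> I}" using xT UI by blast
      moreover have "{pt i d | i d. i \<in> U} \<subseteq> {pt i d | i d. i \<in> I}" using UI by blast
      ultimately have "packing h (Suc (Suc r)) {pt i d | i d. i \<in> I}"
        using packing unfolding packing.simps(2)[of h "Suc r"]
        by (intro exI[of _ "x ` T"] exI[of _ "{pt i d | i d. i \<in> U}"] conjI)
      then show False using Suc.prems(3) by blast
    qed
    moreover have "finite U" using UI(1) Suc.prems(1) finite_subset by blast
    moreover have "\<And>i j d e. i \<in> U \<Longrightarrow> j \<in> U \<Longrightarrow> pt i d = pt j e \<Longrightarrow> i = j" using Suc.prems(4) UI(1) by blast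
    ultimately have "\<exists>os. chain pt os \<and> fst ` set os \<subseteq> U \<and> length os = m" by (intro Suc.IH) simp_all
    then obtain os where "chain pt os" "fst ` set os \<subseteq> U" "length os = m" by blast
    then show ?thesis using UI(1) by (intro exI[of _ os]) auto
  qed
qed

text \<open>Once h beads are abandoned, fewer than h are untouched, for otherwise the exits and the
  untouched terminals would contain two non-adjacent h-sets. All other beads are on the
  chain.\<close>

lemma chain_of_joined:
  assumes "finite I" "h \<le> card I" "joined h {pt i d | i d. i \<in> I}"
    and inj: "\<And>i j d e. i \<in> I \<Longrightarrow> j \<in> I \<Longrightarrow> pt i d = pt j e \<Longrightarrow> i = j"
  shows "\<exists>os. chain pt os \<and> fst ` set os \<subseteq> I \<and> card I \<le> length os + 2 * h"
proof -
  obtain os T U x where s: "dfs_state pt I os T U x" "card T = h"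
    using dfs_exists[OF assms(1,2), of pt] by blast
  have "card U < h"
  proof (rule ccontr)
    assume "\<not> card U < h"
    moreover have "nonadj (x ` T) ((\<lambda>i. pt i True) ` U)" using s(1) unfolding dfs_state_def nonadj_def by blast
    moreover have "x ` T \<subseteq> {pt i d | i d. i \<in> I}" "(\<lambda>i. pt i True) ` U \<subseteq> {pt i d | i d. i \<in> I}"
      using s(1) unfolding dfs_state_def by blast+
    moreover have "\<not> nonadj (x ` T) ((\<lambda>i. pt i True) ` U)"
      using calculation dfs_exits_card[OF s(1) inj] s(2) by (intro joinedD[OF assms(3)]) simp_all
    ultimately show False by simp
  qed
  then have "card I \<le> length os + 2 * h" using dfs_card[OF s(1) assms(1)] s(2) by simp
  moreover have "chain pt os" "fst ` set os \<subseteq> I" using s(1) unfolding dfs_state_def by auto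
  ultimately show ?thesis by blast
qed

text \<open>A single vertex is a bead whose two terminals coincide, so the chain lemmas specialize
  to paths.\<close>

lemma pth_of_chain_id:
  assumes "chain (\<lambda>v d. v) os" "os \<noteq> []" "fst ` set os \<subseteq> S"
  shows "pth S (fst (hd os)) (fst (last os)) (map fst os)"
  using assms unfolding chain_def pth_def by (auto simp: successively_map hd_map last_map)

lemma long_path_of_rank:
  assumes "finite S" "Suc r * (h + m) \<le> card S" "\<not> packing h (Suc r) S" "0 < m"
  shows "\<exists>a b xs. pth S a b xs \<and> length xs = m"
proof -
  have "{v | v (d::bool). v \<in> S} = S" by auto
  then have "\<exists>os. chain (\<lambda>v (d::bool). v) os \<and> fst ` set os \<subseteq> S \<and> length os = m"
    using assms by (intro chain_of_rank[where r = r and h = h]) auto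
  then obtain os where os: "chain (\<lambda>v (d::bool). v) os" "fst ` set os \<subseteq> S" "length os = m" by blast
  then have "pth S (fst (hd os)) (fst (last os)) (map fst os)"
    using assms(4) by (intro pth_of_chain_id) auto
  then show ?thesis using os(3) length_map[of fst os] by blast
qed

lemma long_path_of_joined:
  assumes "finite S" "2 * h < card S" "joined h S"
  shows "\<exists>a b xs. pth S a b xs \<and> card S \<le> length xs + 2 * h"
proof -
  have "{v | v (d::bool). v \<in> S} = S" by auto
  then have "\<exists>os. chain (\<lambda>v (d::bool). v) os \<and> fst ` set os \<subseteq> S \<and> card S \<le> length os + 2 * h"
    using assms by (intro chain_of_joined) auto
  then obtain os where os: "chain (\<lambda>v (d::bool). v) os" "fst ` set os \<subseteq> S" "card S \<le> length os + 2 * h" by blast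
  then have "pth S (fst (hd os)) (fst (last os)) (map fst os)"
    using assms(2) by (intro pth_of_chain_id) auto
  moreover have "card S \<le> length (map fst os) + 2 * h" using os(3) by simp
  ultimately show ?thesis by blast
qed

text \<open>A bead has the same lengths in both directions by \<open>flex_rev\<close>, so the
  orientations do not matter and the intervals add up by \<open>flex_append\<close>.\<close>

lemma chain_flex:
  assumes ch: "chain pt os" and sub: "fst ` set os \<subseteq> I" and ne: "os \<noteq> []"
    and fl: "\<And>i. i \<in> I \<Longrightarrow> flex (pt i True) (pt i False) (W i) (lo i) (hi i) \<and> lo i \<le> hi i"
    and dis: "\<And>i j. i \<in> I \<Longrightarrow> j \<in> I \<Longrightarrow> i \<noteq> j \<Longrightarrow> W i \<inter> W j = {}"
  shows "flex (pt (fst (hd os)) (snd (hd os))) (pt (fst (last os)) (\<not> snd (last os))) (\<Union>i\<in>fst ` set os. W i)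
    (\<Sum>i\<in>fst ` set os. lo i) (\<Sum>i\<in>fst ` set os. hi i)"
  using ch sub ne
proof (induction os)
  case (Cons u os)
  obtain i d where u: "u = (i, d)" by fastforce
  have i: "i \<in> I" using Cons.prems u by auto
  have f1: "flex (pt i d) (pt i (\<not> d)) (W i) (lo i) (hi i)" "lo i \<le> hi i"
    using fl[OF i] flex_rev by (cases d; auto)+
  show ?case
  proof (cases "os = []")
    case True then show ?thesis using f1 u by simp
  next
    case False
    have ch': "chain pt os" using Cons.prems unfolding chain_def by (auto simp: successively_Cons)
    have ad: "adj (pt i (\<not> d)) (pt (fst (hd os)) (snd (hd os)))"
      using Cons.prems(1) False u unfolding chain_def by (auto simp: successively_Cons)
    have iin: "i \<notin> fst ` set os" using Cons.prems(1) u unfolding chain_def by auto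
    have f2: "flex (pt (fst (hd os)) (snd (hd os))) (pt (fst (last os)) (\<not> snd (last os))) (\<Union>i\<in>fst ` set os. W i)
      (\<Sum>i\<in>fst ` set os. lo i) (\<Sum>i\<in>fst ` set os. hi i)"
      using Cons.IH ch' Cons.prems(2) False by auto
    have dj: "W i \<inter> (\<Union>i\<in>fst ` set os. W i) = {}" using dis[OF i] iin Cons.prems(2) by fastforce
    have le: "(\<Sum>i\<in>fst ` set os. lo i) \<le> (\<Sum>i\<in>fst ` set os. hi i)"
      using fl Cons.prems(2) by (intro sum_mono) auto
    from flex_append[OF f1(1) f2 ad dj f1(2) le] show ?thesis using u False iin by simp
  qed
qed simp

end

section \<open>Longest paths between two fixed vertices\<close>

context sgraph
begin

lemma pth_trans_ex:
  assumes "pth S a b xs" "pth S b c ys"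
  shows "\<exists>zs. pth S a c zs"
  using assms(2)
proof (induction ys arbitrary: c rule: rev_induct)
  case Nil
  then show ?case unfolding pth_def by simp
next
  case (snoc y ys)
  have c: "c = y" "y \<in> S" using snoc.prems unfolding pth_def by auto
  show ?case
  proof (cases "ys = []")
    case True
    then have "b = c" using snoc.prems unfolding pth_def by auto
    then show ?thesis using assms(1) by blast
  next
    case False
    then have "pth S b (last ys) ys" using pth_append_left[OF snoc.prems] by simp
    then obtain zs where "pth S a (last ys) zs" using snoc.IH by blast
    moreover have "adj (last ys) y" using snoc.prems False unfolding pth_def by (auto simp: successively_append_iff)
    ultimately show ?thesis using pth_extend c by blast
  qed
qed

definition comp :: "'a set \<Rightarrow> 'a \<Rightarrow> 'a set" where
  "comp Z z = {y. \<exists>zs. pth Z z y zs}"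

lemma comp_props:
  assumes "z \<in> Z"
  shows "z \<in> comp Z z" "comp Z z \<subseteq> Z" "nonadj (comp Z z) (Z - comp Z z)"
    "x \<in> comp Z z \<Longrightarrow> y \<in> comp Z z \<Longrightarrow> \<exists>zs. pth (comp Z z) x y zs"
proof -
  show "z \<in> comp Z z" unfolding comp_def using pth_single assms by blast
  show "comp Z z \<subseteq> Z" unfolding comp_def using pth_in(5) by blast
  show "nonadj (comp Z z) (Z - comp Z z)" unfolding comp_def nonadj_def using pth_extend by blast
  have K: "pth (comp Z z) z y zs" if "pth Z z y zs" for y zs
  proof -
    have "set zs \<subseteq> comp Z z"
    proof
      fix w assume "w \<in> set zs"
      then obtain i where "i < length zs" "zs ! i = w" by (auto simp: in_set_conv_nth)
      then show "w \<in> comp Z z" unfolding comp_def using pth_take[OF that] by blast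
    qed
    then show ?thesis using pth_mono[OF pth_restrict[OF that]] by blast
  qed
  show "\<exists>zs. pth (comp Z z) x y zs" if xy: "x \<in> comp Z z" "y \<in> comp Z z"
  proof -
    obtain xs ys where "pth Z z x xs" "pth Z z y ys" using xy unfolding comp_def by blast
    then have "pth (comp Z z) x z (rev xs)" "pth (comp Z z) z y ys" using K pth_rev by blast+
    then show ?thesis by (rule pth_trans_ex)
  qed
qed

text \<open>The Chvatal--Erdos rerouting: if two successors of neighbours of \<open>K\<close> were adjacent, the path
  could be rerouted through \<open>K\<close> and would become longer, so these successors are independent.\<close>

lemma longest_path_attach:
  assumes p: "pth S a b P" and mx: "\<And>Q. pth S a b Q \<Longrightarrow> length Q \<le> length P"
    and ed: "edgy h S" and KS: "K \<subseteq> S - set P"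
    and conn: "\<And>x y. x \<in> K \<Longrightarrow> y \<in> K \<Longrightarrow> \<exists>zs. pth K x y zs"
  shows "card {x \<in> set P. \<exists>k\<in>K. adj x k} \<le> h"
proof -
  have dP: "distinct P" and sP: "set P \<subseteq> S" and neP: "P \<noteq> []" using p unfolding pth_def by auto
  define I where "I = {i. Suc i < length P \<and> (\<exists>k\<in>K. adj (P ! i) k)}"
  let ?A = "(\<lambda>i. P ! Suc i) ` I"
  have fI: "finite I" by (rule finite_subset[of _ "{..<length P}"]) (auto simp: I_def)
  have inj: "inj_on (\<lambda>i. P ! Suc i) I" using dP unfolding I_def inj_on_def by (auto simp: nth_eq_iff_index_eq)
  have no: "\<not> adj (P ! Suc i) (P ! Suc j)" if ij: "i \<in> I" "j \<in> I" "i < j" for i j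
  proof
    assume a: "adj (P ! Suc i) (P ! Suc j)"
    have len: "Suc j < length P" using ij unfolding I_def by simp
    obtain k k' where k: "k \<in> K" "adj (P ! i) k" "k' \<in> K" "adj (P ! j) k'" using ij unfolding I_def by blast
    obtain zs where zs: "pth K k k' zs" using conn k by blast
    have zK: "set zs \<subseteq> K" "zs \<noteq> []" using zs unfolding pth_def by auto
    let ?D = "drop (Suc i) P"
    have pD: "pth S (P ! Suc i) b ?D" using pth_drop[OF p] len ij(3) by simp
    let ?M = "take (Suc (j - Suc i)) ?D"
    have "pth S (P ! Suc i) (?D ! (j - Suc i)) ?M" using pth_take[OF pD, of "j - Suc i"] len ij(3) by simp
    then have M: "pth S (P ! j) (P ! Suc i) (rev ?M)" using pth_rev len ij(3) by auto
    have T: "pth S a (P ! i) (take (Suc i) P)" using pth_take[OF p] len ij(3) by simp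
    have R: "pth S (P ! Suc j) b (drop (Suc j) P)" using pth_drop[OF p] len by simp
    have split: "take (Suc j) P = take (Suc i) P @ ?M"
    proof -
      have "Suc j = Suc i + Suc (j - Suc i)" using ij(3) by simp
      then show ?thesis using take_add[of "Suc i" "Suc (j - Suc i)" P] by metis
    qed
    have "distinct (take (Suc i) P @ ?M)" unfolding split[symmetric] using dP by (rule distinct_take)
    then have d1: "set (take (Suc i) P) \<inter> set ?M = {}" unfolding distinct_append by blast
    have MP: "set ?M \<subseteq> set P" using set_take_subset set_drop_subset by (metis order_trans)
    have TP: "set (take (Suc i) P) \<subseteq> set P" by (rule set_take_subset)
    have RP: "set (drop (Suc j) P) \<subseteq> set P" by (rule set_drop_subset)
    have d2: "set (take (Suc j) P) \<inter> set (drop (Suc j) P) = {}" using pth_take_drop_disj[OF p] by simp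
    have q1: "pth (S \<union> K) a k' (take (Suc i) P @ zs)"
      using TP zK KS by (intro pth_append[OF T zs k(2)]) blast
    have q2: "pth (S \<union> S) (P ! j) b (rev ?M @ drop (Suc j) P)"
      using d2 split by (intro pth_append[OF M R a]) auto
    \<comment> \<open>The longer path: along P up to position i, through K, back along P from
      position j to i + 1, then over the edge to position j + 1 and on to b.\<close>
    have "pth ((S \<union> K) \<union> (S \<union> S)) a b ((take (Suc i) P @ zs) @ (rev ?M @ drop (Suc j) P))"
    proof (rule pth_append[OF q1 q2])
      show "adj k' (P ! j)" using k adj_sym by blast
      show "set (take (Suc i) P @ zs) \<inter> set (rev ?M @ drop (Suc j) P) = {}"
        using d1 d2 split zK(1) KS MP RP by auto
    qed
    moreover have "(S \<union> K) \<union> (S \<union> S) = S" using KS by blast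
    ultimately have "length ((take (Suc i) P @ zs) @ (rev ?M @ drop (Suc j) P)) \<le> length P" by (intro mx) simp
    moreover have "length P = length (take (Suc j) P) + length (drop (Suc j) P)" using len by simp
    then have "length P = length (take (Suc i) P) + length ?M + length (drop (Suc j) P)"
      unfolding split by simp
    moreover have "0 < length zs" using zK(2) by simp
    ultimately show False unfolding length_append length_rev by linarith
  qed
  have "card I < h"
  proof (rule ccontr)
    assume "\<not> card I < h"
    then have "h \<le> card ?A" using inj by (simp add: card_image)
    moreover have "?A \<subseteq> S" using sP unfolding I_def by (auto dest!: nth_mem)
    ultimately have "\<exists>x y. x \<in> ?A \<and> y \<in> ?A \<and> adj x y" by (intro edgyD[OF ed])
    then obtain x y where xy: "x \<in> ?A" "y \<in> ?A" "adj x y" by blast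
    then obtain i j where ij: "i \<in> I" "j \<in> I" "x = P ! Suc i" "y = P ! Suc j" by blast
    have "i \<noteq> j" using xy ij adj_irrefl by auto
    then consider "i < j" | "j < i" by linarith
    then show False using no ij xy(3) adj_sym by cases blast+
  qed
  \<comment> \<open>Only the last vertex of P has no successor; it turns the strict bound on I into
    the bound h.\<close>
  have "{x \<in> set P. \<exists>k\<in>K. adj x k} \<subseteq> insert (last P) ((!) P ` I)"
  proof
    fix x assume x: "x \<in> {x \<in> set P. \<exists>k\<in>K. adj x k}"
    then obtain i where i: "i < length P" "P ! i = x" by (auto simp: in_set_conv_nth)
    show "x \<in> insert (last P) ((!) P ` I)"
    proof (cases "Suc i < length P")
      case True then show ?thesis using i x unfolding I_def by blast
    next
      case False
      then have "i = length P - 1" using i by simp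
      then show ?thesis using i neP by (simp add: last_conv_nth)
    qed
  qed
  then have "card {x \<in> set P. \<exists>k\<in>K. adj x k} \<le> card (insert (last P) ((!) P ` I))"
    using fI by (intro card_mono) auto
  also have "\<dots> \<le> Suc (card ((!) P ` I))" using fI by (simp add: card_insert_if)
  also have "\<dots> \<le> Suc (card I)" using card_image_le[OF fI] by simp
  finally show ?thesis using \<open>card I < h\<close> by simp
qed

text \<open>Let A be a largest set with fewer than 2 h vertices and no edge to the rest of Z. It has
  at least h vertices, since adding one more small part to fewer than h vertices stays below 2 h.
  Splitting off A uses up fewer than 2 h vertices.\<close>

lemma packing_of_small_parts:
  assumes "finite Z" "\<And>z. z \<in> Z \<Longrightarrow> \<exists>K\<subseteq>Z. z \<in> K \<and> nonadj K (Z - K) \<and> card K < h" "2 * h * r \<le> card Z"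
  shows "packing h r Z"
  using assms
proof (induction r arbitrary: Z)
  case (Suc r)
  define F where "F = {A. A \<subseteq> Z \<and> nonadj A (Z - A) \<and> card A < 2 * h}"
  have fF: "finite F" unfolding F_def using Suc.prems(1) by simp
  show ?case
  proof (cases "h = 0")
    case True
    have "packing 0 k Z" for k
    proof (induction k)
      case (Suc k)
      then show ?case unfolding packing.simps nonadj_def by (intro exI[of _ "{}"] exI[of _ Z]) simp
    qed simp
    then show ?thesis using True by blast
  next
    case False
    have "{} \<in> F" using False unfolding F_def nonadj_def by simp
    then have "Max (card ` F) \<in> card ` F" using fF by (intro Max_in) auto
    then obtain A where A: "A \<in> F" and "Max (card ` F) = card A" by auto
    then have mx: "\<And>B. B \<in> F \<Longrightarrow> card B \<le> card A" using fF by (metis Max_ge finite_imageI imageI)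
    have AZ: "A \<subseteq> Z" "nonadj A (Z - A)" "card A < 2 * h" using A unfolding F_def by auto
    have fA: "finite A" using AZ(1) Suc.prems(1) finite_subset by blast
    have cA: "h \<le> card A"
    proof (rule ccontr)
      assume lt: "\<not> h \<le> card A"
      have "2 * h \<le> card Z" using Suc.prems(3) by simp
      then have "A \<noteq> Z" using AZ(3) by auto
      then obtain z where z: "z \<in> Z" "z \<notin> A" using AZ(1) by blast
      then obtain K where K: "K \<subseteq> Z" "z \<in> K" "nonadj K (Z - K)" "card K < h" using Suc.prems(2) by blast
      have "card (A \<union> K) \<le> card A + card K" by (rule card_Un_le)
      moreover have "nonadj (A \<union> K) (Z - (A \<union> K))" using AZ(2) K(3) unfolding nonadj_def by blast
      ultimately have "A \<union> K \<in> F" using AZ(1) K lt unfolding F_def by auto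
      then have "card (A \<union> K) \<le> card A" using mx by blast
      moreover have "card A < card (A \<union> K)" using z K AZ Suc.prems(1) by (intro psubset_card_mono) (auto intro: finite_subset)
      ultimately show False by simp
    qed
    let ?B = "Z - A"
    have "packing h r ?B"
    proof (rule Suc.IH)
      show "finite ?B" using Suc.prems(1) by simp
      have "card ?B = card Z - card A" using AZ(1) fA by (simp add: card_Diff_subset)
      then show "2 * h * r \<le> card ?B" using Suc.prems(3) AZ(3) by simp
      fix z assume z: "z \<in> ?B"
      then obtain K where K: "K \<subseteq> Z" "z \<in> K" "nonadj K (Z - K)" "card K < h" using Suc.prems(2) by blast
      have "finite K" using K(1) Suc.prems(1) finite_subset by blast
      then have "card (K - A) \<le> card K" by (intro card_mono) auto
      moreover have "nonadj (K - A) (?B - (K - A))" using K(3) unfolding nonadj_def by blast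
      ultimately show "\<exists>K\<subseteq>?B. z \<in> K \<and> nonadj K (?B - K) \<and> card K < h"
        using K z by (intro exI[of _ "K - A"]) auto
    qed
    then show ?thesis using AZ cA unfolding packing.simps by (intro exI[of _ A] exI[of _ ?B]) auto
  qed
qed simp

text \<open>The first x - 1 vertices are kept, and the remaining suffix is replaced by a shortest
  path inside it, which has between 1 and 2 h - 1 vertices.\<close>

lemma trim_path:
  assumes p: "pth S a b P" and ed: "edgy h S" and x: "1 \<le> x" "x \<le> length P"
  shows "\<exists>Q. pth (set P) a b Q \<and> x \<le> length Q \<and> length Q < x + 2 * h"
proof -
  let ?i = "x - 1"
  have i: "?i < length P" using x by simp
  let ?T = "set (drop ?i P)"
  have pd: "pth ?T (P ! ?i) b (drop ?i P)" using pth_restrict[OF pth_drop[OF p i]] .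
  have TS: "?T \<subseteq> S" using pth_in(3)[OF p] set_drop_subset by fast
  have "\<exists>c\<in>{P ! ?i}. \<exists>d\<in>{b}. \<exists>xs. pth ?T c d xs" using pd by (intro bexI[of _ "P ! ?i"] bexI[of _ b] exI[of _ "drop ?i P"]) simp_all
  then obtain c d xs where xs: "c \<in> {P ! ?i}" "d \<in> {b}" "pth ?T c d xs" "length xs < 2 * h"
    by (rule shortest_path[OF _ edgy_mono[OF ed TS]])
  have xs': "pth ?T (P ! ?i) b xs" using xs by simp
  have len: "1 \<le> length xs" using xs' unfolding pth_def by (cases xs) auto
  show ?thesis
  proof (cases "?i = 0")
    case True
    then have "pth (set P) a b xs" using xs' p i unfolding pth_def by (auto simp: hd_conv_nth)
    then show ?thesis using len xs(4) True x by (intro exI[of _ xs]) auto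
  next
    case False
    then obtain j where j: "?i = Suc j" by (cases ?i) auto
    have jl: "j < length P" using i j by simp
    have t: "pth (set P) a (P ! j) (take (Suc j) P)" using pth_take[OF pth_restrict[OF p] jl] .
    have ad: "adj (P ! j) (P ! ?i)" using p i j unfolding pth_def by (metis successively_nth)
    have dj: "set (take (Suc j) P) \<inter> set xs = {}"
      using pth_take_drop_disj[OF p, of "Suc j" ?i] pth_in(3)[OF xs'] j by auto
    have "pth (set P \<union> ?T) a b (take (Suc j) P @ xs)" by (rule pth_append[OF t xs' ad dj])
    moreover have "set P \<union> ?T = set P" using set_drop_subset by fast
    ultimately have "pth (set P) a b (take (Suc j) P @ xs)" by simp
    then show ?thesis using len xs(4) j jl x by (intro exI[of _ "take (Suc j) P @ xs"]) auto
  qed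
qed

end

section \<open>Closing a flexible path into a cycle\<close>

context sgraph
begin

text \<open>A form of connectivity that disregards small pieces: only separations with at least h
  vertices on both sides have to be expensive.\<close>

definition tough :: "nat \<Rightarrow> nat \<Rightarrow> 'a set \<Rightarrow> bool" where
  "tough h t S \<longleftrightarrow> (\<forall>A B. A \<subseteq> S \<longrightarrow> B \<subseteq> S \<longrightarrow> A \<inter> B = {} \<longrightarrow> nonadj A B \<longrightarrow> h \<le> card A \<longrightarrow> h \<le> card B
     \<longrightarrow> t < card (S - (A \<union> B)))"

lemma toughD: "tough h t S \<Longrightarrow> A \<subseteq> S \<Longrightarrow> B \<subseteq> S \<Longrightarrow> A \<inter> B = {} \<Longrightarrow> nonadj A B \<Longrightarrow> h \<le> card A \<Longrightarrow> h \<le> card B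
     \<Longrightarrow> t < card (S - (A \<union> B))"
  unfolding tough_def by simp

text \<open>Otherwise the part of S2 reachable from X and the rest of S2 would be separated at the
  cost of at most t deleted vertices.\<close>

lemma tough_path:
  assumes t: "tough h t S1" and fin: "finite S1" and ed: "edgy h S1"
    and S2: "S2 \<subseteq> S1" "card (S1 - S2) \<le> t" and X: "X \<subseteq> S2" "h \<le> card X" and Y: "Y \<subseteq> S2" "h \<le> card Y"
  obtains a b xs where "a \<in> X" "b \<in> Y" "pth S2 a b xs" "set xs \<inter> X = {a}" "set xs \<inter> Y = {b}" "length xs < 2 * h"
proof -
  have "\<not> (\<exists>A. X \<subseteq> A \<and> A \<subseteq> S2 \<and> A \<inter> Y = {} \<and> nonadj A (S2 - A))"
  proof
    assume "\<exists>A. X \<subseteq> A \<and> A \<subseteq> S2 \<and> A \<inter> Y = {} \<and> nonadj A (S2 - A)"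
    then obtain A where A: "X \<subseteq> A" "A \<subseteq> S2" "A \<inter> Y = {}" "nonadj A (S2 - A)" by blast
    have f2: "finite S2" using S2(1) fin finite_subset by blast
    have "card X \<le> card A" using A f2 by (intro card_mono) (auto intro: finite_subset)
    moreover have "card Y \<le> card (S2 - A)" using A Y f2 by (intro card_mono) auto
    ultimately have "t < card (S1 - (A \<union> (S2 - A)))"
      using A S2(1) X(2) Y(2) by (intro toughD[OF t]) auto
    moreover have "A \<union> (S2 - A) = S2" using A(2) by blast
    ultimately show False using S2(2) by simp
  qed
  then have "\<exists>a\<in>X. \<exists>b\<in>Y. \<exists>xs. pth S2 a b xs" using path_or_cut[OF X(1), of Y] by blast
  then show ?thesis using that by (rule shortest_path[OF _ edgy_mono[OF ed S2(1)]])
qed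

text \<open>E1 and E2 hold the candidates for the ends of the flexible path. They are linked by
  short connections to the first and to the last h vertices of a path with 5 h vertices. This
  selects e1 and e2 and leaves a middle segment of at least 3 h vertices, so that the longest path
  between the resulting ends a and b is long as well.\<close>

lemma initial_path:
  assumes h: "0 < h" and fin: "finite S0" and E: "E1 \<inter> E2 = {}" "E1 \<inter> S0 = {}" "E2 \<inter> S0 = {}" "card E1 = h" "card E2 = h"
    and ed: "edgy h (S0 \<union> E1 \<union> E2)" and t: "tough h (10 * h) (S0 \<union> E1 \<union> E2)"
    and q: "pth S0 qa qb xs" "length xs = 5 * h"
  shows "\<exists>e1 e2 a b R. e1 \<in> E1 \<and> e2 \<in> E2 \<and> adj e2 a \<and> adj b e1 \<and> pth S0 a b R \<and> 3 * h \<le> length R"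
proof -
  let ?S1 = "S0 \<union> E1 \<union> E2"
  have fE: "finite E1" "finite E2" using E h card.infinite by fastforce+
  have fS1: "finite ?S1" using fin fE by simp
  have dx: "distinct xs" and xS: "set xs \<subseteq> S0" using q unfolding pth_def by auto
  define Qa where "Qa = set (take h xs)"
  define Qb where "Qb = set (drop (4 * h) xs)"
  have cQ: "card Qa = h" "card Qb = h" unfolding Qa_def Qb_def using dx q(2) by (auto simp: distinct_card)
  have Qx: "Qa \<subseteq> set xs" "Qb \<subseteq> set xs" unfolding Qa_def Qb_def by (auto dest: in_set_takeD in_set_dropD)
  have Qab: "Qa \<inter> Qb = {}" unfolding Qa_def Qb_def using pth_take_drop_disj[OF q(1), of h "4 * h"] by simp
  have cx: "card (set xs) = 5 * h" using dx q(2) by (simp add: distinct_card)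
  \<comment> \<open>The first connection may meet the given path only in \<open>Qa\<close> and has
    to avoid E2; at most 5 h + h vertices are deleted.\<close>
  define S2 where "S2 = (S0 - set xs) \<union> Qa \<union> E1"
  have "?S1 - S2 \<subseteq> set xs \<union> E2" unfolding S2_def by blast
  then have "card (?S1 - S2) \<le> card (set xs \<union> E2)" using fE by (intro card_mono) auto
  also have "\<dots> \<le> card (set xs) + card E2" by (rule card_Un_le)
  finally have c2: "card (?S1 - S2) \<le> 10 * h" using cx E(5) by simp
  have s2: "S2 \<subseteq> ?S1" "E1 \<subseteq> S2" "Qa \<subseteq> S2" unfolding S2_def using Qx xS by auto
  have "h \<le> card E1" "h \<le> card Qa" using E cQ by simp_all
  then obtain e1 u g1 where g1: "e1 \<in> E1" "u \<in> Qa" "pth S2 e1 u g1" "set g1 \<inter> E1 = {e1}" "set g1 \<inter> Qa = {u}" "length g1 < 2 * h"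
    using tough_path[OF t fS1 ed s2(1) c2 s2(2) _ s2(3)] by metis
  \<comment> \<open>The second connection also avoids the first one, which has fewer than 2 h
    vertices; at most 5 h + 2 h + h vertices are deleted.\<close>
  define S3 where "S3 = (S0 - set xs - set g1) \<union> Qb \<union> E2"
  have "?S1 - S3 \<subseteq> set xs \<union> (set g1 \<union> E1)" unfolding S3_def by blast
  then have "card (?S1 - S3) \<le> card (set xs \<union> (set g1 \<union> E1))" using fE by (intro card_mono) auto
  also have "\<dots> \<le> card (set xs) + card (set g1 \<union> E1)" by (rule card_Un_le)
  also have "\<dots> \<le> card (set xs) + (card (set g1) + card E1)" using card_Un_le by simp
  finally have c3: "card (?S1 - S3) \<le> 10 * h" using cx E(4) g1(6) card_length[of g1] by simp
  have s3: "S3 \<subseteq> ?S1" "E2 \<subseteq> S3" "Qb \<subseteq> S3" unfolding S3_def using Qx xS by auto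
  have "h \<le> card E2" "h \<le> card Qb" using E cQ by simp_all
  then obtain e2 w g2 where g2: "e2 \<in> E2" "w \<in> Qb" "pth S3 e2 w g2" "set g2 \<inter> E2 = {e2}" "set g2 \<inter> Qb = {w}" "length g2 < 2 * h"
    using tough_path[OF t fS1 ed s3(1) c3 s3(2) _ s3(3)] by metis
  obtain i where i: "i < h" "xs ! i = u" using g1(2) q(2) unfolding Qa_def by (auto simp: in_set_conv_nth)
  obtain k where k: "k < h" "drop (4 * h) xs ! k = w" using g2(2) q(2) unfolding Qb_def by (auto simp: in_set_conv_nth)
  define j where "j = 4 * h + k"
  have j: "4 * h \<le> j" "j < 5 * h" "xs ! j = w" using k q(2) unfolding j_def by auto
  have decomp: "\<exists>c g'. g = e # g' \<and> pth (S - E') c v g' \<and> adj e c"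
    if g: "pth S e v g" "set g \<inter> E' = {e}" "v \<notin> E'" for S e v g E'
  proof -
    obtain g' where g': "g = e # g'" using g(1) unfolding pth_def by (cases g) auto
    have "v \<noteq> e" using g by blast
    then have ne: "g' \<noteq> []" using g(1) g' unfolding pth_def by auto
    have "e \<notin> set g'" using g(1) g' unfolding pth_def by auto
    then have "set g' \<inter> E' = {}" using g(2) g' by auto
    then have "pth (S - E') (hd g') v g' \<and> adj e (hd g')" using g(1) g' ne unfolding pth_def
      by (auto simp: successively_Cons)
    then show ?thesis using g' by blast
  qed
  have "u \<notin> E1" "w \<notin> E2" using g1(2) g2(2) Qx xS E by blast+
  then obtain b g1' a g2' where b: "g1 = e1 # g1'" "pth (S2 - E1) b u g1'" "adj e1 b"
    and a: "g2 = e2 # g2'" "pth (S3 - E2) a w g2'" "adj e2 a"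
    using decomp[OF g1(3,4)] decomp[OF g2(3,4)] by blast
  have in1: "set g1' \<subseteq> S0" using pth_in(3)[OF b(2)] Qx xS unfolding S2_def by blast
  have in2: "set g2' \<subseteq> S0" using pth_in(3)[OF a(2)] Qx xS unfolding S3_def by blast
  have x1: "set g1' \<inter> set xs \<subseteq> {u}"
  proof -
    have "set g1' \<inter> set xs \<subseteq> Qa" using pth_in(3)[OF b(2)] unfolding S2_def by blast
    then show ?thesis using g1(5) b(1) by auto
  qed
  have x2: "set g2' \<inter> set xs \<subseteq> {w}"
  proof -
    have "set g2' \<inter> set xs \<subseteq> Qb" using pth_in(3)[OF a(2)] unfolding S3_def by blast
    then show ?thesis using g2(5) a(1) by auto
  qed
  have x12: "set g1' \<inter> set g2' = {}"
  proof -
    have "set g2' \<inter> set g1 \<subseteq> Qb" using pth_in(3)[OF a(2)] unfolding S3_def by blast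
    then have "set g1' \<inter> set g2' \<subseteq> Qb" using b(1) by auto
    moreover have "set g1' \<inter> Qb = {}" using x1 Qx Qab g1(2) by blast
    ultimately show ?thesis by blast
  qed
  let ?D = "drop (Suc i) xs" and ?m = "j - Suc i - 1"
  have pD: "pth S0 (xs ! Suc i) qb ?D" using pth_drop[OF q(1)] i(1) q(2) h by simp
  have ml: "Suc (Suc i + ?m) = j" using i(1) j(1) h by simp
  \<comment> \<open>The segment strictly between u and w, at positions i + 1 to j - 1; since i < h
    and 4 h <= j it has at least 3 h vertices.\<close>
  let ?M = "take (Suc ?m) ?D"
  have "pth S0 (xs ! Suc i) (?D ! ?m) ?M" using pth_take[OF pD, of ?m] ml j(2) q(2) by simp
  moreover have "?D ! ?m = xs ! (j - 1)"
  proof -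
    have e: "Suc i + ?m = j - 1" using ml by simp
    have "?D ! ?m = xs ! (Suc i + ?m)" using i(1) q(2) h by (intro nth_drop) simp
    then show ?thesis unfolding e .
  qed
  ultimately have M: "pth S0 (xs ! (j - 1)) (xs ! Suc i) (rev ?M)" using pth_rev by simp
  have lM: "3 * h \<le> length ?M" using ml i(1) j q(2) by simp
  have idx: "set ?M \<inter> {u, w} = {}"
  proof -
    have "z \<noteq> u \<and> z \<noteq> w" if z: "z \<in> set ?M" for z
    proof -
      obtain c where c: "c < length ?M" "?M ! c = z" using z by (auto simp: in_set_conv_nth)
      have "c < Suc ?m" using c(1) by simp
      then have "z = xs ! (Suc i + c)" "Suc i + c < j" using c ml j(2) q(2) by (auto simp: nth_drop)
      then show ?thesis using dx i j q(2) by (auto simp: nth_eq_iff_index_eq)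
    qed
    then show ?thesis by blast
  qed
  have Mx: "set ?M \<subseteq> set xs" using set_take_subset set_drop_subset by fast
  have ad1: "adj (xs ! Suc i) u" using successively_nth[of adj xs i] q i h adj_sym unfolding pth_def by auto
  have ad2: "adj w (xs ! (j - 1))"
    using successively_nth[of adj xs "j - 1"] q j h adj_sym unfolding pth_def by auto
  have r1: "pth (S0 \<union> S0) (xs ! (j - 1)) b (rev ?M @ rev g1')"
    using pth_mono[OF pth_restrict[OF pth_rev[OF b(2)]]] in1 x1 Mx idx
    by (intro pth_append[OF M _ ad1]) auto
  have r2: "pth (S0 \<union> (S0 \<union> S0)) a b (g2' @ (rev ?M @ rev g1'))"
    using pth_mono[OF pth_restrict[OF a(2)]] in2 x2 Mx idx x12
    by (intro pth_append[OF _ r1 ad2]) auto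
  have "pth S0 a b (g2' @ (rev ?M @ rev g1'))" using r2 by simp
  moreover have "3 * h \<le> length (g2' @ (rev ?M @ rev g1'))"
    unfolding length_append length_rev using lM by linarith
  ultimately show ?thesis using g1(1) g2(1) a(3) b(3) adj_sym by blast
qed

text \<open>A component of the rest with h vertices would be cut off by its at most h neighbours on
  P together with E, that is by 3 h vertices, while at least 2 h vertices of P remain on the other
  side. So all components are small, and 2 h (r + 1) missed vertices could be grouped into a packing
  of r + 1 sets.\<close>

lemma longest_path_near_spanning:
  assumes h: "0 < h" and fin: "finite S0" and cE: "card E \<le> 2 * h" "finite E"
    and ed: "edgy h S0" and t: "tough h (10 * h) (S0 \<union> E)" and rk: "\<not> packing h (Suc r) S0"
    and p: "pth S0 a b P" and mx: "\<And>Q. pth S0 a b Q \<Longrightarrow> length Q \<le> length P" and len: "3 * h \<le> length P"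
  shows "card S0 < length P + 2 * h * Suc r"
proof -
  let ?Z = "S0 - set P"
  have dP: "distinct P" and sP: "set P \<subseteq> S0" using p unfolding pth_def by auto
  have small: "card (comp ?Z z) < h" if z: "z \<in> ?Z" for z
  proof (rule ccontr)
    assume big: "\<not> card (comp ?Z z) < h"
    let ?K = "comp ?Z z"
    note K = comp_props[OF z]
    let ?N = "{x \<in> set P. \<exists>k\<in>?K. adj x k}"
    have cN: "card ?N \<le> h" using K(2) K(4) by (intro longest_path_attach[OF p mx ed]) auto
    let ?B = "S0 - ?K - ?N"
    have nb: "nonadj ?K ?B"
      unfolding nonadj_def
    proof (intro ballI notI)
      fix x y assume xy: "x \<in> ?K" "y \<in> ?B" "adj x y"
      show False
      proof (cases "y \<in> set P")
        case True then show ?thesis using xy adj_sym by blast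
      next
        case False then show ?thesis using xy K(3) unfolding nonadj_def by blast
      qed
    qed
    have "set P - ?N \<subseteq> ?B" using sP K(2) by blast
    then have "card (set P - ?N) \<le> card ?B" using fin by (intro card_mono) auto
    moreover have "card (set P) - card ?N \<le> card (set P - ?N)" by (rule diff_card_le_card_Diff) auto
    moreover have "card (set P) = length P" using dP by (rule distinct_card)
    ultimately have cB: "h \<le> card ?B" using cN len by linarith
    have "10 * h < card (S0 \<union> E - (?K \<union> ?B))"
      using K(2) nb big cB by (intro toughD[OF t]) auto
    also have "\<dots> \<le> card (?N \<union> E)" using cE(2) by (intro card_mono) auto
    also have "\<dots> \<le> card ?N + card E" by (rule card_Un_le)
    finally show False using cN cE(1) h by linarith
  qed
  have "\<not> 2 * h * Suc r \<le> card ?Z"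
  proof
    assume big: "2 * h * Suc r \<le> card ?Z"
    have "packing h (Suc r) ?Z"
    proof (rule packing_of_small_parts[OF _ _ big])
      show "finite ?Z" using fin by simp
      fix z assume z: "z \<in> ?Z"
      show "\<exists>K\<subseteq>?Z. z \<in> K \<and> nonadj K (?Z - K) \<and> card K < h"
        using comp_props[OF z] small[OF z] by (intro exI[of _ "comp ?Z z"]) simp
    qed
    then show False using rk packing_mono by blast
  qed
  moreover have "card ?Z = card S0 - length P" using sP dP by (simp add: card_Diff_subset distinct_card)
  ultimately show ?thesis by simp
qed

text \<open>The cycle consists of a path Q in S0 and a flexible path in F. Q is trimmed to at least
  n - \<open>hi\<close> and fewer than n - \<open>hi\<close> + 2 h vertices, so the number of
  vertices still missing falls into the window that the flexible path covers. The lower bound N0 on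
  \<open>hi\<close> ensures that a longest path in S0 is long enough for this.\<close>

lemma closing:
  assumes h: "0 < h" and fin: "finite S0" and E: "E1 \<inter> E2 = {}" "card E1 = h" "card E2 = h" "E1 \<union> E2 \<subseteq> F" "F \<inter> S0 = {}"
    and ed: "edgy h (S0 \<union> E1 \<union> E2)" and t: "tough h (10 * h) (S0 \<union> E1 \<union> E2)"
    and rk: "\<not> packing h (Suc r) S0"
    and fl: "\<And>e1 e2. e1 \<in> E1 \<Longrightarrow> e2 \<in> E2 \<Longrightarrow> \<exists>hi. N0 \<le> hi \<and> hi < n \<and> flex e1 e2 F (hi - 2 * h) hi"
    and size: "n + 2 * h * Suc r \<le> N0 + card S0" "6 * h * Suc r \<le> card S0" "2 * h \<le> N0"
  shows "cyc n (S0 \<union> F)"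
proof -
  have fE: "finite E1" "finite E2" using E h card.infinite by fastforce+
  have "Suc r * (h + 5 * h) \<le> card S0" using size(2) by (simp add: algebra_simps)
  then obtain qa qb xs where q: "pth S0 qa qb xs" "length xs = 5 * h"
    using long_path_of_rank[OF fin _ rk, of "5 * h"] h by auto
  have dj: "E1 \<inter> S0 = {}" "E2 \<inter> S0 = {}" using E by blast+
  obtain e1 e2 a b R where R: "e1 \<in> E1" "e2 \<in> E2" "adj e2 a" "adj b e1" "pth S0 a b R" "3 * h \<le> length R"
    using initial_path[OF h fin E(1) dj E(2,3) ed t q] by blast
  have bd: "length Q < Suc (card S0)" if "pth S0 a b Q" for Q
  proof -
    have "length Q = card (set Q)" using that unfolding pth_def by (metis distinct_card)
    also have "\<dots> \<le> card S0" using that fin unfolding pth_def by (intro card_mono) auto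
    finally show ?thesis by simp
  qed
  obtain P where P: "pth S0 a b P" and mx: "\<And>Q. pth S0 a b Q \<Longrightarrow> length Q \<le> length P"
    using ex_has_greatest_nat[of "pth S0 a b" R length "Suc (card S0)"] R(5) bd by (metis less_imp_le)
  have len: "3 * h \<le> length P" using mx[OF R(5)] R(6) by simp
  have ed0: "edgy h S0" using edgy_mono[OF ed] by blast
  have cE: "card (E1 \<union> E2) \<le> 2 * h" using card_Un_le[of E1 E2] E by simp
  have t': "tough h (10 * h) (S0 \<union> (E1 \<union> E2))" using t by (simp add: Un_assoc)
  have near: "card S0 < length P + 2 * h * Suc r"
    using longest_path_near_spanning[OF h fin cE _ ed0 t' rk P mx len] fE by simp
  obtain hi where hi: "N0 \<le> hi" "hi < n" "flex e1 e2 F (hi - 2 * h) hi" using fl R by blast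
  have x: "1 \<le> n - hi" "n - hi \<le> length P" using hi near size(1) by linarith+
  obtain Q where Q: "pth (set P) a b Q" "n - hi \<le> length Q" "length Q < (n - hi) + 2 * h"
    using trim_path[OF P ed0 x] by blast
  have "length Q \<le> n" using Q(3) hi(1,2) size(3) by linarith
  then have "hi - 2 * h \<le> n - length Q" "n - length Q \<le> hi" using Q hi by linarith+
  then obtain xs where xs: "pth F e1 e2 xs" "length xs = n - length Q" using hi(3) unfolding flex_def by blast
  have "pth S0 a b Q" using pth_mono[OF Q(1)] P unfolding pth_def by blast
  then have "cyc n (F \<union> S0)" using xs \<open>length Q \<le> n\<close> R E(5) by (intro cyc_of_pths[OF xs(1)]) auto
  then show ?thesis by (simp add: Un_commute)
qed

end

section \<open>Rotations of paths\<close>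

text \<open>Edges are unordered pairs, so reversing a block of a path affects only the edges at the
  borders of the block.\<close>

fun ledges :: "'a list \<Rightarrow> 'a set set" where
  "ledges [] = {}"
| "ledges [x] = {}"
| "ledges (x # y # xs) = insert {x, y} (ledges (y # xs))"

lemma ledges_Cons: "xs \<noteq> [] \<Longrightarrow> ledges (x # xs) = insert {x, hd xs} (ledges xs)"
  by (cases xs) auto

lemma ledges_append:
  "xs \<noteq> [] \<Longrightarrow> ys \<noteq> [] \<Longrightarrow> ledges (xs @ ys) = ledges xs \<union> ledges ys \<union> {{last xs, hd ys}}"
proof (induction xs)
  case (Cons x xs)
  then show ?case by (cases "xs = []") (auto simp: ledges_Cons)
qed simp

lemma ledges_rev: "ledges (rev xs) = ledges xs"
proof (induction xs)
  case (Cons x xs)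
  then show ?case
    by (cases "xs = []") (auto simp: ledges_append ledges_Cons last_rev insert_commute)
qed simp

lemma ledges_sub: "e \<in> ledges xs \<Longrightarrow> e \<subseteq> set xs"
  by (induction xs rule: ledges.induct) auto

lemma finite_ledges: "finite (ledges xs)"
  by (induction xs rule: ledges.induct) auto

lemma ledges_nonempty_edge: "e \<in> ledges xs \<Longrightarrow> e \<noteq> {}"
  by (induction xs rule: ledges.induct) auto

definition lnbr :: "'a list \<Rightarrow> 'a \<Rightarrow> 'a set" where
  "lnbr xs y = {x. {x, y} \<in> ledges xs}"

lemma lnbr_sym: "x \<in> lnbr xs y \<longleftrightarrow> y \<in> lnbr xs x"
  unfolding lnbr_def by (simp add: insert_commute)

lemma lnbr_rev: "lnbr (rev xs) = lnbr xs"
  unfolding lnbr_def ledges_rev ..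

lemma lnbr_sub: "lnbr xs y \<subseteq> set xs"
  unfolding lnbr_def using ledges_sub by fastforce

lemma lnbr_split:
  assumes "distinct (us @ y # ws)"
  shows "lnbr (us @ y # ws) y = (if us = [] then {} else {last us}) \<union> (if ws = [] then {} else {hd ws})"
proof -
  have nu: "e \<notin> ledges us \<and> e \<notin> ledges ws" if "y \<in> e" for e
    using that assms ledges_sub[of e us] ledges_sub[of e ws] by auto
  have hw: "ws \<noteq> [] \<Longrightarrow> hd ws \<noteq> y" and lu: "us \<noteq> [] \<Longrightarrow> last us \<noteq> y"
    using assms by (auto dest: hd_in_set last_in_set)
  have L: "ledges (us @ y # ws) = (if us = [] then {} else ledges us \<union> {{last us, y}}) \<union>
     (if ws = [] then {} else ledges ws \<union> {{y, hd ws}})"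
    by (cases "us = []"; cases "ws = []") (auto simp: ledges_append ledges_Cons)
  have "{x, y} \<in> ledges (us @ y # ws) \<longleftrightarrow> (us \<noteq> [] \<and> {x, y} = {last us, y}) \<or> (ws \<noteq> [] \<and> {x, y} = {y, hd ws})" for x
    unfolding L using nu[of "{x, y}"] by auto
  then show ?thesis unfolding lnbr_def using hw lu by (auto simp: doubleton_eq_iff)
qed

lemma lnbr_card: assumes "distinct xs" shows "card (lnbr xs y) \<le> 2" "finite (lnbr xs y)"
proof -
  show "finite (lnbr xs y)" using lnbr_sub by (rule finite_subset) simp
  show "card (lnbr xs y) \<le> 2"
  proof (cases "y \<in> set xs")
    case True
    then obtain us ws where "xs = us @ y # ws" by (meson split_list)
    then show ?thesis using lnbr_split[of us y ws] assms by (auto simp: card_insert_if)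
  next
    case False
    then have "lnbr xs y = {}" unfolding lnbr_def using ledges_sub by fastforce
    then show ?thesis by simp
  qed
qed

lemma lnbr_UN_card:
  assumes "distinct xs" "finite Z"
  shows "card (\<Union>z\<in>Z. lnbr xs z) \<le> 2 * card Z" "finite (\<Union>z\<in>Z. lnbr xs z)"
proof -
  have "card (\<Union>z\<in>Z. lnbr xs z) \<le> (\<Sum>z\<in>Z. card (lnbr xs z))" using assms(2) by (rule card_UN_le)
  also have "\<dots> \<le> (\<Sum>z\<in>Z. 2)" using lnbr_card[OF assms(1)] by (intro sum_mono) auto
  finally show "card (\<Union>z\<in>Z. lnbr xs z) \<le> 2 * card Z" by simp
  show "finite (\<Union>z\<in>Z. lnbr xs z)" using assms(2) lnbr_card(2)[OF assms(1)] by simp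
qed

lemma lnbr_append_left:
  assumes "distinct (J @ ws)" "y \<in> set J" "y \<noteq> last J"
  shows "lnbr (J @ ws) y = lnbr J y"
proof (cases "ws = []")
  case False
  have ne: "J \<noteq> []" using assms(2) by auto
  have "ledges (J @ ws) = ledges J \<union> ledges ws \<union> {{last J, hd ws}}" using ledges_append[OF ne False] .
  moreover have "y \<notin> set ws" using assms by auto
  then have "{x, y} \<notin> ledges ws" for x using ledges_sub[of "{x, y}" ws] by auto
  moreover have "{x, y} \<noteq> {last J, hd ws}" for x using assms(3) \<open>y \<notin> set ws\<close> False by (auto simp: doubleton_eq_iff)
  ultimately show ?thesis unfolding lnbr_def by auto
qed simp

text \<open>Both paths start at the same vertex. If y is that vertex, it has a single path edge in
  each of them; otherwise it has two edges in P, which are then all its edges in the new path. In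
  both cases its new successor is an old neighbour.\<close>

lemma succ_is_old_neighbour:
  assumes dP: "distinct P" and dx: "distinct (us @ y # ws)" and yP: "y \<in> set P" "y \<noteq> last P"
    and hd: "hd (us @ y # ws) = hd P" and unb: "lnbr P y \<subseteq> lnbr (us @ y # ws) y" and ne: "ws \<noteq> []"
  shows "hd ws \<in> lnbr P y"
proof -
  obtain us' ws' where P: "P = us' @ y # ws'" using yP(1) by (meson split_list)
  have ws': "ws' \<noteq> []" using P yP(2) by auto
  have nP: "lnbr P y = (if us' = [] then {} else {last us'}) \<union> {hd ws'}"
    using lnbr_split[of us' y ws'] dP P ws' by simp
  have nx: "lnbr (us @ y # ws) y = (if us = [] then {} else {last us}) \<union> {hd ws}"
    using lnbr_split[OF dx] ne by simp
  show ?thesis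
  proof (cases "us = []")
    case True
    then show ?thesis using nP nx unb by auto
  next
    case False
    then have "y \<noteq> hd P" using hd dx by (cases us) auto
    then have us': "us' \<noteq> []" using P by auto
    have "last us' \<noteq> hd ws'" using dP P us' ws' by (auto dest: hd_in_set last_in_set)
    then show ?thesis using nP nx unb us' False by auto
  qed
qed

section \<open>Posa rotations with the first vertex fixed\<close>

context sgraph
begin

text \<open>K restricts the new ends \<open>hd ws\<close>; with K = \<open>UNIV\<close> these are
  ordinary rotations. The counter t bounds the number of destroyed edges of P.\<close>

inductive rot :: "'a set \<Rightarrow> 'a list \<Rightarrow> nat \<Rightarrow> 'a list \<Rightarrow> bool" for K P where
  rot_0: "rot K P 0 P"
| rot_Suc: "rot K P t (us @ y # ws) \<Longrightarrow> ws \<noteq> [] \<Longrightarrow> adj y (last ws) \<Longrightarrow> hd ws \<in> K \<Longrightarrow> rot K P (Suc t) (us @ y # rev ws)"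

text \<open>The condition 0 < s leaves out the original path, whose end need not lie in K.\<close>

definition rot_ends :: "'a set \<Rightarrow> 'a list \<Rightarrow> nat \<Rightarrow> 'a set" where
  "rot_ends K P t = {last xs | xs s. rot K P s xs \<and> 0 < s \<and> s \<le> t}"

lemma rot_ends_mono: "s \<le> t \<Longrightarrow> rot_ends K P s \<subseteq> rot_ends K P t"
  unfolding rot_ends_def by (auto intro: order_trans)

lemma rot_pth:
  assumes "rot K P t xs" "pth S a b P"
  shows "pth S a (last xs) xs \<and> set xs = set P"
  using assms(1)
proof induction
  case rot_0
  then show ?case using assms(2) unfolding pth_def by simp
next
  case (rot_Suc t us y ws)
  then show ?case unfolding pth_def
    by (auto simp: successively_append_iff successively_Cons successively_adj_rev hd_rev last_rev hd_append
        simp del: successively_rev)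
qed

text \<open>A rotation removes only the edge between y and \<open>hd ws\<close>, and
  \<open>hd ws\<close> becomes the new end.\<close>

lemma rot_broken:
  assumes "rot K P t xs"
  shows "card (ledges P - ledges xs) \<le> t \<and> (\<forall>e\<in>ledges P - ledges xs. e \<inter> rot_ends K P t \<noteq> {})"
  using assms
proof induction
  case rot_0
  then show ?case by simp
next
  case (rot_Suc t us y ws)
  let ?x = "us @ y # ws" and ?x' = "us @ y # rev ws"
  have L: "ledges ?x \<subseteq> insert {y, hd ws} (ledges ?x')"
    using rot_Suc.hyps(2) by (cases "us = []") (auto simp: ledges_append ledges_Cons ledges_rev)
  have sub: "ledges P - ledges ?x' \<subseteq> insert {y, hd ws} (ledges P - ledges ?x)" using L by blast
  have "card (ledges P - ledges ?x') \<le> card (insert {y, hd ws} (ledges P - ledges ?x))"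
    using finite_ledges[of P] by (intro card_mono[OF _ sub]) simp
  also have "\<dots> \<le> Suc (card (ledges P - ledges ?x))" using finite_ledges[of P] by (simp add: card_insert_if)
  finally have c: "card (ledges P - ledges ?x') \<le> Suc t" using rot_Suc.IH by simp
  have "rot K P (Suc t) ?x'" using rot_Suc.hyps by (rule rot.rot_Suc)
  then have "last ?x' \<in> rot_ends K P (Suc t)" unfolding rot_ends_def by blast
  then have "hd ws \<in> rot_ends K P (Suc t)" using rot_Suc.hyps(2) by (simp add: last_rev)
  then have hw: "{y, hd ws} \<inter> rot_ends K P (Suc t) \<noteq> {}" by blast
  have "e \<inter> rot_ends K P (Suc t) \<noteq> {}" if e: "e \<in> ledges P - ledges ?x'" for e
  proof (cases "e = {y, hd ws}")
    case False
    then have "e \<in> ledges P - ledges ?x" using sub e by blast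
    then have "e \<inter> rot_ends K P t \<noteq> {}" using rot_Suc.IH by simp
    then show ?thesis using rot_ends_mono[of t "Suc t" K P] by fastforce
  qed (use hw in simp)
  then show ?case using c by simp
qed

text \<open>Posa's observation: an edge of P at y can have been destroyed only if one of its two
  vertices was a new end. Under the assumptions both edges are intact, so rotating at y breaks one
  of them and makes a neighbour of y on P the new end.\<close>

lemma rot_extend:
  assumes p: "pth S a b P" and r: "rot K P t xs" and y: "adj (last xs) y" "y \<in> set P" "y \<noteq> last P"
    and ny: "y \<notin> rot_ends K P t" "lnbr P y \<inter> rot_ends K P t = {}" and K: "lnbr P y \<subseteq> K"
  shows "\<exists>z\<in>lnbr P y. z \<in> rot_ends K P (Suc t)"
proof -
  have px: "pth S a (last xs) xs" "set xs = set P" using rot_pth[OF r p] by auto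
  obtain us ws where xs: "xs = us @ y # ws" using y(2) px(2) by (metis split_list)
  have ne: "ws \<noteq> []" using y(1) xs adj_irrefl by auto
  have unb: "lnbr P y \<subseteq> lnbr xs y"
  proof
    fix z assume z: "z \<in> lnbr P y"
    have "{z, y} \<in> ledges xs"
    proof (rule ccontr)
      assume "{z, y} \<notin> ledges xs"
      then have "{z, y} \<inter> rot_ends K P t \<noteq> {}" using rot_broken[OF r] z unfolding lnbr_def by blast
      then show False using ny z by blast
    qed
    then show "z \<in> lnbr xs y" unfolding lnbr_def by simp
  qed
  have "hd ws \<in> lnbr P y"
    using p px xs y unb ne unfolding pth_def by (intro succ_is_old_neighbour[of P us y ws]) auto
  moreover have "rot K P (Suc t) (us @ y # rev ws)"
    using r xs ne y(1) K calculation adj_sym by (intro rot.rot_Suc) auto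
  then have "last (us @ y # rev ws) \<in> rot_ends K P (Suc t)" unfolding rot_ends_def by blast
  then have "hd ws \<in> rot_ends K P (Suc t)" using ne by (simp add: last_rev)
  ultimately show ?thesis by blast
qed

text \<open>Posa's lemma with pivots confined to Y and ends confined to K. Let Z be the set of all
  ends obtained. By \<open>rot_extend\<close> every neighbour of Z in Y - Z is next to a vertex of Z
  on P, so there are at most 2 |Z| of them. Expansion excludes this unless |Z| exceeds g.\<close>

lemma posa_restricted:
  assumes p: "pth S a b P" and Y: "Y \<subseteq> set P" "last P \<notin> Y" "\<And>y. y \<in> Y \<Longrightarrow> lnbr P y \<subseteq> K" and KP: "K \<subseteq> set P"
    and b: "\<exists>y\<in>Y. adj b y"
    and ex: "\<And>Z. Z \<subseteq> K \<Longrightarrow> Z \<noteq> {} \<Longrightarrow> card Z \<le> g \<Longrightarrow> 2 * card Z < card {y \<in> Y - Z. \<exists>z\<in>Z. adj z y}"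
  shows "\<exists>Z\<subseteq>K. g < card Z \<and> (\<forall>z\<in>Z. \<exists>xs. pth S a z xs \<and> set xs = set P)"
proof -
  define Z where "Z = (\<Union>t. rot_ends K P t)"
  have ZK: "Z \<subseteq> K"
  proof
    fix z assume "z \<in> Z"
    then obtain xs s where "rot K P s xs" "0 < s" "z = last xs" unfolding Z_def rot_ends_def by blast
    then show "z \<in> K" by (cases rule: rot.cases) (auto simp: last_rev)
  qed
  have fZ: "finite Z" using ZK KP by (meson List.finite_set finite_subset)
  have paths: "\<exists>xs. pth S a z xs \<and> set xs = set P" if z: "z \<in> Z" for z
  proof -
    obtain xs s where "rot K P s xs" "z = last xs" using z unfolding Z_def rot_ends_def by blast
    then show ?thesis using rot_pth[OF _ p] by blast
  qed
  have RZ: "rot_ends K P t \<subseteq> Z" for t unfolding Z_def by blast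
  have step: "\<exists>z\<in>lnbr P y. z \<in> Z" if "rot K P t xs" "adj (last xs) y" "y \<in> Y" "y \<notin> Z" for t xs y
  proof (rule ccontr)
    assume no: "\<not> ?thesis"
    have "\<exists>z\<in>lnbr P y. z \<in> rot_ends K P (Suc t)"
      using that no Y RZ by (intro rot_extend[OF p that(1,2)]) blast+
    then show False using no RZ by blast
  qed
  have "Z \<noteq> {}"
  proof -
    obtain y where y: "y \<in> Y" "adj b y" using b by blast
    have "last P = b" using p unfolding pth_def by simp
    then show ?thesis using step[OF rot_0, of y] y by blast
  qed
  have "\<not> card Z \<le> g"
  proof
    assume "card Z \<le> g"
    then have lt: "2 * card Z < card {y \<in> Y - Z. \<exists>z\<in>Z. adj z y}" using ex ZK \<open>Z \<noteq> {}\<close> by blast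
    have "{y \<in> Y - Z. \<exists>z\<in>Z. adj z y} \<subseteq> (\<Union>z\<in>Z. lnbr P z)"
    proof
      fix y assume y: "y \<in> {y \<in> Y - Z. \<exists>z\<in>Z. adj z y}"
      then obtain z where z: "z \<in> Z" "adj z y" by blast
      then obtain xs s where "rot K P s xs" "z = last xs" unfolding Z_def rot_ends_def by blast
      then have "\<exists>w\<in>lnbr P y. w \<in> Z" using step z y by blast
      then show "y \<in> (\<Union>z\<in>Z. lnbr P z)" using lnbr_sym by fast
    qed
    moreover have dP: "distinct P" using p unfolding pth_def by simp
    ultimately have "card {y \<in> Y - Z. \<exists>z\<in>Z. adj z y} \<le> card (\<Union>z\<in>Z. lnbr P z)"
      using lnbr_UN_card(2)[OF dP fZ] by (intro card_mono)
    then show False using lt lnbr_UN_card(1)[OF dP fZ] by simp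
  qed
  then show ?thesis using ZK paths by (intro exI[of _ Z]) auto
qed

end

text \<open>Induction on J: the vertex x is next to the head of the remaining block on
  \<open>ys\<close>, hence it extends this block on its free side, or on either side of a block with
  one element.\<close>

lemma intact_sublist:
  assumes "distinct ys" "distinct J" "J \<noteq> []" "set J \<subseteq> set ys" "ledges J \<subseteq> ledges ys"
  shows "\<exists>us ws. ys = us @ J @ ws \<or> ys = us @ rev J @ ws"
  using assms(2-5)
proof (induction J)
  case (Cons x J)
  show ?case
  proof (cases "J = []")
    case True
    then show ?thesis using Cons.prems(3) by (metis append_Cons append_Nil list.set_intros(1) split_list subsetD)
  next
    case False
    then have L: "ledges (x # J) = insert {x, hd J} (ledges J)" by (rule ledges_Cons)
    have "distinct J" "set J \<subseteq> set ys" "ledges J \<subseteq> ledges ys" using Cons.prems L by auto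
    then obtain us ws where IH: "ys = us @ J @ ws \<or> ys = us @ rev J @ ws" using Cons.IH False by blast
    obtain y J' where J: "J = y # J'" using False by (cases J) auto
    have e: "x \<in> lnbr ys y" using Cons.prems(4) L J unfolding lnbr_def by auto
    have xJ: "x \<notin> set J'" "x \<noteq> y" using Cons.prems(1) J by auto
    from IH show ?thesis
    proof
      assume ys: "ys = us @ J @ ws"
      then have "x \<in> (if us = [] then {} else {last us}) \<union> (if J' @ ws = [] then {} else {hd (J' @ ws)})"
        using lnbr_split[of us y "J' @ ws"] assms(1) e J by simp
      then have "(us \<noteq> [] \<and> x = last us) \<or> (J' = [] \<and> ws \<noteq> [] \<and> x = hd ws)"
        using xJ(1) by (cases J') (auto split: if_splits)
      then show ?thesis
      proof
        assume u: "us \<noteq> [] \<and> x = last us"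
        then have "ys = butlast us @ (x # J) @ ws" using ys append_butlast_last_id[of us] by (metis append.assoc append_Cons append_Nil)
        then show ?thesis by blast
      next
        assume w: "J' = [] \<and> ws \<noteq> [] \<and> x = hd ws"
        then have "ys = us @ rev (x # J) @ tl ws" using ys J by (cases ws) auto
        then show ?thesis by blast
      qed
    next
      assume ys: "ys = us @ rev J @ ws"
      then have ys': "ys = (us @ rev J') @ y # ws" using J by simp
      then have "x \<in> (if us @ rev J' = [] then {} else {last (us @ rev J')}) \<union> (if ws = [] then {} else {hd ws})"
        using lnbr_split[of "us @ rev J'" y ws] assms(1) e by simp
      then have "(ws \<noteq> [] \<and> x = hd ws) \<or> (J' = [] \<and> us \<noteq> [] \<and> x = last us)"
        using xJ(1) by (cases J') (auto split: if_splits simp: last_rev)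
      then show ?thesis
      proof
        assume w: "ws \<noteq> [] \<and> x = hd ws"
        then have "ys = us @ rev (x # J) @ tl ws" using ys by (cases ws) auto
        then show ?thesis by blast
      next
        assume u: "J' = [] \<and> us \<noteq> [] \<and> x = last us"
        then have "ys = butlast us @ (x # J) @ ws"
          using ys J append_butlast_last_id[of us] by (metis append.assoc append_Cons append_Nil rev_singleton_conv rev_rev_ident)
        then show ?thesis by blast
      qed
    qed
  qed
qed simp

text \<open>If B began inside A, its first element would lie in both blocks.\<close>

lemma sublists_ordered_aux:
  assumes "us @ A @ ws = us' @ B @ ws'" "set A \<inter> set B = {}" "A \<noteq> []" "B \<noteq> []" "length us \<le> length us'" "distinct (us @ A @ ws)"
  shows "\<exists>m r. us @ A @ ws = us @ A @ m @ B @ r"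
proof -
  let ?L = "us @ A @ ws"
  have "length us + length A \<le> length us'"
  proof (rule ccontr)
    assume "\<not> ?thesis"
    then have lt: "length us' < length us + length A" by simp
    have lt': "length us' - length us < length A" using lt assms(3) assms(5) by auto
    have "?L ! length us' = (A @ ws) ! (length us' - length us)" using assms(5) by (simp add: nth_append)
    then have "?L ! length us' = A ! (length us' - length us)" using lt' by (simp add: nth_append)
    then have "?L ! length us' \<in> set A" using lt' by simp
    moreover have "?L ! length us' = B ! 0" unfolding assms(1) using assms(4) by (simp add: nth_append)
    then have "?L ! length us' \<in> set B" using assms(4) by simp
    ultimately show False using assms(2) by blast
  qed
  moreover have "(us @ A) @ ws = us' @ (B @ ws')" using assms(1) by simp
  ultimately obtain m where "us' = (us @ A) @ m" "ws = m @ B @ ws'"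
    by (auto simp: append_eq_append_conv2)
  then show ?thesis by auto
qed

lemma sublists_ordered:
  assumes "L = us @ A @ ws" "L = us' @ B @ ws'" "set A \<inter> set B = {}" "A \<noteq> []" "B \<noteq> []" "distinct L"
  shows "\<exists>p m r. L = p @ A @ m @ B @ r \<or> L = p @ B @ m @ A @ r"
proof (cases "length us \<le> length us'")
  case True
  then show ?thesis using sublists_ordered_aux[of us A ws us' B ws'] assms by metis
next
  case False
  then show ?thesis using sublists_ordered_aux[of us' B ws' us A ws] assms by (metis Int_commute nat_le_linear)
qed

section \<open>Longest paths in joined expanders\<close>

context sgraph
begin

definition longest :: "'a set \<Rightarrow> 'a list \<Rightarrow> bool" where
  "longest Q P \<longleftrightarrow> (\<exists>a b. pth Q a b P) \<and> (\<forall>a b xs. pth Q a b xs \<longrightarrow> length xs \<le> length P)"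

text \<open>One round of rotations accounts for at most 2 |Z| + 2 |Z'| neighbours of the set Z of
  ends, where Z' is the next set of ends; the factor 8 thus gives |Z'| >= 3 |Z|.\<close>

definition expands :: "nat \<Rightarrow> 'a set \<Rightarrow> bool" where
  "expands g Q \<longleftrightarrow> (\<forall>Z. Z \<subseteq> Q \<longrightarrow> Z \<noteq> {} \<longrightarrow> card Z \<le> g \<longrightarrow> 8 * card Z \<le> card {y \<in> Q - Z. \<exists>z\<in>Z. adj z y})"

lemma expandsD: "expands g Q \<Longrightarrow> Z \<subseteq> Q \<Longrightarrow> Z \<noteq> {} \<Longrightarrow> card Z \<le> g \<Longrightarrow> 8 * card Z \<le> card {y \<in> Q - Z. \<exists>z\<in>Z. adj z y}"
  unfolding expands_def by simp

lemma joined_nonnbrs: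
  assumes j: "joined g Q" and fin: "finite Q" and Z: "Z \<subseteq> Q" "g \<le> card Z"
  shows "card Q \<le> card {y \<in> Q - Z. \<exists>z\<in>Z. adj z y} + card Z + g"
proof -
  let ?N = "{y \<in> Q - Z. \<exists>z\<in>Z. adj z y}" and ?R = "Q - Z - {y \<in> Q - Z. \<exists>z\<in>Z. adj z y}"
  have "nonadj Z ?R" unfolding nonadj_def by auto
  then have "\<not> g \<le> card ?R" using joinedD[OF j Z(1), of ?R] Z(2) by blast
  moreover have "Q \<subseteq> ?N \<union> (Z \<union> ?R)" by blast
  then have "card Q \<le> card (?N \<union> (Z \<union> ?R))" using fin Z(1) finite_subset[OF Z(1) fin] by (intro card_mono) auto
  moreover have "card (?N \<union> (Z \<union> ?R)) \<le> card ?N + card (Z \<union> ?R)" by (rule card_Un_le)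
  moreover have "card (Z \<union> ?R) \<le> card Z + card ?R" by (rule card_Un_le)
  ultimately show ?thesis by linarith
qed

text \<open>The set of ends at least doubles per round until it reaches g vertices, after at most q
  rounds. Then fewer than g vertices outside it are non-neighbours, and one more round yields more
  than M ends, for otherwise Q would have at most 5 M + g vertices. So q + 1 rotations suffice, and
  few edges of P are destroyed.\<close>

lemma rot_many_ends:
  assumes lg: "longest Q P" and fin: "finite Q" and j: "joined g Q" and ex: "expands g Q" and g: "0 < g" "g \<le> 2 ^ q"
    and big: "5 * M + g < card Q"
  shows "\<exists>B. M < card B \<and> B \<subseteq> Q \<and> (\<forall>b\<in>B. \<exists>xs. pth Q (hd P) b xs \<and> set xs = set P \<and> card (ledges P - ledges xs) \<le> Suc q)"
proof -
  obtain a b where p: "pth Q a b P" using lg unfolding longest_def by blast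
  have a: "hd P = a" "last P = b" and dP: "distinct P" and sP: "set P \<subseteq> Q" using p unfolding pth_def by auto
  define Z where "Z = (\<lambda>t. insert b (rot_ends UNIV P t))"
  have Zx: "\<exists>xs s. rot UNIV P s xs \<and> s \<le> t \<and> z = last xs" if "z \<in> Z t" for z t
    using that a rot_0[of UNIV P] unfolding Z_def rot_ends_def by blast
  have ZQ: "Z t \<subseteq> Q" for t
  proof
    fix z assume "z \<in> Z t"
    then obtain xs s where "rot UNIV P s xs" "z = last xs" using Zx by blast
    then have "pth Q a z xs" using rot_pth[OF _ p] by blast
    then show "z \<in> Q" by (rule pth_in(5))
  qed
  have fZ: "finite (Z t)" for t using finite_subset[OF ZQ fin] .
  \<comment> \<open>Otherwise a rotated path could be extended by y, although P is longest.\<close>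
  have nbrP: "y \<in> set P" if z: "z \<in> Z t" "adj z y" "y \<in> Q" for z y t
  proof (rule ccontr)
    assume y: "y \<notin> set P"
    obtain xs s where r: "rot UNIV P s xs" "z = last xs" using Zx z by blast
    then have xs: "pth Q a z xs" "set xs = set P" using rot_pth[OF r(1) p] by auto
    have "pth (Q \<union> Q) a y (xs @ [y])"
      using xs y z by (intro pth_append[OF xs(1) pth_single[OF z(3)]]) auto
    then have "pth Q a y (xs @ [y])" by simp
    then have "length (xs @ [y]) \<le> length P" using lg unfolding longest_def by blast
    moreover have "length xs = length P" using xs dP unfolding pth_def by (metis distinct_card)
    ultimately show False by simp
  qed
  have grow: "card {y \<in> Q - Z t. \<exists>z\<in>Z t. adj z y} \<le> 2 * card (Z t) + 2 * card (Z (Suc t))" for t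
  proof -
    have "{y \<in> Q - Z t. \<exists>z\<in>Z t. adj z y} \<subseteq> (\<Union>z\<in>Z t. lnbr P z) \<union> (\<Union>z\<in>Z (Suc t). lnbr P z)"
    proof
      fix y assume "y \<in> {y \<in> Q - Z t. \<exists>z\<in>Z t. adj z y}"
      then obtain z where z: "z \<in> Z t" "adj z y" "y \<in> Q" "y \<notin> Z t" by blast
      show "y \<in> (\<Union>z\<in>Z t. lnbr P z) \<union> (\<Union>z\<in>Z (Suc t). lnbr P z)"
      proof (cases "lnbr P y \<inter> Z t = {}")
        case True
        obtain xs s where r: "rot UNIV P s xs" "s \<le> t" "z = last xs" using Zx[OF z(1)] by blast
        have sub: "rot_ends UNIV P s \<subseteq> Z t" using rot_ends_mono[OF r(2)] unfolding Z_def by blast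
        have "\<exists>w\<in>lnbr P y. w \<in> rot_ends UNIV P (Suc s)"
        proof (rule rot_extend[OF p r(1)])
          show "adj (last xs) y" using z r by simp
          show "y \<in> set P" using nbrP z by blast
          show "y \<noteq> last P" using z(4) a unfolding Z_def by blast
          show "y \<notin> rot_ends UNIV P s" using sub z(4) by blast
          show "lnbr P y \<inter> rot_ends UNIV P s = {}" using sub True by blast
        qed simp
        then obtain w where w: "w \<in> lnbr P y" "w \<in> rot_ends UNIV P (Suc s)" by blast
        have "w \<in> Z (Suc t)" using w(2) rot_ends_mono[of "Suc s" "Suc t" UNIV P] r(2) unfolding Z_def by auto
        moreover have "y \<in> lnbr P w" using w(1) lnbr_sym by metis
        ultimately show ?thesis by blast
      next
        case False
        then obtain w where "w \<in> lnbr P y" "w \<in> Z t" by blast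
        then have "y \<in> lnbr P w" using lnbr_sym by metis
        then show ?thesis using \<open>w \<in> Z t\<close> by blast
      qed
    qed
    then have "card {y \<in> Q - Z t. \<exists>z\<in>Z t. adj z y} \<le> card ((\<Union>z\<in>Z t. lnbr P z) \<union> (\<Union>z\<in>Z (Suc t). lnbr P z))"
      using lnbr_UN_card(2)[OF dP fZ] by (intro card_mono) simp_all
    also have "\<dots> \<le> card (\<Union>z\<in>Z t. lnbr P z) + card (\<Union>z\<in>Z (Suc t). lnbr P z)" by (rule card_Un_le)
    also have "\<dots> \<le> 2 * card (Z t) + 2 * card (Z (Suc t))" using lnbr_UN_card(1)[OF dP fZ] by (intro add_mono) auto
    finally show ?thesis .
  qed
  have Zmono: "card (Z s) \<le> card (Z t)" if "s \<le> t" for s t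
    using rot_ends_mono[OF that, of UNIV P] fZ[of t] unfolding Z_def by (intro card_mono) auto
  have small: "2 ^ t \<le> card (Z t) \<or> g \<le> card (Z t)" for t
  proof (induction t)
    case 0
    have "Z 0 = {b}" unfolding Z_def rot_ends_def by auto
    then show ?case by simp
  next
    case (Suc t)
    show ?case
    proof (cases "g \<le> card (Z t)")
      case True then show ?thesis using Zmono[of t "Suc t"] by simp
    next
      case False
      have "Z t \<noteq> {}" unfolding Z_def by blast
      then have "8 * card (Z t) \<le> card {y \<in> Q - Z t. \<exists>z\<in>Z t. adj z y}" using False ZQ by (intro expandsD[OF ex]) auto
      then have "2 * card (Z t) \<le> card (Z (Suc t))" using grow[of t] by linarith
      then show ?thesis using Suc False by auto
    qed
  qed
  then have gq: "g \<le> card (Z q)" using g(2) by (meson order_trans)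
  have "M < card (Z (Suc q))"
  proof (cases "M < card (Z q)")
    case True then show ?thesis using Zmono[of q "Suc q"] by simp
  next
    case False
    then show ?thesis using joined_nonnbrs[OF j fin ZQ gq] grow[of q] big by linarith
  qed
  moreover have "\<exists>xs. pth Q (hd P) z xs \<and> set xs = set P \<and> card (ledges P - ledges xs) \<le> Suc q" if z: "z \<in> Z (Suc q)" for z
  proof -
    obtain xs s where r: "rot UNIV P s xs" "s \<le> Suc q" "z = last xs" using Zx[OF z] by blast
    then show ?thesis using rot_pth[OF r(1) p] rot_broken[OF r(1)] a(1) by (intro exI[of _ xs]) auto
  qed
  ultimately show ?thesis using ZQ by (intro exI[of _ "Z (Suc q)"]) auto
qed

text \<open>The admissible pivots: a rotation that breaks an edge of J at such a vertex has its new
  end in K.\<close>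

definition inner :: "'a list \<Rightarrow> 'a set \<Rightarrow> 'a set" where
  "inner J K = {y \<in> set J. y \<noteq> hd J \<and> y \<noteq> last J \<and> lnbr J y \<subseteq> K}"

lemma inner_rev: "inner (rev J) K = inner J K"
  unfolding inner_def lnbr_rev by (cases "J = []") (auto simp: hd_rev last_rev)

text \<open>A largest set B of at most 2 g vertices is removed that fails to expand into the pivots
  of the remainder. If B had g vertices, joinedness would leave fewer than 4 g + 2 g + g pivots, but
  there are at least 20 g - 4 g - 2. So |B| < g, and a set Z of at most g vertices violating the
  claim could be added to B.\<close>

lemma core_exists:
  assumes j: "joined g Q" and J: "distinct J" "set J \<subseteq> Q" "length J = 20 * g" and g: "0 < g"
  shows "\<exists>K\<subseteq>set J. 2 * g \<le> card (inner J K) \<and>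
    (\<forall>Z. Z \<subseteq> K \<longrightarrow> Z \<noteq> {} \<longrightarrow> card Z \<le> g \<longrightarrow> 2 * card Z < card {y \<in> inner J K - Z. \<exists>z\<in>Z. adj z y})"
proof -
  let ?Y = "\<lambda>B. inner J (set J - B)"
  let ?N = "\<lambda>B Z. {y \<in> ?Y B - Z. \<exists>z\<in>Z. adj z y}"
  define F where "F = {B. B \<subseteq> set J \<and> card B \<le> 2 * g \<and> card (?N B B) \<le> 2 * card B}"
  have cJ: "card (set J) = 20 * g" using J by (simp add: distinct_card)
  have fY: "finite (?Y B)" for B unfolding inner_def by simp
  have Yc: "20 * g \<le> card (?Y B) + 2 * card B + 2" if B: "B \<subseteq> set J" for B
  proof -
    have fB: "finite B" using B finite_subset by blast
    have "set J \<subseteq> ?Y B \<union> ((\<Union>z\<in>B. lnbr J z) \<union> {hd J, last J})"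
    proof
      fix y assume y: "y \<in> set J"
      show "y \<in> ?Y B \<union> ((\<Union>z\<in>B. lnbr J z) \<union> {hd J, last J})"
      proof (cases "lnbr J y \<subseteq> set J - B")
        case True then show ?thesis using y unfolding inner_def by blast
      next
        case False
        then obtain z where "z \<in> lnbr J y" "z \<in> B" using lnbr_sub[of J y] by blast
        then show ?thesis using lnbr_sym[of z J y] by blast
      qed
    qed
    then have "card (set J) \<le> card (?Y B \<union> ((\<Union>z\<in>B. lnbr J z) \<union> {hd J, last J}))"
      using fY lnbr_UN_card(2)[OF J(1) fB] by (intro card_mono) simp_all
    also have "\<dots> \<le> card (?Y B) + card ((\<Union>z\<in>B. lnbr J z) \<union> {hd J, last J})" by (rule card_Un_le)
    also have "\<dots> \<le> card (?Y B) + (card (\<Union>z\<in>B. lnbr J z) + card {hd J, last J})" by (intro add_left_mono card_Un_le)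
    also have "\<dots> \<le> card (?Y B) + (2 * card B + 2)" using lnbr_UN_card(1)[OF J(1) fB]
      by (intro add_mono) (auto simp: card_insert_if)
    finally show ?thesis using cJ by simp
  qed
  have fF: "finite F" unfolding F_def by simp
  have "{} \<in> F" unfolding F_def by simp
  then have "Max (card ` F) \<in> card ` F" using fF by (intro Max_in) auto
  then obtain B where B: "B \<in> F" and "Max (card ` F) = card B" by auto
  then have mx: "\<And>C. C \<in> F \<Longrightarrow> card C \<le> card B" using fF by (metis Max_ge finite_imageI imageI)
  have BJ: "B \<subseteq> set J" "card B \<le> 2 * g" "card (?N B B) \<le> 2 * card B" using B unfolding F_def by auto
  have fB: "finite B" using BJ(1) finite_subset by blast
  have lt: "card B < g"
  proof (rule ccontr)
    assume "\<not> card B < g"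
    then have gB: "g \<le> card B" by simp
    let ?R = "?Y B - B - ?N B B"
    have "nonadj B ?R" unfolding nonadj_def by blast
    moreover have "?R \<subseteq> set J" "B \<inter> ?R = {}" unfolding inner_def by blast+
    ultimately have "\<not> g \<le> card ?R" using joinedD[OF joined_mono[OF j J(2)] BJ(1), of ?R] gB by blast
    moreover have "card (?Y B) \<le> card (?N B B \<union> (B \<union> ?R))" using fY[of B] fB by (intro card_mono) auto
    moreover have "card (?N B B \<union> (B \<union> ?R)) \<le> card (?N B B) + card (B \<union> ?R)" by (rule card_Un_le)
    moreover have "card (B \<union> ?R) \<le> card B + card ?R" by (rule card_Un_le)
    ultimately show False using Yc[OF BJ(1)] BJ g by linarith
  qed
  let ?K = "set J - B"
  have "2 * g \<le> card (inner J ?K)" using Yc[OF BJ(1)] lt g by linarith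
  moreover have "2 * card Z < card (?N B Z)" if Z: "Z \<subseteq> ?K" "Z \<noteq> {}" "card Z \<le> g" for Z
  proof (rule ccontr)
    assume "\<not> 2 * card Z < card (?N B Z)"
    then have le: "card (?N B Z) \<le> 2 * card Z" by simp
    have fZ: "finite Z" using Z(1) finite_subset by blast
    have c: "card (B \<union> Z) = card B + card Z" using Z(1) fB fZ by (intro card_Un_disjoint) auto
    have "?N (B \<union> Z) (B \<union> Z) \<subseteq> ?N B B \<union> ?N B Z" unfolding inner_def by blast
    then have "card (?N (B \<union> Z) (B \<union> Z)) \<le> card (?N B B \<union> ?N B Z)" using fY[of B] by (intro card_mono) auto
    also have "\<dots> \<le> card (?N B B) + card (?N B Z)" by (rule card_Un_le)
    finally have "card (?N (B \<union> Z) (B \<union> Z)) \<le> 2 * card (B \<union> Z)" using le BJ(3) c by simp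
    then have "B \<union> Z \<in> F" using BJ(1) Z c lt unfolding F_def by auto
    then have "card (B \<union> Z) \<le> card B" using mx by blast
    then show False using c Z(2) fZ by simp
  qed
  ultimately show ?thesis by (intro exI[of _ ?K]) auto
qed

text \<open>The bad vertices may lie in Y; of the 2 g vertices of Y at least g remain after g bad
  ones are taken away.\<close>

lemma joined_bad_card:
  assumes j: "joined g Q" and fin: "finite Q" and Y: "Y \<subseteq> Q" "2 * g \<le> card Y"
  shows "card {x \<in> Q. \<not> (\<exists>y\<in>Y. adj x y)} < g"
proof (rule ccontr)
  let ?D = "{x \<in> Q. \<not> (\<exists>y\<in>Y. adj x y)}"
  assume "\<not> card ?D < g"
  then have "g \<le> card ?D" by simp
  then obtain D where D: "D \<subseteq> ?D" "card D = g" by (rule obtain_subset_with_card_n)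
  have fD: "finite D" using D(1) fin finite_subset[of D Q] by blast
  have "card Y - card D \<le> card (Y - D)" using fD by (rule diff_card_le_card_Diff)
  then have "g \<le> card (Y - D)" using D(2) Y(2) by simp
  moreover have "nonadj D (Y - D)" using D(1) unfolding nonadj_def by blast
  moreover have "D \<subseteq> Q" "Y - D \<subseteq> Q" "D \<inter> (Y - D) = {}" using D(1) Y(1) by blast+
  ultimately show False using joinedD[OF j, of D "Y - D"] D(2) by simp
qed

end

section \<open>Hamilton cycles in joined expanders\<close>

lemma ledges_infix: "ledges B \<subseteq> ledges (A @ B @ C)"
  by (cases "A = []"; cases "B = []"; cases "C = []") (auto simp: ledges_append)

lemma infix_decomp: "xs = take i xs @ take s (drop i xs) @ drop s (drop i xs)"
  by (simp only: append_take_drop_id)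

context sgraph
begin

text \<open>A block A that alone supplies the expansion for \<open>posa_restricted\<close>. X
  collects path ends from which the first rotation into the block is possible.\<close>

definition core :: "nat \<Rightarrow> 'a set \<Rightarrow> 'a list \<Rightarrow> 'a set \<Rightarrow> bool" where
  "core g X A K \<longleftrightarrow> A \<noteq> [] \<and> K \<subseteq> set A \<and>
    (\<forall>Z. Z \<subseteq> K \<longrightarrow> Z \<noteq> {} \<longrightarrow> card Z \<le> g \<longrightarrow> 2 * card Z < card {y \<in> inner A K - Z. \<exists>z\<in>Z. adj z y}) \<and>
    (\<forall>x\<in>X. \<exists>y\<in>inner A K. adj x y)"

lemma core_rev: "core g X A K \<Longrightarrow> core g X (rev A) K"
  unfolding core_def inner_rev by simp

lemma core_posa:
  assumes c: "core g X A K" and p: "pth Q c b (A @ r)" and b: "b \<in> X"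
  shows "\<exists>Z\<subseteq>K. g < card Z \<and> (\<forall>z\<in>Z. \<exists>xs. pth Q c z xs \<and> set xs = set (A @ r))"
proof (rule posa_restricted[OF p, of "inner A K"])
  have d: "distinct (A @ r)" using p unfolding pth_def by simp
  show "inner A K \<subseteq> set (A @ r)" unfolding inner_def by auto
  show "last (A @ r) \<notin> inner A K"
  proof (cases "r = []")
    case True then show ?thesis unfolding inner_def by simp
  next
    case False
    then have "last (A @ r) \<in> set r" by simp
    then show ?thesis using d unfolding inner_def by auto
  qed
  show "lnbr (A @ r) y \<subseteq> K" if "y \<in> inner A K" for y
    using lnbr_append_left[OF d, of y] that unfolding inner_def by simp
  show "K \<subseteq> set (A @ r)" using c unfolding core_def by auto
  show "\<exists>y\<in>inner A K. adj b y" using c b unfolding core_def by simp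
  show "2 * card Z < card {y \<in> inner A K - Z. \<exists>z\<in>Z. adj z y}" if "Z \<subseteq> K" "Z \<noteq> {}" "card Z \<le> g" for Z
    using c that unfolding core_def by simp
qed

text \<open>Cutting between the blocks gives a path from \<open>last A\<close> to b and one from
  \<open>hd B\<close> to a. They are rotated separately with \<open>last A\<close> and
  \<open>hd B\<close> fixed, so neither side disturbs the other. Each gets more than g ends, and an
  edge between the two sets of ends closes a cycle through \<open>m\<close>.\<close>

lemma two_cores_close:
  assumes ys: "pth Q b a (p @ A @ m @ B @ r)" and j: "joined g Q" and b: "b \<in> X" "a \<in> X"
    and A: "core g X A KA" and B: "core g X B KB"
  shows "\<exists>C. distinct C \<and> set C = set (p @ A @ m @ B @ r) \<and> successively adj C \<and> adj (last C) (hd C)"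
proof -
  have ne: "A \<noteq> []" "B \<noteq> []" using A B unfolding core_def by auto
  have d: "distinct (p @ A @ m @ B @ r)" and sQ: "set (p @ A @ m @ B @ r) \<subseteq> Q"
    and su: "successively adj (p @ A @ m @ B @ r)" using ys unfolding pth_def by auto
  have "pth Q b (last (p @ A)) (p @ A)" using pth_append_left[of Q b a "p @ A" "m @ B @ r"] ys ne by simp
  then have "pth Q (last (p @ A)) b (rev (p @ A))" by (rule pth_rev)
  then have pl: "pth Q (last A) b (rev A @ rev p)" using ne by simp
  have "pth Q (hd (B @ r)) a (B @ r)" using pth_append_right[of Q b a "p @ A @ m" "B @ r"] ys ne by simp
  then have pr: "pth Q (hd B) a (B @ r)" using ne by simp
  obtain Z1 where Z1: "Z1 \<subseteq> KA" "g < card Z1" "\<And>z. z \<in> Z1 \<Longrightarrow> \<exists>xs. pth Q (last A) z xs \<and> set xs = set (rev A @ rev p)"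
    using core_posa[OF core_rev[OF A] pl b(1)] by blast
  obtain Z2 where Z2: "Z2 \<subseteq> KB" "g < card Z2" "\<And>z. z \<in> Z2 \<Longrightarrow> \<exists>xs. pth Q (hd B) z xs \<and> set xs = set (B @ r)"
    using core_posa[OF B pr b(2)] by blast
  have "KA \<subseteq> set A" "KB \<subseteq> set B" using A B unfolding core_def by auto
  moreover have "set A \<inter> set B = {}" "set A \<subseteq> Q" "set B \<subseteq> Q" using d sQ by auto
  ultimately have "Z1 \<subseteq> Q" "Z2 \<subseteq> Q" "Z1 \<inter> Z2 = {}" using Z1(1) Z2(1) by blast+
  then have "\<not> nonadj Z1 Z2" using joinedD[OF j, of Z1 Z2] Z1(2) Z2(2) by simp
  then obtain z1 z2 where z: "z1 \<in> Z1" "z2 \<in> Z2" "adj z1 z2" unfolding nonadj_def by blast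
  obtain xs where xs: "pth Q (last A) z1 xs" "set xs = set (rev A @ rev p)" using Z1(3) z by blast
  obtain ys where ys': "pth Q (hd B) z2 ys" "set ys = set (B @ r)" using Z2(3) z by blast
  let ?C = "rev xs @ m @ ys"
  have xsp: "xs \<noteq> []" "distinct xs" "successively adj (rev xs)" "hd xs = last A" "last xs = z1"
    using xs unfolding pth_def successively_adj_rev by auto
  have ysp: "ys \<noteq> []" "distinct ys" "successively adj ys" "hd ys = hd B" "last ys = z2"
    using ys' unfolding pth_def by auto
  have su2: "successively adj (m @ B)" "adj (last A) (hd (m @ B))"
    using su ne by (auto simp: successively_append_iff hd_append split: if_splits)
  have s1: "successively adj (m @ ys)"
    using su2 ysp ne by (auto simp: successively_append_iff)
  have "hd (m @ ys) = hd (m @ B)" using ysp ne by (cases m) auto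
  then have "adj (last (rev xs)) (hd (m @ ys))" using su2(2) xsp by (simp add: last_rev)
  then have "successively adj ?C" using s1 xsp(3) unfolding successively_append_iff[of adj "rev xs"] by blast
  moreover have "distinct ?C" using d xsp(2) ysp(2) xs(2) ys'(2) by auto
  moreover have "set ?C = set (p @ A @ m @ B @ r)" using xs(2) ys'(2) by auto
  moreover have "hd ?C = z1" "last ?C = z2" using xsp ysp by (auto simp: hd_rev)
  ultimately show ?thesis using z(3) adj_sym by metis
qed

text \<open>P contains 2 q + 4 disjoint blocks of 20 g vertices with a core in each. Rotations at
  either end reach vertices from which every core can be used. They destroy at most 2 (q + 1) edges
  of P, and each edge damages at most one block, so two blocks stay intact for
  \<open>two_cores_close\<close>.\<close>

lemma longest_closes:
  assumes lg: "longest Q P" and fin: "finite Q" and j: "joined g Q" and ex: "expands g Q" and g: "0 < g" "g \<le> 2 ^ q"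
    and big: "(2 * q + 4) * (20 * g) \<le> length P"
  shows "\<exists>C. distinct C \<and> set C = set P \<and> successively adj C \<and> adj (last C) (hd C)"
proof -
  define m where "m = 2 * q + 4"
  define s where "s = 20 * g"
  have ms: "m * s \<le> length P" "0 < s" using big g unfolding m_def s_def by simp_all
  have dP: "distinct P" and sP: "set P \<subseteq> Q" using lg unfolding longest_def pth_def by auto
  define J where "J = (\<lambda>i. take s (drop (i * s) P))"
  have iv: "i * s + s \<le> length P" if "i < m" for i
  proof -
    have "Suc i * s \<le> m * s" using that by (intro mult_le_mono1) simp
    then show ?thesis using ms by simp
  qed
  have Jlen: "length (J i) = s" if "i < m" for i unfolding J_def using iv[OF that] by simp
  have Jdist: "distinct (J i)" for i unfolding J_def using dP by simp
  have JP: "set (J i) \<subseteq> set P" for i unfolding J_def by (meson order_trans set_drop_subset set_take_subset)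
  have Jled: "ledges (J i) \<subseteq> ledges P" for i
    unfolding J_def by (subst infix_decomp[of P "i * s" s]) (rule ledges_infix)
  have Jmem: "\<exists>k<s. x = P ! (i * s + k) \<and> i * s + k < length P" if x: "x \<in> set (J i)" "i < m" for x i
  proof -
    obtain k where "k < length (J i)" "J i ! k = x" using x(1) by (auto simp: in_set_conv_nth)
    then show ?thesis using iv[OF x(2)] Jlen[OF x(2)] unfolding J_def by (intro exI[of _ k]) auto
  qed
  have Jdisj: "set (J i) \<inter> set (J i') = {}" if ii: "i < m" "i' < m" "i \<noteq> i'" for i i'
  proof (rule ccontr)
    assume "\<not> ?thesis"
    then obtain x where x: "x \<in> set (J i)" "x \<in> set (J i')" by blast
    obtain k where k: "k < s" "x = P ! (i * s + k)" "i * s + k < length P" using Jmem[OF x(1) ii(1)] by blast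
    obtain k' where k': "k' < s" "x = P ! (i' * s + k')" "i' * s + k' < length P" using Jmem[OF x(2) ii(2)] by blast
    have "i * s + k = i' * s + k'" using k k' dP by (metis nth_eq_iff_index_eq)
    then have "(i * s + k) div s = (i' * s + k') div s" by simp
    then show False using ii(3) k(1) k'(1) by simp
  qed
  have "\<forall>i\<in>{..<m}. \<exists>K\<subseteq>set (J i). 2 * g \<le> card (inner (J i) K) \<and>
    (\<forall>Z. Z \<subseteq> K \<longrightarrow> Z \<noteq> {} \<longrightarrow> card Z \<le> g \<longrightarrow> 2 * card Z < card {y \<in> inner (J i) K - Z. \<exists>z\<in>Z. adj z y})"
  proof
    fix i assume "i \<in> {..<m}"
    then show "\<exists>K\<subseteq>set (J i). 2 * g \<le> card (inner (J i) K) \<and>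
      (\<forall>Z. Z \<subseteq> K \<longrightarrow> Z \<noteq> {} \<longrightarrow> card Z \<le> g \<longrightarrow> 2 * card Z < card {y \<in> inner (J i) K - Z. \<exists>z\<in>Z. adj z y})"
      using Jlen[of i] Jdist JP sP g(1) unfolding s_def by (intro core_exists[OF j]) auto
  qed
  from bchoice[OF this] obtain K where K: "\<And>i. i < m \<Longrightarrow> K i \<subseteq> set (J i)" "\<And>i. i < m \<Longrightarrow> 2 * g \<le> card (inner (J i) (K i))"
    "\<And>i Z. i < m \<Longrightarrow> Z \<subseteq> K i \<Longrightarrow> Z \<noteq> {} \<Longrightarrow> card Z \<le> g \<Longrightarrow> 2 * card Z < card {y \<in> inner (J i) (K i) - Z. \<exists>z\<in>Z. adj z y}"
    by auto
  \<comment> \<open>Vertices that cannot start the rotations in some block, at most g for each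
    block.\<close>
  define Bad where "Bad = (\<Union>i<m. {x \<in> Q. \<not> (\<exists>y\<in>inner (J i) (K i). adj x y)})"
  have "card Bad \<le> (\<Sum>i<m. card {x \<in> Q. \<not> (\<exists>y\<in>inner (J i) (K i). adj x y)})" unfolding Bad_def by (rule card_UN_le) simp
  also have "\<dots> \<le> (\<Sum>i<m. g)"
  proof (rule sum_mono)
    fix i assume i: "i \<in> {..<m}"
    have "inner (J i) (K i) \<subseteq> Q" using JP[of i] sP unfolding inner_def by blast
    then show "card {x \<in> Q. \<not> (\<exists>y\<in>inner (J i) (K i). adj x y)} \<le> g"
      using joined_bad_card[OF j fin _ K(2)[of i]] i by simp
  qed
  finally have cBad: "card Bad \<le> m * g" by simp
  have fBad: "finite Bad" unfolding Bad_def using fin by simp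
  have cr: "core g (Q - Bad) (J i) (K i)" if i: "i < m" for i
    unfolding core_def
  proof (intro conjI allI impI ballI)
    show "J i \<noteq> []" using Jlen[OF i] ms(2) by auto
    show "K i \<subseteq> set (J i)" using K(1) i by blast
    show "2 * card Z < card {y \<in> inner (J i) (K i) - Z. \<exists>z\<in>Z. adj z y}" if "Z \<subseteq> K i" "Z \<noteq> {}" "card Z \<le> g" for Z
      using K(3)[OF i that] .
    show "\<exists>y\<in>inner (J i) (K i). adj x y" if "x \<in> Q - Bad" for x
      using that i unfolding Bad_def by blast
  qed
  have lenP: "length P \<le> card Q" using dP sP fin by (metis card_mono distinct_card)
  have "20 * (m * g) \<le> card Q" using ms lenP unfolding s_def by (simp add: mult_ac)
  moreover have "g \<le> m * g" "0 < m * g" unfolding m_def using g by simp_all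
  ultimately have big': "5 * (m * g) + g < card Q" by linarith
  obtain a0 b0 where p0: "pth Q a0 b0 P" using lg unfolding longest_def by blast
  obtain B where B: "m * g < card B" "B \<subseteq> Q" "\<And>b. b \<in> B \<Longrightarrow> \<exists>xs. pth Q (hd P) b xs \<and> set xs = set P \<and> card (ledges P - ledges xs) \<le> Suc q"
    using rot_many_ends[OF lg fin j ex g big'] by blast
  \<comment> \<open>There are more ends than bad vertices, so some end b works for all
    blocks.\<close>
  have "\<not> B \<subseteq> Bad" using B(1) cBad card_mono[OF fBad, of B] by linarith
  then obtain b where b: "b \<in> B" "b \<in> Q - Bad" using B(2) by blast
  obtain xs where xs: "pth Q (hd P) b xs" "set xs = set P" "card (ledges P - ledges xs) \<le> Suc q" using B(3) b by blast
  have "length xs = length P" using xs dP unfolding pth_def by (metis distinct_card)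
  \<comment> \<open>The reversed path is again longest; now the other end is rotated while b stays
    fixed.\<close>
  then have lg': "longest Q (rev xs)" using lg pth_rev[OF xs(1)] unfolding longest_def by auto
  obtain B' where B': "m * g < card B'" "B' \<subseteq> Q" "\<And>a. a \<in> B' \<Longrightarrow> \<exists>ys. pth Q (hd (rev xs)) a ys \<and> set ys = set (rev xs) \<and> card (ledges (rev xs) - ledges ys) \<le> Suc q"
    using rot_many_ends[OF lg' fin j ex g big'] by blast
  have "\<not> B' \<subseteq> Bad" using B'(1) cBad card_mono[OF fBad, of B'] by linarith
  then obtain a where a: "a \<in> B'" "a \<in> Q - Bad" using B'(2) by blast
  obtain ys where ys0: "pth Q (hd (rev xs)) a ys" "set ys = set (rev xs)" "card (ledges (rev xs) - ledges ys) \<le> Suc q" using B'(3) a by blast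
  have "hd (rev xs) = b" using xs(1) unfolding pth_def by (simp add: hd_rev)
  then have ys: "pth Q b a ys" "set ys = set P" "card (ledges xs - ledges ys) \<le> Suc q"
    using ys0 xs(2) unfolding ledges_rev by auto
  have dys: "distinct ys" using ys(1) unfolding pth_def by simp
  have "ledges P - ledges ys \<subseteq> (ledges P - ledges xs) \<union> (ledges xs - ledges ys)" by blast
  then have "card (ledges P - ledges ys) \<le> card ((ledges P - ledges xs) \<union> (ledges xs - ledges ys))"
    using finite_ledges by (intro card_mono) auto
  also have "\<dots> \<le> card (ledges P - ledges xs) + card (ledges xs - ledges ys)" by (rule card_Un_le)
  finally have broken: "card (ledges P - ledges ys) \<le> 2 * Suc q" using xs(3) ys(3) by simp
  \<comment> \<open>The damaged blocks. A destroyed edge picked in each of them determines its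
    block, since the blocks are disjoint.\<close>
  define I where "I = {i. i < m \<and> \<not> ledges (J i) \<subseteq> ledges ys}"
  have "\<forall>i\<in>I. \<exists>e. e \<in> ledges (J i) - ledges ys" unfolding I_def by blast
  from bchoice[OF this] obtain e where e: "\<And>i. i \<in> I \<Longrightarrow> e i \<in> ledges (J i) - ledges ys" by blast
  have "inj_on e I"
  proof (rule inj_onI)
    fix i i' assume ii: "i \<in> I" "i' \<in> I" "e i = e i'"
    show "i = i'"
    proof (rule ccontr)
      assume "i \<noteq> i'"
      then have "set (J i) \<inter> set (J i') = {}" using Jdisj ii unfolding I_def by blast
      moreover have "e i \<subseteq> set (J i)" "e i \<subseteq> set (J i')" "e i \<noteq> {}"
        using e[OF ii(1)] e[OF ii(2)] ii(3) ledges_sub ledges_nonempty_edge by (metis DiffD1)+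
      ultimately show False by blast
    qed
  qed
  moreover have "e ` I \<subseteq> ledges P - ledges ys" using e Jled by blast
  ultimately have "card I \<le> card (ledges P - ledges ys)"
    using card_inj_on_le[of e I] finite_ledges[of P] by blast
  then have cI: "card I \<le> 2 * q + 2" using broken by simp
  have fI: "finite I" unfolding I_def by simp
  have "card {..<m} - card I \<le> card ({..<m} - I)" using fI by (rule diff_card_le_card_Diff)
  then have "2 \<le> card ({..<m} - I)" using cI unfolding m_def by simp
  then obtain T where T: "T \<subseteq> {..<m} - I" "card T = 2" by (rule obtain_subset_with_card_n)
  then obtain i i' where "T = {i, i'}" "i \<noteq> i'" by (auto simp: card_2_iff)
  then have ii: "i \<in> {..<m} - I" "i' \<in> {..<m} - I" "i \<noteq> i'" using T(1) by auto
  have "\<exists>A us ws. ys = us @ A @ ws \<and> set A = set (J k) \<and> core g (Q - Bad) A (K k)" if k: "k \<in> {..<m} - I" for k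
  proof -
    have km: "k < m" "ledges (J k) \<subseteq> ledges ys" using k unfolding I_def by auto
    have "J k \<noteq> []" using cr[OF km(1)] unfolding core_def by simp
    then obtain us ws where "ys = us @ J k @ ws \<or> ys = us @ rev (J k) @ ws"
      using intact_sublist[OF dys Jdist _ _ km(2)] JP ys(2) by blast
    then show ?thesis
    proof
      assume "ys = us @ J k @ ws"
      then show ?thesis using cr[OF km(1)] by blast
    next
      assume "ys = us @ rev (J k) @ ws"
      then show ?thesis using core_rev[OF cr[OF km(1)]]
        by (intro exI[of _ "rev (J k)"] exI[of _ us] exI[of _ ws]) simp
    qed
  qed
  note sl = this
  obtain A us ws where A: "ys = us @ A @ ws" "set A = set (J i)" "core g (Q - Bad) A (K i)" using sl[OF ii(1)] by blast
  obtain B us' ws' where B: "ys = us' @ B @ ws'" "set B = set (J i')" "core g (Q - Bad) B (K i')" using sl[OF ii(2)] by blast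
  have "set A \<inter> set B = {}" using A(2) B(2) Jdisj ii by auto
  moreover have "A \<noteq> []" "B \<noteq> []" using A(3) B(3) unfolding core_def by auto
  ultimately obtain p mm r where "ys = p @ A @ mm @ B @ r \<or> ys = p @ B @ mm @ A @ r"
    using sublists_ordered[OF A(1) B(1) _ _ _ dys] by blast
  then show ?thesis
  proof
    assume y: "ys = p @ A @ mm @ B @ r"
    show ?thesis using two_cores_close[OF _ j b(2) a(2) A(3) B(3), of p mm r] ys y by simp
  next
    assume y: "ys = p @ B @ mm @ A @ r"
    show ?thesis using two_cores_close[OF _ j b(2) a(2) B(3) A(3), of p mm r] ys y by simp
  qed
qed

text \<open>If the cycle on the vertices of a longest path missed a vertex, some edge would leave
  the cycle, by expansion if few vertices are missed and by joinedness otherwise. Opening the cycle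
  at that edge gives a longer path.\<close>

lemma hamilton:
  assumes fin: "finite Q" and j: "joined g Q" and ex: "expands g Q" and g: "0 < g" "g \<le> 2 ^ q"
    and big: "(2 * q + 4) * (20 * g) + 2 * g \<le> card Q"
  shows "cyc (card Q) Q"
proof -
  have "2 * g < card Q" using big g(1) by (simp add: algebra_simps)
  \<comment> \<open>The term 2 g in the size bound pays for the vertices missed by this
    path.\<close>
  then obtain a0 b0 xs0 where x0: "pth Q a0 b0 xs0" "card Q \<le> length xs0 + 2 * g"
    using long_path_of_joined[OF fin _ j] by blast
  define isp where "isp = (\<lambda>xs. \<exists>a b. pth Q a b xs)"
  have bd: "length xs \<le> card Q" if "isp xs" for xs
    using that fin unfolding isp_def pth_def by (metis card_mono distinct_card)
  have "isp xs0" using x0(1) unfolding isp_def by blast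
  then obtain P where P: "isp P" and mx: "\<And>xs. isp xs \<Longrightarrow> length xs \<le> length P"
    using ex_has_greatest_nat[of isp xs0 length "Suc (card Q)"] bd by (metis less_Suc_eq_le less_imp_le)
  have lg: "longest Q P" using P mx unfolding longest_def isp_def by blast
  have len: "(2 * q + 4) * (20 * g) \<le> length P" using mx[OF \<open>isp xs0\<close>] x0(2) big by linarith
  obtain C where C: "distinct C" "set C = set P" "successively adj C" "adj (last C) (hd C)"
    using longest_closes[OF lg fin j ex g len] by blast
  have dP: "distinct P" and sP: "set P \<subseteq> Q" using P unfolding isp_def pth_def by auto
  have lC: "length C = length P" using C dP by (metis distinct_card)
  have "set P = Q"
  proof (rule ccontr)
    assume ne: "set P \<noteq> Q"
    let ?Z = "Q - set P"
    have Zne: "?Z \<noteq> {}" using ne sP by blast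
    have "\<exists>z\<in>?Z. \<exists>c\<in>set P. adj z c"
    proof (cases "card ?Z \<le> g")
      case True
      then have "8 * card ?Z \<le> card {y \<in> Q - ?Z. \<exists>z\<in>?Z. adj z y}" using Zne by (intro expandsD[OF ex]) auto
      moreover have "0 < card ?Z" using Zne fin by (simp add: card_gt_0_iff)
      ultimately have "{y \<in> Q - ?Z. \<exists>z\<in>?Z. adj z y} \<noteq> {}" by (metis card.empty le_zero_eq mult_is_0 not_gr_zero zero_neq_numeral)
      then show ?thesis by blast
    next
      case False
      have "g \<le> (2 * q + 4) * (20 * g)" by simp
      then have "g \<le> length P" using len by (rule order_trans)
      then have "g \<le> card (set P)" using dP by (simp add: distinct_card)
      then have "\<not> nonadj ?Z (set P)" using False sP by (intro joinedD[OF j]) auto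
      then show ?thesis unfolding nonadj_def by blast
    qed
    then obtain z c where z: "z \<in> Q" "z \<notin> set P" "c \<in> set P" "adj z c" by blast
    then obtain us ws where us: "C = us @ c # ws" using C(2) by (metis split_list)
    have "successively adj ((c # ws) @ us)"
    proof (cases "us = []")
      case False
      have "successively adj us" "successively adj (c # ws)" "adj (last (c # ws)) (hd us)"
        using C(3,4) us False by (auto simp: successively_append_iff)
      then show ?thesis unfolding successively_append_iff by blast
    qed (use C us in auto)
    then have "pth Q z (last (c # ws @ us)) (z # c # ws @ us)"
      unfolding pth_def using z C(1,2) us sP by (auto simp: successively_Cons)
    then have "isp (z # c # ws @ us)" unfolding isp_def by blast
    from mx[OF this] show False using lC us by simp
  qed
  then have "length C = card Q" using lC dP by (metis distinct_card)
  then show ?thesis unfolding cyc_def using C sP by (intro exI[of _ C]) auto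
qed

end

section \<open>Tough sets and cycles from chains\<close>

context sgraph
begin

lemma packing_Suc: "packing h (Suc r) U \<Longrightarrow> packing h r U"
proof -
  assume "packing h (Suc r) U"
  then obtain B where "B \<subseteq> U" "packing h r B" by auto
  then show ?thesis using packing_mono by blast
qed

lemma packing_le: "packing h r U \<Longrightarrow> s \<le> r \<Longrightarrow> packing h s U"
  by (induction r) (auto simp: le_Suc_eq simp del: packing.simps(2) dest: packing_Suc)

lemma exact_rank:
  assumes "finite A" "0 < h" "h \<le> card A"
  shows "\<exists>a\<ge>1. packing h a A \<and> \<not> packing h (Suc a) A"
proof -
  have one: "packing h (Suc 0) A" using assms(3) unfolding packing_one by blast
  have bd: "a \<le> card A" if "packing h a A" for a
  proof -
    have "a * 1 \<le> a * h" using assms(2) by (intro mult_le_mono2) simp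
    then show ?thesis using packing_card[OF that assms(1)] by linarith
  qed
  define a where "a = (GREATEST a. packing h a A)"
  have "packing h a A" unfolding a_def using one bd by (rule GreatestI_nat)
  moreover have le: "b \<le> a" if "packing h b A" for b unfolding a_def using that bd by (rule Greatest_le_nat)
  have "1 \<le> a" using le[OF one] by simp
  moreover have "\<not> packing h (Suc a) A" using le[of "Suc a"] by (metis Suc_n_not_le_n)
  ultimately show ?thesis by (intro exI[of _ a] conjI)
qed

text \<open>Suppose that deleting at most t vertices splits a minimal S into A and B, of ranks a and
  b. Then a + b <= r, and r k <= |S| + t together with |S| <= |A| + |B| + t gives (a + b) k <= (|A|
  + t) + (|B| + t). Hence A or B satisfies the same size condition and is smaller.\<close>

lemma good_set:
  assumes fin: "finite U" and rk: "\<not> packing h (Suc r0) U" and r0: "1 \<le> r0" "r0 * k \<le> card U + t" and h: "0 < h"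
  shows "\<exists>S r. S \<subseteq> U \<and> 1 \<le> r \<and> \<not> packing h (Suc r) S \<and> r * k \<le> card S + t \<and> tough h t S"
proof -
  define ok where "ok = (\<lambda>S. S \<subseteq> U \<and> (\<exists>r\<ge>1. \<not> packing h (Suc r) S \<and> r * k \<le> card S + t))"
  have okU: "ok U" unfolding ok_def using rk r0 by blast
  define S where "S = arg_min card ok"
  have okS: "ok S" and mn: "\<And>A. ok A \<Longrightarrow> card S \<le> card A"
    using okU unfolding S_def by (auto intro: arg_min_natI arg_min_nat_le)
  obtain r where r: "S \<subseteq> U" "1 \<le> r" "\<not> packing h (Suc r) S" "r * k \<le> card S + t" using okS unfolding ok_def by blast
  have fS: "finite S" using r(1) fin finite_subset by blast
  have "tough h t S"
    unfolding tough_def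
  proof (intro allI impI)
    fix A B assume AB: "A \<subseteq> S" "B \<subseteq> S" "A \<inter> B = {}" "nonadj A B" "h \<le> card A" "h \<le> card B"
    show "t < card (S - (A \<union> B))"
    proof (rule ccontr)
      assume "\<not> t < card (S - (A \<union> B))"
      then have le: "card (S - (A \<union> B)) \<le> t" by simp
      have f: "finite A" "finite B" using AB fS finite_subset by blast+
      obtain a where a: "1 \<le> a" "packing h a A" "\<not> packing h (Suc a) A" using exact_rank[OF f(1) h AB(5)] by blast
      obtain b where b: "1 \<le> b" "packing h b B" "\<not> packing h (Suc b) B" using exact_rank[OF f(2) h AB(6)] by blast
      have "packing h (a + b) S" using packing_add[OF a(2) b(2) AB(3,4,1,2)] .
      then have ab: "a + b \<le> r" using r(3) packing_le[of h "a + b" S "Suc r"] by (metis not_less_eq_eq)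
      have "S \<subseteq> (A \<union> B) \<union> (S - (A \<union> B))" by blast
      then have "card S \<le> card ((A \<union> B) \<union> (S - (A \<union> B)))" using fS f by (intro card_mono) auto
      also have "\<dots> \<le> card (A \<union> B) + card (S - (A \<union> B))" by (rule card_Un_le)
      also have "\<dots> \<le> card A + card B + t" using le card_Un_le[of A B] by linarith
      finally have cS: "card S \<le> card A + card B + t" .
      have "(a + b) * k \<le> r * k" using ab by (rule mult_le_mono1)
      then have "a * k + b * k \<le> (card A + t) + (card B + t)" using r(4) cS by (simp add: add_mult_distrib)
      then have "a * k \<le> card A + t \<or> b * k \<le> card B + t" by linarith
      then show False
      proof
        assume "a * k \<le> card A + t"
        then have "ok A" unfolding ok_def using a AB(1) r(1) by blast
        then have "card S \<le> card A" by (rule mn)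
        then have "A = S" using AB(1) fS by (meson card_seteq)
        then have "B = {}" using AB(2,3) by blast
        then show False using AB(6) h by simp
      next
        assume "b * k \<le> card B + t"
        then have "ok B" unfolding ok_def using b AB(2) r(1) by blast
        then have "card S \<le> card B" by (rule mn)
        then have "B = S" using AB(2) fS by (meson card_seteq)
        then have "A = {}" using AB(1,3) by blast
        then show False using AB(5) h by simp
      qed
    qed
  qed
  then show ?thesis using r by blast
qed

lemma chain_infix:
  assumes "chain pt (us @ vs @ ws)" shows "chain pt vs"
  using assms unfolding chain_def by (auto simp: successively_append_iff)

text \<open>Sub-chains starting at one of the first \<open>h\<close> beads and ending at one of the last \<open>h\<close> beads all
  contain the beads in the middle; this is what makes the length of the closed-up cycle adjustable.\<close>

lemma chain_cycle:
  fixes W :: "'b \<Rightarrow> 'a set" and lo hi :: "'b \<Rightarrow> nat"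
  assumes h: "0 < h" and fin: "finite S0"
    and ch: "chain pt os" and osI: "fst ` set os \<subseteq> I" and c: "2 * h < length os"
    and fl: "\<And>i. i \<in> I \<Longrightarrow> flex (pt i True) (pt i False) (W i) (lo i) (hi i) \<and> lo i \<le> hi i"
    and dis: "\<And>i j. i \<in> I \<Longrightarrow> j \<in> I \<Longrightarrow> i \<noteq> j \<Longrightarrow> W i \<inter> W j = {}"
    and ptW: "\<And>i d. i \<in> I \<Longrightarrow> pt i d \<in> W i"
    and WS: "\<And>i. i \<in> I \<Longrightarrow> W i \<inter> S0 = {}"
    and host: "\<And>E. E \<subseteq> {pt i d | i d. i \<in> I} \<Longrightarrow> card E \<le> 2 * h \<Longrightarrow> edgy h (S0 \<union> E) \<and> tough h (10 * h) (S0 \<union> E)"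
    and rk: "\<not> packing h (Suc r) S0"
    and mid: "mid = fst ` set (take (length os - 2 * h) (drop h os))"
    and save: "2 * h \<le> (\<Sum>i\<in>mid. hi i - lo i)" and N0: "N0 \<le> (\<Sum>i\<in>mid. hi i)" "2 * h \<le> N0"
    and small: "(\<Sum>i\<in>fst ` set os. hi i) < n"
    and size: "n + 2 * h * Suc r \<le> N0 + card S0" "6 * h * Suc r \<le> card S0"
  shows "cyc n (S0 \<union> (\<Union>i\<in>I. W i))"
proof -
  let ?c = "length os"
  let ?F = "\<Union>i\<in>I. W i"
  define ent where "ent = (\<lambda>i. pt (fst (os ! i)) (snd (os ! i)))"
  define ext where "ext = (\<lambda>i. pt (fst (os ! i)) (\<not> snd (os ! i)))"
  have inI: "fst (os ! i) \<in> I" if "i < ?c" for i using osI that by auto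
  have dos: "distinct (map fst os)" using ch unfolding chain_def by simp
  have fstinj: "i = j" if ij: "fst (os ! i) = fst (os ! j)" "i < ?c" "j < ?c" for i j
    using dos ij by (metis length_map nth_eq_iff_index_eq nth_map)
  have ptinj: "i = j" if ij: "pt i d = pt j e" "i \<in> I" "j \<in> I" for i j d e
    using dis[of i j] ptW[of i d] ptW[of j e] ij by auto
  define E1 where "E1 = ent ` {..<h}"
  define E2 where "E2 = ext ` {?c - h..<?c}"
  have cE1: "card E1 = h"
  proof -
    have "inj_on ent {..<h}"
    proof (rule inj_onI)
      fix i j assume ij: "i \<in> {..<h}" "j \<in> {..<h}" "ent i = ent j"
      then have "fst (os ! i) = fst (os ! j)" using ptinj inI c unfolding ent_def by auto
      then show "i = j" using fstinj ij c by auto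
    qed
    then show ?thesis unfolding E1_def by (simp add: card_image)
  qed
  have cE2: "card E2 = h"
  proof -
    have "inj_on ext {?c - h..<?c}"
    proof (rule inj_onI)
      fix i j assume ij: "i \<in> {?c - h..<?c}" "j \<in> {?c - h..<?c}" "ext i = ext j"
      then have "fst (os ! i) = fst (os ! j)" using ptinj inI unfolding ext_def by auto
      then show "i = j" using fstinj ij by auto
    qed
    then show ?thesis unfolding E2_def using c by (simp add: card_image)
  qed
  have E12: "E1 \<inter> E2 = {}"
  proof (rule ccontr)
    assume "\<not> ?thesis"
    then obtain i j where ij: "i < h" "?c - h \<le> j" "j < ?c" "ent i = ext j" unfolding E1_def E2_def by auto
    then have "fst (os ! i) = fst (os ! j)" using ptinj inI c unfolding ent_def ext_def by auto
    then have "i = j" using fstinj ij c by auto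
    then show False using ij c by simp
  qed
  have E1pt: "E1 \<subseteq> {pt i d | i d. i \<in> I}" unfolding E1_def ent_def using inI c by fastforce
  have E2pt: "E2 \<subseteq> {pt i d | i d. i \<in> I}" unfolding E2_def ext_def using inI by fastforce
  have EF: "E1 \<union> E2 \<subseteq> ?F" using E1pt E2pt ptW by blast
  have FS: "?F \<inter> S0 = {}" using WS by blast
  have cE: "card (E1 \<union> E2) \<le> 2 * h" using card_Un_le[of E1 E2] cE1 cE2 by simp
  have hs: "edgy h (S0 \<union> (E1 \<union> E2))" "tough h (10 * h) (S0 \<union> (E1 \<union> E2))"
    using host[of "E1 \<union> E2"] E1pt E2pt cE by auto
  show ?thesis
  proof (rule closing[OF h fin E12 cE1 cE2 EF FS _ _ rk _ size N0(2)])
    show "edgy h (S0 \<union> E1 \<union> E2)" "tough h (10 * h) (S0 \<union> E1 \<union> E2)" using hs by (simp_all add: Un_assoc)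
    fix e1 e2 assume "e1 \<in> E1" "e2 \<in> E2"
    then obtain i j where ij: "i < h" "?c - h \<le> j" "j < ?c" "e1 = ent i" "e2 = ext j" unfolding E1_def E2_def by auto
    have ilt: "i < j" using ij c by simp
    let ?v = "take (Suc j - i) (drop i os)"
    have dec: "os = take i os @ ?v @ drop (Suc j - i) (drop i os)" by (rule infix_decomp)
    have chv: "chain pt ?v" using chain_infix[of pt "take i os" ?v "drop (Suc j - i) (drop i os)"] ch dec by simp
    have lv: "length ?v = Suc j - i" using ij by simp
    have vne: "?v \<noteq> []" using lv ilt by auto
    have hv: "hd ?v = os ! i" using ij ilt by (simp add: hd_drop_conv_nth)
    have "last ?v = ?v ! (j - i)" using vne lv ilt by (simp add: last_conv_nth)
    then have lastv: "last ?v = os ! j" using ij ilt by simp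
    have vsub: "fst ` set ?v \<subseteq> fst ` set os" by (meson image_mono order_trans set_drop_subset set_take_subset)
    have midv: "mid \<subseteq> fst ` set ?v"
    proof -
      have "set (take (?c - 2 * h) (drop h os)) \<subseteq> set ?v"
      proof
        fix x assume "x \<in> set (take (?c - 2 * h) (drop h os))"
        then obtain k where k: "k < ?c - 2 * h" "x = os ! (h + k)" by (auto simp: in_set_conv_nth)
        have "h + k - i < length ?v" "?v ! (h + k - i) = x" using k ij lv by auto
        then show "x \<in> set ?v" by (metis nth_mem)
      qed
      then show ?thesis unfolding mid by (rule image_mono)
    qed
    let ?V = "fst ` set ?v"
    have fV: "finite ?V" by simp
    have f1: "flex (pt (fst (hd ?v)) (snd (hd ?v))) (pt (fst (last ?v)) (\<not> snd (last ?v))) (\<Union>i\<in>?V. W i)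
      (\<Sum>i\<in>?V. lo i) (\<Sum>i\<in>?V. hi i)"
      using vsub osI by (intro chain_flex[OF chv _ vne fl dis, of I]) auto
    have "(\<Sum>i\<in>mid. hi i - lo i) \<le> (\<Sum>i\<in>?V. hi i - lo i)" using midv by (intro sum_mono2) auto
    also have "(\<Sum>i\<in>?V. hi i - lo i) = (\<Sum>i\<in>?V. hi i) - (\<Sum>i\<in>?V. lo i)"
      using fl vsub osI by (intro sum_subtractf_nat) blast
    finally have sv: "2 * h \<le> (\<Sum>i\<in>?V. hi i) - (\<Sum>i\<in>?V. lo i)" using save by simp
    have "(\<Sum>i\<in>mid. hi i) \<le> (\<Sum>i\<in>?V. hi i)" using midv by (intro sum_mono2) auto
    then have n0: "N0 \<le> (\<Sum>i\<in>?V. hi i)" using N0(1) by simp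
    have "(\<Sum>i\<in>?V. hi i) \<le> (\<Sum>i\<in>fst ` set os. hi i)" using vsub by (intro sum_mono2) auto
    then have n1: "(\<Sum>i\<in>?V. hi i) < n" using small by simp
    have "flex e1 e2 (\<Union>i\<in>?V. W i) (\<Sum>i\<in>?V. lo i) (\<Sum>i\<in>?V. hi i)"
      using f1 ij(4,5) unfolding hv lastv ent_def ext_def by simp
    moreover have "(\<Union>i\<in>?V. W i) \<subseteq> ?F" using vsub osI by blast
    moreover have "(\<Sum>i\<in>?V. lo i) \<le> (\<Sum>i\<in>?V. hi i) - 2 * h" using sv h by linarith
    ultimately have "flex e1 e2 ?F ((\<Sum>i\<in>?V. hi i) - 2 * h) (\<Sum>i\<in>?V. hi i)" by (rule flex_mono)
    then show "\<exists>hi. N0 \<le> hi \<and> hi < n \<and> flex e1 e2 ?F (hi - 2 * h) hi" using n0 n1 by blast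
  qed
qed

lemma tough_Diff:
  assumes "tough h t S" "finite S" "T \<subseteq> S" "card (S - T) + t' \<le> t"
  shows "tough h t' T"
  unfolding tough_def
proof (intro allI impI)
  fix A B assume AB: "A \<subseteq> T" "B \<subseteq> T" "A \<inter> B = {}" "nonadj A B" "h \<le> card A" "h \<le> card B"
  have "t < card (S - (A \<union> B))" using AB assms(3) by (intro toughD[OF assms(1)]) auto
  also have "card (S - (A \<union> B)) \<le> card ((S - T) \<union> (T - (A \<union> B)))"
    using assms(2,3) finite_subset[OF assms(3,2)] by (intro card_mono) auto
  also have "\<dots> \<le> card (S - T) + card (T - (A \<union> B))" by (rule card_Un_le)
  finally show "t' < card (T - (A \<union> B))" using assms(4) by linarith
qed

text \<open>Vacuous, as there are no two disjoint non-adjacent h-sets at all.\<close>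

lemma joined_tough: "joined h S \<Longrightarrow> tough h t S"
  unfolding tough_def using joinedD by blast

lemma flex_hi_le:
  assumes "flex p q W lo hi" "lo \<le> hi" "finite W" shows "hi \<le> card W"
proof -
  obtain xs where "pth W p q xs" "length xs = hi" using assms unfolding flex_def by blast
  then show ?thesis using assms(3) unfolding pth_def by (metis card_mono distinct_card)
qed

lemma card_fst_set: "chain pt os \<Longrightarrow> card (fst ` set (take a (drop b os))) = length (take a (drop b os))"
proof -
  assume "chain pt os"
  then have "distinct (map fst (take a (drop b os)))"
    unfolding chain_def take_map[symmetric] drop_map[symmetric] by simp
  then show ?thesis by (metis distinct_card length_map set_map)
qed

text \<open>Here S has room to spare and only the exact length matters. A chain of 4 h adjusters is
  enough: its middle 2 h beads are always traversed and provide 2 h units. The number T of adjusters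
  is what \<open>chain_of_rank\<close> asks for.\<close>

lemma cyc_of_high_rank:
  assumes h: "0 < h" and l: "l = 2 * lam + 2" and lam: "4 * h < 2 ^ Suc lam" and t: "t = 30 * h * l" and n: "100 * t \<le> n"
    and fin: "finite S" and ed: "edgy h S" and r: "2 \<le> r" and rk: "\<not> packing h (Suc r) S"
    and size: "r * (n - 1) \<le> card S + t" and tg: "tough h t S"
  shows "cyc n S"
proof -
  have hl: "2 * h \<le> h * l" "l \<le> h * l" using l h mult_le_mono1[of 1 h l] by simp_all
  have tl: "t = 30 * (h * l)" using t by simp
  obtain s where s: "r = Suc (Suc s)" using r by (metis Suc_le_D numeral_2_eq_2 Suc_le_mono)
  define T where "T = Suc r * (h + 4 * h)"
  have sz: "s * (n - 1) + 2 * (n - 1) \<le> card S + t" using size s by simp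
  \<comment> \<open>The losses grow with the rank like s h l, where r = s + 2; the s additional
    multiples of n - 1 in the size of S pay for them.\<close>
  have sh: "s * (50 * (h * l)) \<le> s * (n - 1)" using n tl hl h by (intro mult_le_mono2) linarith
  have shh: "s * (2 * h) \<le> s * (h * l)" using hl by (intro mult_le_mono2)
  have T1: "T * l = 5 * (s * (h * l)) + 15 * (h * l)" unfolding T_def s by (simp add: algebra_simps)
  have sh': "50 * (s * (h * l)) \<le> s * (n - 1)" using sh by (simp add: mult.left_commute)
  have big: "T * l + 4 * h \<le> card S" using T1 sz sh' n tl hl h by linarith
  then obtain p q W where g: "\<And>i. i < T \<Longrightarrow> W i \<subseteq> S \<and> gadget l (p i) (q i) (W i)"
    "\<And>i j. i < T \<Longrightarrow> j < T \<Longrightarrow> i \<noteq> j \<Longrightarrow> W i \<inter> W j = {}"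
    using many_gadgets[OF fin ed lam, of T, folded l] by metis
  define pt where "pt = (\<lambda>i (d::bool). if d then p i else q i)"
  have ptW: "pt i d \<in> W i" if "i < T" for i d using g(1)[OF that] unfolding pt_def gadget_def by simp
  have ptinj: "i = j" if "i < T" "j < T" "pt i d = pt j e" for i j d e
    using g(2)[of i j] ptW[of i d] ptW[of j e] that by auto
  have "{pt i d | i d. i \<in> {..<T}} \<subseteq> S" using ptW g(1) by fastforce
  then have "\<not> packing h (Suc r) {pt i d | i d. i \<in> {..<T}}" using rk packing_mono by blast
  then have "\<exists>os. chain pt os \<and> fst ` set os \<subseteq> {..<T} \<and> length os = 4 * h"
    using ptinj unfolding T_def by (intro chain_of_rank[where r = r and h = h]) auto
  then obtain os where os: "chain pt os" "fst ` set os \<subseteq> {..<T}" "length os = 4 * h" by blast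
  define I where "I = fst ` set os"
  have IT: "i < T" if "i \<in> I" for i using os(2) that unfolding I_def by auto
  have cI: "card I = 4 * h" unfolding I_def using card_fst_set[OF os(1), of "length os" 0] os(3) by simp
  have fI: "finite I" unfolding I_def by simp
  have "\<forall>i\<in>I. \<exists>lo. flex (p i) (q i) (W i) lo (Suc lo)" using g(1) IT unfolding gadget_def by blast
  from bchoice[OF this] obtain lo where lo: "\<And>i. i \<in> I \<Longrightarrow> flex (p i) (q i) (W i) (lo i) (Suc (lo i))" by blast
  have hil: "Suc (lo i) \<le> l" if i: "i \<in> I" for i
    using flex_hi_le[OF lo[OF i]] g(1)[OF IT[OF i]] unfolding gadget_def by auto
  let ?F = "\<Union>i\<in>I. W i"
  have "card ?F \<le> (\<Sum>i\<in>I. card (W i))" using fI by (rule card_UN_le)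
  also have "\<dots> \<le> (\<Sum>i\<in>I. l)" using g(1) IT by (intro sum_mono) (auto simp: gadget_def)
  finally have cF: "card ?F \<le> 4 * (h * l)" using cI by simp
  have FS: "?F \<subseteq> S" using g(1) IT by blast
  define S0 where "S0 = S - ?F"
  have fS0: "finite S0" unfolding S0_def using fin by simp
  have fF: "finite ?F" using FS fin finite_subset by blast
  have cS0: "card S \<le> card S0 + 4 * (h * l)"
    unfolding S0_def using diff_card_le_card_Diff[OF fF, of S] cF by linarith
  let ?mid = "fst ` set (take (length os - 2 * h) (drop h os))"
  have cmid: "card ?mid = 2 * h" using card_fst_set[OF os(1)] os(3) by simp
  have "cyc n (S0 \<union> ?F)"
  \<comment> \<open>The crude value N0 = 2 h, one vertex per middle bead, is enough, since S0 alone
    has more than n vertices to offer.\<close>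
  proof (rule chain_cycle[OF h fS0 os(1), where mid = ?mid and lo = lo and hi = "\<lambda>i. Suc (lo i)" and r = r and ?N0.0 = "2 * h"])
    show "fst ` set os \<subseteq> I" unfolding I_def by simp
    show "2 * h < length os" using os(3) h by simp
    show "flex (pt i True) (pt i False) (W i) (lo i) (Suc (lo i)) \<and> lo i \<le> Suc (lo i)" if "i \<in> I" for i
      using lo[OF that] unfolding pt_def by simp
    show "W i \<inter> W j = {}" if "i \<in> I" "j \<in> I" "i \<noteq> j" for i j using g(2) IT that by blast
    show "pt i d \<in> W i" if "i \<in> I" for i d using ptW IT that by blast
    show "W i \<inter> S0 = {}" if "i \<in> I" for i using that unfolding S0_def by blast
    show "\<not> packing h (Suc r) S0" using rk packing_mono unfolding S0_def by blast
    show "?mid = fst ` set (take (length os - 2 * h) (drop h os))" ..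
    show "2 * h \<le> (\<Sum>i\<in>?mid. Suc (lo i) - lo i)" using cmid by simp
    have "(\<Sum>i\<in>?mid. 1) \<le> (\<Sum>i\<in>?mid. Suc (lo i))" by (rule sum_mono) simp
    then show "2 * h \<le> (\<Sum>i\<in>?mid. Suc (lo i))" using cmid by simp
    show "2 * h \<le> 2 * h" ..
    have "(\<Sum>i\<in>fst ` set os. Suc (lo i)) \<le> (\<Sum>i\<in>fst ` set os. l)" using hil unfolding I_def by (intro sum_mono) auto
    also have "\<dots> = 4 * (h * l)" using cI unfolding I_def by simp
    finally show "(\<Sum>i\<in>fst ` set os. Suc (lo i)) < n" using n tl hl h by linarith
    show "n + 2 * h * Suc r \<le> 2 * h + card S0"
    proof -
      have "2 * h * Suc r = s * (2 * h) + 6 * h" unfolding s by (simp add: algebra_simps)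
      then show ?thesis using cS0 sz shh sh' n tl hl h by linarith
    qed
    show "6 * h * Suc r \<le> card S0"
    proof -
      have "6 * h * Suc r = 3 * (s * (2 * h)) + 18 * h" unfolding s by (simp add: algebra_simps)
      then show ?thesis using cS0 sz shh sh' n tl hl h by linarith
    qed
    fix E assume E: "E \<subseteq> {pt i d | i d. i \<in> I}" "card E \<le> 2 * h"
    have ES: "S0 \<union> E \<subseteq> S" using E(1) ptW IT FS unfolding S0_def by blast
    have "S - (S0 \<union> E) \<subseteq> ?F" unfolding S0_def by blast
    then have "card (S - (S0 \<union> E)) \<le> 4 * (h * l)" using cF fF by (meson card_mono order_trans)
    then have "tough h (10 * h) (S0 \<union> E)" using hl tl h by (intro tough_Diff[OF tg fin ES]) linarith
    then show "edgy h (S0 \<union> E) \<and> tough h (10 * h) (S0 \<union> E)" using edgy_mono[OF ed ES] by simp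
  qed
  moreover have "S0 \<union> ?F = S" using FS unfolding S0_def by blast
  ultimately show ?thesis by simp
qed

section \<open>Detours through a large matching\<close>

lemma maximal_matching:
  assumes "finite V"
  shows "\<exists>Y f. Y \<subseteq> V \<and> inj_on f Y \<and> f ` Y \<subseteq> S \<and> (\<forall>y\<in>Y. adj y (f y)) \<and> nonadj (V - Y) (S - f ` Y)"
proof -
  define ok where "ok = (\<lambda>Y. Y \<subseteq> V \<and> (\<exists>f. inj_on f Y \<and> f ` Y \<subseteq> S \<and> (\<forall>y\<in>Y. adj y (f y))))"
  have "ok {}" unfolding ok_def by simp
  moreover have "card Y < Suc (card V)" if "ok Y" for Y using that assms unfolding ok_def by (simp add: card_mono less_Suc_eq_le)
  ultimately obtain Y where Y: "ok Y" and mx: "\<And>X. ok X \<Longrightarrow> card X \<le> card Y"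
    using ex_has_greatest_nat[of ok "{}" card "Suc (card V)"] by (metis less_imp_le)
  obtain f where f: "Y \<subseteq> V" "inj_on f Y" "f ` Y \<subseteq> S" "\<forall>y\<in>Y. adj y (f y)" using Y unfolding ok_def by blast
  have "nonadj (V - Y) (S - f ` Y)"
    unfolding nonadj_def
  proof (intro ballI notI)
    fix y s assume ys: "y \<in> V - Y" "s \<in> S - f ` Y" "adj y s"
    have "inj_on (f(y := s)) (insert y Y)" using f(2) ys by (auto simp: inj_on_def)
    moreover have "(f(y := s)) ` insert y Y \<subseteq> S" using f(3) ys by auto
    moreover have "\<forall>z\<in>insert y Y. adj z ((f(y := s)) z)" using f(4) ys by auto
    ultimately have "ok (insert y Y)" using f(1) ys unfolding ok_def by blast
    then have "card (insert y Y) \<le> card Y" by (rule mx)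
    moreover have "finite Y" using f(1) assms finite_subset by blast
    ultimately show False using ys by simp
  qed
  then show ?thesis using f by blast
qed

lemma many_disjoint_edges:
  assumes "finite Y" "edgy h Y" "2 * k + h \<le> card Y"
  shows "\<exists>u v. (\<forall>i<k. u i \<in> Y \<and> v i \<in> Y \<and> adj (u i) (v i)) \<and> (\<forall>i<k. \<forall>j<k. i \<noteq> j \<longrightarrow> {u i, v i} \<inter> {u j, v j} = {})"
  using assms(3)
proof (induction k)
  case (Suc k)
  then have "2 * k + h \<le> card Y" by simp
  then obtain u v where IH: "\<And>i. i < k \<Longrightarrow> u i \<in> Y \<and> v i \<in> Y \<and> adj (u i) (v i)"
    "\<And>i j. i < k \<Longrightarrow> j < k \<Longrightarrow> i \<noteq> j \<Longrightarrow> {u i, v i} \<inter> {u j, v j} = {}" using Suc.IH by metis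
  let ?R = "\<Union>i<k. {u i, v i}"
  have "card ?R \<le> (\<Sum>i<k. card {u i, v i})" by (rule card_UN_le) simp
  also have "\<dots> \<le> (\<Sum>i<k. 2)" by (intro sum_mono) (simp add: card_insert_if)
  finally have "card ?R \<le> 2 * k" by simp
  moreover have "card Y - card ?R \<le> card (Y - ?R)" by (rule diff_card_le_card_Diff) simp
  ultimately have "h \<le> card (Y - ?R)" using Suc.prems by simp
  then have "\<exists>x y. x \<in> Y - ?R \<and> y \<in> Y - ?R \<and> adj x y" by (intro edgyD[OF assms(2)]) auto
  then obtain x y where xy: "x \<in> Y - ?R" "y \<in> Y - ?R" "adj x y" by blast
  have new: "{u i, v i} \<inter> {x, y} = {}" if "i < k" for i using xy that by blast
  show ?case
    using IH xy new by (intro exI[of _ "u(k := x)"] exI[of _ "v(k := y)"]) (auto simp: less_Suc_eq)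
qed auto

text \<open>S is t + 1 vertices short of n. An edge between matched vertices u, v outside S gives a
  bead f u, u, v, f v with only two vertices in S; t such beads gain 2 t, which covers the deficit
  and all losses of order h l. Up to 4 h beads can be lost, 2 h in the search and h at either end of
  the chain, so 6 h adjusters leave the 2 h that are needed.\<close>

lemma cyc_of_large_matching:
  assumes h: "0 < h" and l: "l = 2 * lam + 2" and lam: "4 * h < 2 ^ Suc lam" and t: "t = 30 * h * l" and n: "100 * t \<le> n"
    and fin: "finite U" and ed: "edgy h U" and SU: "S \<subseteq> U" and jn: "joined h S" and cS: "card S = n - 1 - t"
    and Y: "Y \<subseteq> U - S" "inj_on f Y" "f ` Y \<subseteq> S" "\<forall>y\<in>Y. adj y (f y)" and cY: "card Y = 2 * t + h"
  shows "cyc n U"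
proof -
  have hl: "2 * h \<le> h * l" "l \<le> h * l" using l h mult_le_mono1[of 1 h l] by simp_all
  have tl: "t = 30 * (h * l)" using t by simp
  have fS: "finite S" and fY: "finite Y" using SU Y(1) fin finite_subset by blast+
  obtain u v where uv: "\<And>i. i < t \<Longrightarrow> u i \<in> Y \<and> v i \<in> Y \<and> adj (u i) (v i)"
    "\<And>i j. i < t \<Longrightarrow> j < t \<Longrightarrow> i \<noteq> j \<Longrightarrow> {u i, v i} \<inter> {u j, v j} = {}"
  proof -
    have "edgy h Y" using edgy_mono[OF ed] Y(1) by blast
    then show ?thesis using many_disjoint_edges[OF fY, of h t] cY that by (metis order_refl)
  qed
  have cfY: "card (f ` Y) \<le> 2 * t + h" using card_image_le[OF fY, of f] cY by simp
  \<comment> \<open>Adjusters are taken from the unmatched part of S, which makes them disjoint from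
    the detours.\<close>
  let ?R = "S - f ` Y"
  have cR: "card S \<le> card ?R + (2 * t + h)" using diff_card_le_card_Diff[of "f ` Y" S] fY cfY by force
  have "6 * h * l + 4 * h \<le> card ?R" using cR cS n tl hl h by linarith
  moreover have "edgy h ?R" using edgy_mono[OF ed] SU by blast
  ultimately have "\<exists>p q W. (\<forall>i<6 * h. W i \<subseteq> ?R \<and> gadget l (p i) (q i) (W i)) \<and> (\<forall>i<6 * h. \<forall>j<6 * h. i \<noteq> j \<longrightarrow> W i \<inter> W j = {})"
    unfolding l using fS lam by (intro many_gadgets) auto
  then obtain p q W where g: "\<And>i. i < 6 * h \<Longrightarrow> W i \<subseteq> ?R \<and> gadget l (p i) (q i) (W i)"
    "\<And>i j. i < 6 * h \<Longrightarrow> j < 6 * h \<Longrightarrow> i \<noteq> j \<Longrightarrow> W i \<inter> W j = {}" by metis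
  have "\<forall>i\<in>{..<6 * h}. \<exists>lo. flex (p i) (q i) (W i) lo (Suc lo)" using g(1) unfolding gadget_def by blast
  from bchoice[OF this] obtain lo where lo: "\<And>i. i < 6 * h \<Longrightarrow> flex (p i) (q i) (W i) (lo i) (Suc (lo i))" by blast
  have hil: "Suc (lo i) \<le> l" if i: "i < 6 * h" for i
    using flex_hi_le[OF lo[OF i]] g(1)[OF i] unfolding gadget_def by auto
  \<comment> \<open>The left summand indexes the detours, the right one the adjusters.\<close>
  define IL :: "(nat + nat) set" where "IL = Inl ` {..<t}"
  define IR :: "(nat + nat) set" where "IR = Inr ` {..<6 * h}"
  define I where "I = IL \<union> IR"
  define pt :: "nat + nat \<Rightarrow> bool \<Rightarrow> 'a" where
    "pt = (\<lambda>x d. case x of Inl i \<Rightarrow> (if d then f (u i) else f (v i)) | Inr i \<Rightarrow> (if d then p i else q i))"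
  define Wb :: "nat + nat \<Rightarrow> 'a set" where
    "Wb = (\<lambda>x. case x of Inl i \<Rightarrow> {f (u i), u i, v i, f (v i)} | Inr i \<Rightarrow> W i)"
  define lb :: "nat + nat \<Rightarrow> nat" where "lb = (\<lambda>x. case x of Inl i \<Rightarrow> 4 | Inr i \<Rightarrow> lo i)"
  define hb :: "nat + nat \<Rightarrow> nat" where "hb = (\<lambda>x. case x of Inl i \<Rightarrow> 4 | Inr i \<Rightarrow> Suc (lo i))"
  have cIL: "card IL = t" "card IR = 6 * h" unfolding IL_def IR_def by (simp_all add: card_image)
  have fI: "finite IL" "finite IR" "finite I" unfolding I_def IL_def IR_def by simp_all
  have cI: "card I = t + 6 * h" unfolding I_def using cIL fI by (subst card_Un_disjoint) (auto simp: IL_def IR_def)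
  have Icases: "(\<exists>i<t. x = Inl i) \<or> (\<exists>i<6 * h. x = Inr i)" if "x \<in> I" for x
    using that unfolding I_def IL_def IR_def by auto
  have fu: "f (u i) \<in> S" "f (v i) \<in> S" "u i \<notin> S" "v i \<notin> S" "u i \<noteq> v i" "f (u i) \<noteq> f (v i)"
    "f (u i) \<in> f ` Y" "f (v i) \<in> f ` Y" "u i \<in> U" "v i \<in> U" if i: "i < t" for i
  proof -
    have y: "u i \<in> Y" "v i \<in> Y" "adj (u i) (v i)" using uv(1)[OF i] by auto
    show "u i \<noteq> v i" using y(3) adj_irrefl by auto
    then show "f (u i) \<noteq> f (v i)" using Y(2) y(1,2) unfolding inj_on_def by blast
    show "f (u i) \<in> f ` Y" "f (v i) \<in> f ` Y" using y by auto
    then show "f (u i) \<in> S" "f (v i) \<in> S" using Y(3) by blast+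
    show "u i \<notin> S" "v i \<notin> S" "u i \<in> U" "v i \<in> U" using y Y(1) by blast+
  qed
  have flex4: "flex (f (u i)) (f (v i)) {f (u i), u i, v i, f (v i)} 4 4" if i: "i < t" for i
  proof -
    have "adj (u i) (f (u i))" "adj (v i) (f (v i))" "adj (u i) (v i)" using uv(1)[OF i] Y(4) by auto
    then have "pth {f (u i), u i, v i, f (v i)} (f (u i)) (f (v i)) [f (u i), u i, v i, f (v i)]"
      unfolding pth_def using fu[OF i] adj_sym by auto
    then show ?thesis unfolding flex_def
      by (intro allI impI exI[of _ "[f (u i), u i, v i, f (v i)]"]) simp
  qed
  have fl: "flex (pt x True) (pt x False) (Wb x) (lb x) (hb x) \<and> lb x \<le> hb x" if x: "x \<in> I" for x
    using Icases[OF x]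
  proof
    assume "\<exists>i<t. x = Inl i"
    then obtain i where "i < t" "x = Inl i" by blast
    then show ?thesis using flex4[of i] unfolding pt_def Wb_def lb_def hb_def by simp
  next
    assume "\<exists>i<6 * h. x = Inr i"
    then obtain i where "i < 6 * h" "x = Inr i" by blast
    then show ?thesis using lo[of i] unfolding pt_def Wb_def lb_def hb_def by simp
  qed
  have disLL: "{f (u i), u i, v i, f (v i)} \<inter> {f (u j), u j, v j, f (v j)} = {}" if ij: "i < t" "j < t" "i \<noteq> j" for i j
  proof -
    have y: "u i \<in> Y" "v i \<in> Y" "u j \<in> Y" "v j \<in> Y" using uv(1)[OF ij(1)] uv(1)[OF ij(2)] by auto
    have d: "u i \<noteq> u j" "u i \<noteq> v j" "v i \<noteq> u j" "v i \<noteq> v j" using uv(2)[OF ij] by auto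
    then have "f (u i) \<noteq> f (u j)" "f (u i) \<noteq> f (v j)" "f (v i) \<noteq> f (u j)" "f (v i) \<noteq> f (v j)"
      using y Y(2) unfolding inj_on_def by blast+
    moreover have "f (u i) \<noteq> u j" "f (u i) \<noteq> v j" "f (v i) \<noteq> u j" "f (v i) \<noteq> v j"
      "u i \<noteq> f (u j)" "u i \<noteq> f (v j)" "v i \<noteq> f (u j)" "v i \<noteq> f (v j)"
      using fu[OF ij(1)] fu[OF ij(2)] by metis+
    ultimately show ?thesis using d by simp
  qed
  have disLR: "{f (u i), u i, v i, f (v i)} \<inter> W j = {}" if ij: "i < t" "j < 6 * h" for i j
    using g(1)[OF ij(2)] fu[OF ij(1)] by blast
  have dis: "Wb x \<inter> Wb y = {}" if xy: "x \<in> I" "y \<in> I" "x \<noteq> y" for x y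
  proof -
    consider (1) i j where "x = Inl i" "y = Inl j" "i < t" "j < t" | (2) i j where "x = Inl i" "y = Inr j" "i < t" "j < 6 * h"
      | (3) i j where "x = Inr i" "y = Inl j" "i < 6 * h" "j < t" | (4) i j where "x = Inr i" "y = Inr j" "i < 6 * h" "j < 6 * h"
      using Icases[OF xy(1)] Icases[OF xy(2)] by metis
    then show ?thesis
    proof cases
      case 1 then show ?thesis using disLL[of i j] xy(3) unfolding Wb_def by simp
    next
      case 2 then show ?thesis using disLR[of i j] unfolding Wb_def by simp
    next
      case 3 then show ?thesis using disLR[of j i] unfolding Wb_def by (simp add: Int_commute)
    next
      case 4 then show ?thesis using g(2)[of i j] xy(3) unfolding Wb_def by simp
    qed
  qed
  have ptS: "pt x d \<in> S" "pt x d \<in> Wb x" if x: "x \<in> I" for x d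
  proof -
    have "pt x d \<in> S \<and> pt x d \<in> Wb x"
      using Icases[OF x]
    proof
      assume "\<exists>i<t. x = Inl i"
      then obtain i where i: "i < t" "x = Inl i" by blast
      then show ?thesis using fu[OF i(1)] unfolding pt_def Wb_def by simp
    next
      assume "\<exists>i<6 * h. x = Inr i"
      then obtain i where i: "i < 6 * h" "x = Inr i" by blast
      then show ?thesis using g(1)[OF i(1)] unfolding pt_def Wb_def gadget_def by auto
    qed
    then show "pt x d \<in> S" "pt x d \<in> Wb x" by auto
  qed
  have ptinj: "x = y" if "x \<in> I" "y \<in> I" "pt x d = pt y e" for x y d e
    using dis[of x y] ptS(2)[of x d] ptS(2)[of y e] that by auto
  have sub: "{pt i d | i d. i \<in> I} \<subseteq> S" using ptS(1) by blast
  have "h \<le> card I" using cI by simp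
  then have "\<exists>os. chain pt os \<and> fst ` set os \<subseteq> I \<and> card I \<le> length os + 2 * h"
  proof (rule chain_of_joined[OF fI(3) _ joined_mono[OF jn sub]])
    show "i = j" if "i \<in> I" "j \<in> I" "pt i d = pt j e" for i j d e using ptinj[OF that] .
  qed
  then obtain os where os: "chain pt os" "fst ` set os \<subseteq> I" "card I \<le> length os + 2 * h" by blast
  let ?F = "\<Union>i\<in>I. Wb i"
  define S0 where "S0 = S - ?F"
  have fS0: "finite S0" unfolding S0_def using fS by simp
  have cS0: "card S \<le> card S0 + (2 * t + 6 * (h * l))"
  proof -
    let ?A = "\<Union>i<t. {f (u i), f (v i)}" and ?B = "\<Union>i<6 * h. W i"
    have "card ?A \<le> (\<Sum>i<t. card {f (u i), f (v i)})" by (rule card_UN_le) simp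
    also have "\<dots> \<le> (\<Sum>i<t. 2)" by (intro sum_mono) (simp add: card_insert_if)
    finally have cA: "card ?A \<le> 2 * t" by simp
    have "card ?B \<le> (\<Sum>i<6 * h. card (W i))" by (rule card_UN_le) simp
    also have "\<dots> \<le> (\<Sum>i<6 * h. l)" using g(1) by (intro sum_mono) (auto simp: gadget_def)
    finally have cB: "card ?B \<le> 6 * (h * l)" by simp
    have "S \<subseteq> S0 \<union> (?A \<union> ?B)"
    proof
      fix x assume x: "x \<in> S"
      show "x \<in> S0 \<union> (?A \<union> ?B)"
      proof (cases "x \<in> ?F")
        case True
        then obtain y where y: "y \<in> I" "x \<in> Wb y" by blast
        from Icases[OF y(1)] show ?thesis
        proof
          assume "\<exists>i<t. y = Inl i"
          then obtain i where i: "i < t" "y = Inl i" by blast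
          then have "x \<in> {f (u i), f (v i)}" using y(2) x fu[OF i(1)] unfolding Wb_def by auto
          then show ?thesis using i(1) by blast
        next
          assume "\<exists>i<6 * h. y = Inr i"
          then show ?thesis using y(2) unfolding Wb_def by auto
        qed
      qed (use x in \<open>simp add: S0_def\<close>)
    qed
    moreover have "finite (S0 \<union> (?A \<union> ?B))" using fS0 g(1) unfolding gadget_def by auto
    ultimately have "card S \<le> card (S0 \<union> (?A \<union> ?B))" by (rule card_mono[rotated])
    also have "\<dots> \<le> card S0 + card (?A \<union> ?B)" by (rule card_Un_le)
    also have "\<dots> \<le> card S0 + (card ?A + card ?B)" by (intro add_left_mono card_Un_le)
    finally show ?thesis using cA cB by linarith
  qed
  let ?mid = "fst ` set (take (length os - 2 * h) (drop h os))"
  have clen: "2 * h < length os" using os(3) cI tl hl h by linarith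
  have cmid: "card ?mid = length os - 2 * h" using card_fst_set[OF os(1)] clen by simp
  have midI: "?mid \<subseteq> I" using os(2) by (meson image_mono order_trans set_drop_subset set_take_subset)
  have "card (I - ?mid) = card I - card ?mid" using midI by (intro card_Diff_subset) auto
  then have cmiss: "card (I - ?mid) \<le> 4 * h" using cmid os(3) by linarith
  \<comment> \<open>At most 4 h beads lie outside the middle of the chain, so each kind of bead
    loses at most that many.\<close>
  have part: "card J \<le> card (?mid \<inter> J) + 4 * h" if J: "J \<subseteq> I" for J
  proof -
    have fJ: "finite J" using J fI(3) finite_subset by blast
    have "J \<subseteq> (?mid \<inter> J) \<union> (I - ?mid)" using J by blast
    then have "card J \<le> card ((?mid \<inter> J) \<union> (I - ?mid))" using fJ fI(3) by (intro card_mono) auto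
    also have "\<dots> \<le> card (?mid \<inter> J) + card (I - ?mid)" by (rule card_Un_le)
    finally show ?thesis using cmiss by linarith
  qed
  have fmid: "finite ?mid" by simp
  have "cyc n (S0 \<union> ?F)"
  \<comment> \<open>N0 counts four vertices for each of the at least t - 4 h detours in the
    middle.\<close>
  proof (rule chain_cycle[OF h fS0 os(1,2) clen fl dis ptS(2), where mid = ?mid and r = 1 and ?N0.0 = "4 * t - 16 * h"])
    show "Wb i \<inter> S0 = {}" if "i \<in> I" for i using that unfolding S0_def by blast
    show "\<not> packing h (Suc 1) S0" using joined_mono[OF jn, of S0] unfolding joined_iff S0_def by (simp add: numeral_2_eq_2 del: packing.simps)
    show "?mid = fst ` set (take (length os - 2 * h) (drop h os))" ..
    have "card (?mid \<inter> IR) = (\<Sum>i\<in>?mid \<inter> IR. 1)" by simp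
    also have "\<dots> \<le> (\<Sum>i\<in>?mid \<inter> IR. hb i - lb i)"
      by (intro sum_mono) (auto simp: IR_def hb_def lb_def)
    also have "\<dots> \<le> (\<Sum>i\<in>?mid. hb i - lb i)" by (intro sum_mono2) auto
    finally show "2 * h \<le> (\<Sum>i\<in>?mid. hb i - lb i)" using part[of IR] cIL(2) unfolding I_def by simp
    have "card (?mid \<inter> IL) * 4 = (\<Sum>i\<in>?mid \<inter> IL. 4)" by simp
    also have "\<dots> = (\<Sum>i\<in>?mid \<inter> IL. hb i)"
      by (intro sum.cong) (auto simp: IL_def hb_def)
    also have "\<dots> \<le> (\<Sum>i\<in>?mid. hb i)" by (intro sum_mono2) auto
    finally show "4 * t - 16 * h \<le> (\<Sum>i\<in>?mid. hb i)" using part[of IL] cIL(1) unfolding I_def by simp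
    show "2 * h \<le> 4 * t - 16 * h" using tl hl by linarith
    have "(\<Sum>i\<in>fst ` set os. hb i) \<le> (\<Sum>i\<in>I. hb i)" using os(2) fI(3) by (intro sum_mono2) auto
    also have "\<dots> = (\<Sum>i\<in>IL. hb i) + (\<Sum>i\<in>IR. hb i)"
      unfolding I_def using fI by (intro sum.union_disjoint) (auto simp: IL_def IR_def)
    also have "(\<Sum>i\<in>IL. hb i) = 4 * t" unfolding IL_def by (simp add: sum.reindex hb_def)
    also have "(\<Sum>i\<in>IR. hb i) \<le> (\<Sum>i\<in>IR. l)" using hil by (intro sum_mono) (auto simp: IR_def hb_def)
    also have "(\<Sum>i\<in>IR. l) = 6 * (h * l)" using cIL(2) by simp
    finally show "(\<Sum>i\<in>fst ` set os. hb i) < n" using n tl hl h by linarith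
    have e: "2 * h * Suc 1 = 4 * h" "6 * h * Suc 1 = 12 * h" by simp_all
    show "n + 2 * h * Suc 1 \<le> 4 * t - 16 * h + card S0" unfolding e using cS0 cS n tl hl h by linarith
    show "6 * h * Suc 1 \<le> card S0" unfolding e using cS0 cS n tl hl h by linarith
    fix E assume E: "E \<subseteq> {pt i d | i d. i \<in> I}"
    have "S0 \<union> E \<subseteq> S" using E sub unfolding S0_def by blast
    then show "edgy h (S0 \<union> E) \<and> tough h (10 * h) (S0 \<union> E)"
      using edgy_mono[OF ed, of "S0 \<union> E"] SU joined_tough[OF joined_mono[OF jn, of "S0 \<union> E"]] by blast
  qed
  moreover have "S0 \<union> ?F \<subseteq> U"
  proof -
    have "Wb x \<subseteq> U" if x: "x \<in> I" for x
      using Icases[OF x]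
    proof
      assume "\<exists>i<t. x = Inl i"
      then obtain i where i: "i < t" "x = Inl i" by blast
      then show ?thesis using fu[OF i(1)] SU unfolding Wb_def by auto
    next
      assume "\<exists>i<6 * h. x = Inr i"
      then show ?thesis using g(1) SU unfolding Wb_def by fastforce
    qed
    then show ?thesis using SU unfolding S0_def by blast
  qed
  ultimately show ?thesis by (rule cyc_mono)
qed

end

section \<open>The induction on the number of parts\<close>

context sgraph
begin

definition nb :: "'a set \<Rightarrow> 'a set \<Rightarrow> 'a set" where
  "nb U X = {y \<in> U - X. \<exists>x\<in>X. adj x y}"

text \<open>The minimizer \<open>X\<close> of \<open>9 |X \<union> N(X)| - |X|\<close> expands: passing from \<open>X\<close> to \<open>X - (Z \<union> N(Z))\<close>
  removes \<open>Z\<close> from the closed neighbourhood, so it must remove at least \<open>9 |Z|\<close> vertices from \<open>X\<close>.\<close>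

lemma cyc_of_small_boundary:
  assumes h: "0 < h" and fin: "finite U" and SU: "S \<subseteq> U" and jn: "joined h S" and cS: "card S < n" "h \<le> card S"
    and nbS: "card (nb U S) \<le> v" and cl: "\<And>X. X \<subseteq> U \<Longrightarrow> h \<le> card X \<Longrightarrow> n \<le> card (X \<union> nb U X)"
    and g: "g = h + 9 * v" "g \<le> 2 ^ q" and big: "(2 * q + 4) * (20 * g) + 2 * g \<le> n"
  shows "cyc n U"
proof -
  have big80: "80 * g \<le> n"
  proof -
    have "4 * (20 * g) \<le> (2 * q + 4) * (20 * g)" by (intro mult_le_mono1) simp
    then show ?thesis using big by linarith
  qed
  have nbU: "nb U X \<subseteq> U" "X \<inter> nb U X = {}" for X unfolding nb_def by blast+
  have fnb: "finite (nb U X)" for X using nbU(1) fin finite_subset by blast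
  define key where "key = (\<lambda>X. 9 * card (X \<union> nb U X) - card X)"
  define ok where "ok = (\<lambda>X. X \<subseteq> S \<and> h \<le> card X)"
  have okS: "ok S" unfolding ok_def using cS by simp
  define X where "X = arg_min key ok"
  have okX: "ok X" and mn: "\<And>Y. ok Y \<Longrightarrow> key X \<le> key Y"
    using okS unfolding X_def by (auto intro: arg_min_natI arg_min_nat_le)
  have XS: "X \<subseteq> S" "h \<le> card X" using okX unfolding ok_def by auto
  have XU: "X \<subseteq> U" using XS SU by blast
  have fX: "finite X" using XU fin finite_subset by blast
  have fS: "finite S" using SU fin finite_subset by blast
  have cX: "card (X \<union> nb U X) = card X + card (nb U X)" using fX fnb nbU(2) by (intro card_Un_disjoint) auto
  have XltS: "card X \<le> card S" using XS fS by (intro card_mono)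
  have nX: "n \<le> card X + card (nb U X)" using cl[OF XU XS(2)] cX by simp
  have cSn: "card (S \<union> nb U S) \<le> card S + v" using card_Un_le[of S "nb U S"] nbS by linarith
  have "9 * card (X \<union> nb U X) - card X \<le> 9 * card (S \<union> nb U S) - card S" using mn[OF okS] unfolding key_def .
  \<comment> \<open>Comparison with S gives 8 |X| + 9 |N(X)| <= 8 |S| + 9 v, while |X| + |N(X)| >= n
    > |S|; hence X is at most 9 v vertices short of n.\<close>
  then have Xbig: "n \<le> card X + 9 * v" using cX nX cSn cS by linarith
  have exp: "8 * card Z \<le> card {y \<in> X - Z. \<exists>z\<in>Z. adj z y}"
    if Z: "Z \<subseteq> X \<union> nb U X" "h \<le> card (X - (Z \<union> {y. \<exists>z\<in>Z. adj z y}))" for Z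
  proof -
    let ?NZ = "{y. \<exists>z\<in>Z. adj z y}"
    let ?X' = "X - (Z \<union> ?NZ)"
    have fZ: "finite Z" using Z(1) fX fnb finite_subset by blast
    have "ok ?X'" unfolding ok_def using XS(1) Z(2) by blast
    then have le: "9 * card (X \<union> nb U X) - card X \<le> 9 * card (?X' \<union> nb U ?X') - card ?X'"
      using mn unfolding key_def by blast
    have "?X' \<union> nb U ?X' \<subseteq> (X \<union> nb U X) - Z"
    proof
      fix y assume "y \<in> ?X' \<union> nb U ?X'"
      then show "y \<in> (X \<union> nb U X) - Z"
      proof
        assume "y \<in> nb U ?X'"
        then obtain x where x: "x \<in> ?X'" "adj x y" "y \<in> U" unfolding nb_def by blast
        have "y \<notin> Z" using x adj_sym by blast
        moreover have "y \<in> X \<union> nb U X" using x unfolding nb_def by blast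
        ultimately show ?thesis by blast
      qed blast
    qed
    then have "card (?X' \<union> nb U ?X') \<le> card ((X \<union> nb U X) - Z)" using fX fnb by (intro card_mono) auto
    also have "\<dots> = card (X \<union> nb U X) - card Z" using Z(1) fZ by (intro card_Diff_subset) auto
    finally have c1: "card (?X' \<union> nb U ?X') \<le> card (X \<union> nb U X) - card Z" .
    have c2: "card Z \<le> card (X \<union> nb U X)" using Z(1) fX fnb by (intro card_mono) auto
    have c3: "card ?X' \<le> card (?X' \<union> nb U ?X')" using fX fnb by (intro card_mono) auto
    \<comment> \<open>All vertices removed from X lie in Z or are neighbours of Z; of the at least 9
      |Z| removed ones at least 8 |Z| are neighbours outside Z.\<close>
    have "card X \<le> card (?X' \<union> ({y \<in> X - Z. \<exists>z\<in>Z. adj z y} \<union> Z))" using fX fZ by (intro card_mono) auto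
    also have "\<dots> \<le> card ?X' + card ({y \<in> X - Z. \<exists>z\<in>Z. adj z y} \<union> Z)" by (rule card_Un_le)
    also have "\<dots> \<le> card ?X' + (card {y \<in> X - Z. \<exists>z\<in>Z. adj z y} + card Z)" by (intro add_left_mono card_Un_le)
    finally have c4: "card X \<le> card ?X' + (card {y \<in> X - Z. \<exists>z\<in>Z. adj z y} + card Z)" .
    show ?thesis using le c1 c2 c3 c4 cX by linarith
  qed
  have "n - card X \<le> card (nb U X)" using nX by simp
  then obtain M where M: "M \<subseteq> nb U X" "card M = n - card X" by (rule obtain_subset_with_card_n)
  \<comment> \<open>At most 9 v vertices of N(X) fill X up to exactly n vertices. As g = h + 9 v,
    any g vertices of Q include h vertices of X, so joinedness of S carries over to Q.\<close>
  define Q where "Q = X \<union> M"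
  have fM: "finite M" using M(1) fnb finite_subset by blast
  have XM: "X \<inter> M = {}" using M(1) nbU(2) by blast
  have cQ: "card Q = n" unfolding Q_def using card_Un_disjoint[OF fX fM XM] M(2) XltS cS by simp
  have QU: "Q \<subseteq> U" unfolding Q_def using XU M(1) nbU(1) by blast
  have fQ: "finite Q" using QU fin finite_subset by blast
  have cM: "card M \<le> 9 * v" using M(2) Xbig by simp
  have inX: "h \<le> card (A \<inter> X)" if A: "A \<subseteq> Q" "g \<le> card A" for A
  proof -
    have "A \<subseteq> (A \<inter> X) \<union> M" using A(1) unfolding Q_def by blast
    then have "card A \<le> card ((A \<inter> X) \<union> M)" using fX fM by (intro card_mono) auto
    also have "\<dots> \<le> card (A \<inter> X) + card M" by (rule card_Un_le)
    finally show ?thesis using A(2) cM g(1) by linarith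
  qed
  have jQ: "joined g Q"
    unfolding joined_def
  proof (intro allI impI notI)
    fix A B assume AB: "A \<subseteq> Q" "B \<subseteq> Q" "A \<inter> B = {}" "g \<le> card A" "g \<le> card B" "nonadj A B"
    have "nonadj (A \<inter> X) (B \<inter> X)" using AB(6) by (rule nonadj_mono) auto
    moreover have "\<not> nonadj (A \<inter> X) (B \<inter> X)"
      using AB(3) inX[OF AB(1,4)] inX[OF AB(2,5)] XS(1) by (intro joinedD[OF jn]) auto
    ultimately show False by blast
  qed
  have eQ: "expands g Q"
    unfolding expands_def
  proof (intro allI impI)
    fix Z assume Z: "Z \<subseteq> Q" "Z \<noteq> {}" "card Z \<le> g"
    have fZ: "finite Z" using Z(1) fQ finite_subset by blast
    let ?NX = "{y \<in> X - Z. \<exists>z\<in>Z. adj z y}"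
    have sub: "card ?NX \<le> card {y \<in> Q - Z. \<exists>z\<in>Z. adj z y}" using fQ unfolding Q_def by (intro card_mono) auto
    have "8 * card Z \<le> card ?NX"
    proof (cases "h \<le> card (X - (Z \<union> {y. \<exists>z\<in>Z. adj z y}))")
      case True
      then show ?thesis using exp[of Z] Z(1) M(1) unfolding Q_def by blast
    next
      case False
      \<comment> \<open>Fewer than h vertices of X escape Z and its neighbourhood, so Z has more
        than 8 g neighbours in X because n >= 80 g.\<close>
      let ?X' = "X - (Z \<union> {y. \<exists>z\<in>Z. adj z y})"
      have "card X \<le> card (?X' \<union> (?NX \<union> Z))" using fX fZ by (intro card_mono) auto
      also have "\<dots> \<le> card ?X' + card (?NX \<union> Z)" by (rule card_Un_le)
      also have "\<dots> \<le> card ?X' + (card ?NX + card Z)" by (intro add_left_mono card_Un_le)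
      finally show ?thesis using False Xbig Z(3) big80 g(1) by linarith
    qed
    then show "8 * card Z \<le> card {y \<in> Q - Z. \<exists>z\<in>Z. adj z y}" using sub by linarith
  qed
  have "0 < g" using g(1) h by simp
  then have "cyc (card Q) Q" using big cQ by (intro hamilton[OF fQ jQ eQ _ g(2)]) simp_all
  then show ?thesis using cQ cyc_mono[OF _ QU] by simp
qed

lemma cyc_main:
  assumes h: "0 < h" and lam: "4 * h < 2 ^ Suc lam" and n: "200000 * (h * (lam + 7) * (lam + 7)) \<le> n"
    and fin: "finite U" and ed: "edgy h U" and rk: "\<not> packing h (Suc r0) U" and r0: "1 \<le> r0" "r0 * (n - 1) \<le> card U"
    and cl: "\<And>X. X \<subseteq> U \<Longrightarrow> h \<le> card X \<Longrightarrow> n \<le> card (X \<union> nb U X)"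
  shows "cyc n U"
proof -
  define l where "l = 2 * lam + 2"
  define t where "t = 30 * h * l"
  define a where "a = h * (lam + 7)"
  define b where "b = h * (lam + 7) * (lam + 7)"
  have ab: "7 * a \<le> b" unfolding a_def b_def by (simp add: algebra_simps)
  have ha: "7 * h \<le> a" unfolding a_def by simp
  have hla: "h * l \<le> 2 * a" unfolding a_def l_def by (simp add: algebra_simps)
  have hl: "2 * h \<le> h * l" unfolding l_def by simp
  have tl: "t = 30 * (h * l)" unfolding t_def by simp
  have nb0: "200000 * b \<le> n" using n unfolding b_def .
  have n100: "100 * t \<le> n" using nb0 ab hla tl by linarith
  obtain S r where S: "S \<subseteq> U" "1 \<le> r" "\<not> packing h (Suc r) S" "r * (n - 1) \<le> card S + t" "tough h t S"
    using good_set[OF fin rk r0(1) _ h, of "n - 1" t] r0(2) by auto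
  have fS: "finite S" using S(1) fin finite_subset by blast
  show ?thesis
  proof (cases "2 \<le> r")
    case True
    have "cyc n S"
      using cyc_of_high_rank[OF h l_def lam t_def n100 fS edgy_mono[OF ed S(1)] True S(3,4,5)] .
    then show ?thesis using S(1) by (rule cyc_mono)
  next
    case False
    then have r1: "r = 1" using S(2) by simp
    have jS: "joined h S" unfolding joined_iff using S(3) r1 by (simp add: numeral_2_eq_2 del: packing.simps)
    have "n - 1 - t \<le> card S" using S(4) r1 by simp
    \<comment> \<open>Cutting down keeps the set joined and brings it below n vertices, as the
      small-boundary case requires.\<close>
    then obtain S1 where S1: "S1 \<subseteq> S" "card S1 = n - 1 - t" by (rule obtain_subset_with_card_n)
    have jS1: "joined h S1" using joined_mono[OF jS S1(1)] .
    have S1U: "S1 \<subseteq> U" using S1 S by blast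
    have fS1: "finite S1" using S1U fin finite_subset by blast
    have "finite (U - S1)" using fin by simp
    then obtain Y f where Y: "Y \<subseteq> U - S1" "inj_on f Y" "f ` Y \<subseteq> S1" "\<forall>y\<in>Y. adj y (f y)" "nonadj (U - S1 - Y) (S1 - f ` Y)"
      using maximal_matching[of "U - S1" S1] by metis
    have fY: "finite Y" using Y(1) fin finite_subset by blast
    show ?thesis
    proof (cases "2 * t + h \<le> card Y")
      case True
      then obtain Y' where Y': "Y' \<subseteq> Y" "card Y' = 2 * t + h" by (rule obtain_subset_with_card_n)
      have "Y' \<subseteq> U - S1" "inj_on f Y'" "f ` Y' \<subseteq> S1" "\<forall>y\<in>Y'. adj y (f y)"
        using Y(1-4) Y'(1) inj_on_subset[OF Y(2) Y'(1)] by blast+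
      then show ?thesis
        using cyc_of_large_matching[OF h l_def lam t_def n100 fin ed S1U jS1 S1(2) _ _ _ _ Y'(2)] by blast
    next
      case F: False
      define S' where "S' = S1 - f ` Y"
      define v where "v = 4 * t + 2 * h"
      have cfY: "card (f ` Y) \<le> card Y" using fY by (rule card_image_le)
      \<comment> \<open>Maximality leaves no edge between unmatched vertices on the two sides, so
        all neighbours of S' are matched; there are at most 2 (2 t + h) = v of them.\<close>
      have "nb U S' \<subseteq> f ` Y \<union> Y"
      proof
        fix y assume "y \<in> nb U S'"
        then obtain x where x: "y \<in> U" "y \<notin> S'" "x \<in> S'" "adj x y" unfolding nb_def by blast
        show "y \<in> f ` Y \<union> Y"
        proof (cases "y \<in> S1")
          case True then show ?thesis using x(2) unfolding S'_def by blast
        next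
          case False
          then show ?thesis using x Y(5) adj_sym unfolding S'_def nonadj_def by blast
        qed
      qed
      then have "card (nb U S') \<le> card (f ` Y \<union> Y)" using fY by (intro card_mono) auto
      also have "\<dots> \<le> card (f ` Y) + card Y" by (rule card_Un_le)
      finally have cv: "card (nb U S') \<le> v" using cfY F unfolding v_def by linarith
      have c1: "card S1 \<le> card S' + card Y" unfolding S'_def
        using diff_card_le_card_Diff[of "f ` Y" S1] fY cfY by force
      have S'S: "S' \<subseteq> S1" unfolding S'_def by blast
      have c2: "card S' \<le> card S1" using S'S fS1 by (intro card_mono)
      define g where "g = h + 9 * v"
      have gb: "g \<le> 1090 * (h * l)" 
      proof -
        have "g = 1080 * (h * l) + 19 * h" unfolding g_def v_def tl by simp
        moreover have "19 * h \<le> 10 * (h * l)" using hl by linarith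
        ultimately show ?thesis by linarith
      qed
      \<comment> \<open>g is at most 1090 h l, which is at most 2 ^ 11 times 2 ^ (2 lam).\<close>
      define q where "q = 2 * lam + 11"
      have "g \<le> 2 ^ q"
      proof -
        have "Suc lam \<le> 2 ^ lam" by (simp add: Suc_leI less_exp)
        moreover have "2 * h \<le> 2 ^ lam" using lam by simp
        ultimately have "(2 * h) * Suc lam \<le> 2 ^ lam * 2 ^ lam" by (intro mult_le_mono)
        then have "h * l \<le> 2 ^ lam * 2 ^ lam" unfolding l_def by simp
        then have "g \<le> 2048 * (2 ^ lam * 2 ^ lam)" using gb by linarith
        moreover have "q = lam + lam + 11" unfolding q_def by simp
        then have "(2::nat) ^ q = 2 ^ lam * 2 ^ lam * 2 ^ 11" by (simp only: power_add)
        moreover have "(2::nat) ^ 11 = 2048" by simp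
        ultimately show ?thesis by (simp only: mult.commute)
      qed
      \<comment> \<open>Origin of the constants: 2 q + 4 = 4 lam + 26 <= 4 (lam + 7), and 4 * 20 *
        2180 = 174400 leaves a reserve up to 200000.\<close>
      moreover have "(2 * q + 4) * (20 * g) + 2 * g \<le> n"
      proof -
        have ga: "g \<le> 2180 * a" using gb hla by linarith
        have "(2 * q + 4) * (20 * g) \<le> (4 * (lam + 7)) * (20 * (2180 * a))"
          using ga unfolding q_def by (intro mult_le_mono) simp_all
        also have "\<dots> = 174400 * b" unfolding a_def b_def by (simp add: algebra_simps)
        finally show ?thesis using ga ab nb0 by linarith
      qed
      ultimately show ?thesis
      proof (intro cyc_of_small_boundary[OF h fin _ joined_mono[OF jS1 S'S] _ _ cv cl g_def])
        show "S' \<subseteq> U" using S'S S1U by blast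
        show "card S' < n" using c2 S1(2) nb0 ab ha h by linarith
        show "h \<le> card S'" using c1 S1(2) F nb0 ab hla tl hl ha h by linarith
      qed auto
    qed
  qed
qed

text \<open>\<open>has ms U\<close>: the complement of the graph induced on \<open>U\<close> contains the complete multipartite
  graph with part sizes \<open>ms\<close>.\<close>

primrec has :: "nat list \<Rightarrow> 'a set \<Rightarrow> bool" where
  "has [] U = True"
| "has (m # ms) U = (\<exists>A B. A \<subseteq> U \<and> B \<subseteq> U \<and> A \<inter> B = {} \<and> nonadj A B \<and> card A = m \<and> has ms B)"

lemma has_mono: "has ms U \<Longrightarrow> U \<subseteq> W \<Longrightarrow> has ms W"
proof (cases ms)
  case (Cons m ms')
  assume "has ms U" "U \<subseteq> W"
  then obtain A B where "A \<subseteq> U" "B \<subseteq> U" "A \<inter> B = {}" "nonadj A B" "card A = m" "has ms' B"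
    unfolding Cons by auto
  then have "A \<subseteq> W" "B \<subseteq> W" "A \<inter> B = {}" "nonadj A B" "card A = m" "has ms' B" using \<open>U \<subseteq> W\<close> by auto
  then show ?thesis unfolding Cons has.simps by (intro exI[of _ A] exI[of _ B]) simp
qed simp

lemma has_of_packing: "packing h (length ms) U \<Longrightarrow> \<forall>m\<in>set ms. m \<le> h \<Longrightarrow> has ms U"
proof (induction ms arbitrary: U)
  case (Cons m ms)
  then obtain A B where AB: "A \<subseteq> U" "B \<subseteq> U" "A \<inter> B = {}" "nonadj A B" "h \<le> card A" "packing h (length ms) B" by auto
  have "m \<le> card A" using AB(5) Cons.prems(2) by simp
  then obtain A' where A': "A' \<subseteq> A" "card A' = m" by (rule obtain_subset_with_card_n)
  have "has ms B" using Cons.IH AB(6) Cons.prems(2) by simp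
  moreover have "nonadj A' B" using nonadj_mono[OF AB(4) A'(1)] by blast
  moreover have "A' \<subseteq> U" "A' \<inter> B = {}" using A'(1) AB by blast+
  ultimately show ?case using A'(2) AB(2) unfolding has.simps by blast
qed simp

lemma has_of_indep: "finite A \<Longrightarrow> nonadj A A \<Longrightarrow> sum_list ms \<le> card A \<Longrightarrow> has ms A"
proof (induction ms arbitrary: A)
  case (Cons m ms)
  have "m \<le> card A" using Cons.prems(3) by simp
  then obtain A' where A': "A' \<subseteq> A" "card A' = m" by (rule obtain_subset_with_card_n)
  have "finite A'" using A'(1) Cons.prems(1) finite_subset by blast
  then have "card (A - A') = card A - m" using A' by (simp add: card_Diff_subset)
  then have "has ms (A - A')"
    using Cons.prems nonadj_mono[OF Cons.prems(2), of "A - A'" "A - A'"] by (intro Cons.IH) auto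
  moreover have "nonadj A' (A - A')" using nonadj_mono[OF Cons.prems(2) A'(1)] by blast
  ultimately show ?case using A' unfolding has.simps by (intro exI[of _ A'] exI[of _ "A - A'"]) auto
qed simp

text \<open>The number h only has to bound the sum of the parts, so it stays fixed in the induction
  and the conditions on \<open>lam\<close> and n persist. The part that enters the size bound stands
  last and is therefore never removed.\<close>

lemma ramsey_upper:
  assumes h: "0 < h" and lam: "4 * h < 2 ^ Suc lam" and n: "200000 * (h * (lam + 7) * (lam + 7)) \<le> n"
    and "ms \<noteq> []" "sum_list ms \<le> h" "finite U" "(length ms - 1) * (n - 1) + last ms \<le> card U" "\<not> cyc n U"
  shows "has ms U"
  using assms(4-)
proof (induction ms arbitrary: U)
  case (Cons m ms)
  show ?case
  proof (cases "ms = []")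
    case True
    then have "m \<le> card U" using Cons.prems by simp
    then obtain A where "A \<subseteq> U" "card A = m" by (rule obtain_subset_with_card_n)
    then show ?thesis using True by (auto simp: nonadj_def)
  next
    case False
    have len: "1 \<le> length ms" using False by (cases ms) auto
    have lst: "last (m # ms) = last ms" using False by simp
    show ?thesis
    proof (rule ccontr)
      assume no: "\<not> has (m # ms) U"
      have ed: "edgy h U"
        unfolding edgy_def
      proof (intro allI impI)
        fix A assume A: "A \<subseteq> U" "h \<le> card A"
        show "\<exists>x\<in>A. \<exists>y\<in>A. adj x y"
        proof (rule ccontr)
          assume "\<not> ?thesis"
          then have "nonadj A A" unfolding nonadj_def by blast
          then have "has (m # ms) A" using A Cons.prems finite_subset by (intro has_of_indep) auto
          then show False using no has_mono A(1) by blast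
        qed
      qed
      have mle: "\<forall>k\<in>set (m # ms). k \<le> h" 
      proof
        fix k assume "k \<in> set (m # ms)"
        then have "k \<le> sum_list (m # ms)" by (intro member_le_sum_list) auto
        then show "k \<le> h" using Cons.prems(2) by (rule order_trans)
      qed
      have rk: "\<not> packing h (Suc (length ms)) U" using has_of_packing[of h "m # ms" U] mle no by auto
      have "cyc n U"
      proof (rule cyc_main[OF h lam n Cons.prems(3) ed rk len])
        show "length ms * (n - 1) \<le> card U" using Cons.prems(4) by simp
        fix X assume X: "X \<subseteq> U" "h \<le> card X"
        show "n \<le> card (X \<union> nb U X)"
        proof (rule ccontr)
          assume "\<not> ?thesis"
          then have lt: "card (X \<union> nb U X) \<le> n - 1" by simp
          let ?T = "U - (X \<union> nb U X)"
          have XU: "X \<union> nb U X \<subseteq> U" using X(1) unfolding nb_def by blast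
          have "card ?T = card U - card (X \<union> nb U X)"
            using XU Cons.prems(3) by (intro card_Diff_subset) (auto intro: finite_subset)
          moreover have "length ms * (n - 1) = (length ms - 1) * (n - 1) + (n - 1)"
            using len by (cases "length ms") auto
          moreover have "length ms * (n - 1) + last ms \<le> card U" using Cons.prems(4) unfolding lst by simp
          ultimately have "(length ms - 1) * (n - 1) + last ms \<le> card ?T" using lt by linarith
          moreover have "\<not> cyc n ?T" using Cons.prems(5) cyc_mono[of n ?T U] by blast
          ultimately have hT: "has ms ?T" using Cons.prems False by (intro Cons.IH) auto
          have "m \<le> card X" using mle X(2) by simp
          then obtain A where A: "A \<subseteq> X" "card A = m" by (rule obtain_subset_with_card_n)
          have "nonadj A ?T" using A(1) unfolding nonadj_def nb_def by blast
          moreover have "A \<subseteq> U" "A \<inter> ?T = {}" using A(1) X(1) by blast+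
          ultimately have "has (m # ms) U" using A(2) hT unfolding has.simps by blast
          then show False using no by blast
        qed
      qed
      then show False using Cons.prems(5) by blast
    qed
  qed
qed simp

end

section \<open>Complete multipartite graphs and the Ramsey number\<close>

context sgraph
begin

text \<open>Unfolds the nested description into a family of sets indexed by the parts.\<close>

lemma has_family:
  assumes "has (map w cs) U" "distinct cs"
  shows "\<exists>A. (\<forall>i\<in>set cs. A i \<subseteq> U \<and> card (A i) = w i) \<and>
    (\<forall>i\<in>set cs. \<forall>j\<in>set cs. i \<noteq> j \<longrightarrow> A i \<inter> A j = {} \<and> nonadj (A i) (A j))"
  using assms
proof (induction cs arbitrary: U)
  case (Cons c cs)
  then obtain X B where XB: "X \<subseteq> U" "B \<subseteq> U" "X \<inter> B = {}" "nonadj X B" "card X = w c" "has (map w cs) B" by auto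
  have "distinct cs" using Cons.prems(2) by simp
  from Cons.IH[OF XB(6) this] obtain A where A0: "(\<forall>i\<in>set cs. A i \<subseteq> B \<and> card (A i) = w i) \<and>
    (\<forall>i\<in>set cs. \<forall>j\<in>set cs. i \<noteq> j \<longrightarrow> A i \<inter> A j = {} \<and> nonadj (A i) (A j))" ..
  have A: "\<And>i. i \<in> set cs \<Longrightarrow> A i \<subseteq> B \<and> card (A i) = w i"
    "\<And>i j. i \<in> set cs \<Longrightarrow> j \<in> set cs \<Longrightarrow> i \<noteq> j \<Longrightarrow> A i \<inter> A j = {} \<and> nonadj (A i) (A j)"
    using A0 by simp_all
  have c: "c \<notin> set cs" using Cons.prems(2) by simp
  have XA: "X \<inter> A i = {} \<and> nonadj X (A i) \<and> nonadj (A i) X" if "i \<in> set cs" for i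
  proof -
    have "A i \<subseteq> B" using A(1) that by blast
    then show ?thesis using XB(3) nonadj_mono[OF XB(4), of X "A i"] nonadj_sym by blast
  qed
  let ?A = "A(c := X)"
  have "?A i \<subseteq> U \<and> card (?A i) = w i" if "i \<in> set (c # cs)" for i
    using that A(1) XB(1,2,5) by (cases "i = c") auto
  moreover have "?A i \<inter> ?A j = {} \<and> nonadj (?A i) (?A j)" if "i \<in> set (c # cs)" "j \<in> set (c # cs)" "i \<noteq> j" for i j
    using that A(2) XA c by (cases "i = c"; cases "j = c") (auto simp: Int_commute)
  ultimately show ?case by (intro exI[of _ ?A]) simp
qed simp

end

section \<open>Colourings of complete multipartite graphs\<close>

lemma class_representatives:
  fixes k :: nat
  assumes p: "p ` V = {0..<k}"
  shows "\<exists>s. \<forall>i<k. s i \<in> V \<and> p (s i) = i"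
proof (rule choice, rule allI)
  fix i
  show "\<exists>v. i < k \<longrightarrow> v \<in> V \<and> p v = i"
  proof (cases "i < k")
    case True
    then have "i \<in> p ` V" using p by simp
    then show ?thesis by blast
  qed simp
qed

text \<open>Representatives of the k parts get k different colours, hence all colours. Every vertex
  differs in colour from the representatives of the other parts, so the colouring is p up to a
  permutation.\<close>

lemma rigid_colouring:
  fixes k :: nat
  assumes p: "p ` V = {0..<k}" and c: "\<forall>v\<in>V. c v < k" and pr: "\<forall>u\<in>V. \<forall>v\<in>V. p u \<noteq> p v \<longrightarrow> c u \<noteq> c v"
  shows "\<exists>f. bij_betw f {0..<k} {0..<k} \<and> (\<forall>v\<in>V. c v = f (p v))"
proof -
  obtain s where s: "\<And>i. i < k \<Longrightarrow> s i \<in> V \<and> p (s i) = i" using class_representatives[OF p] by blast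
  define f where "f = (\<lambda>i. c (s i))"
  have inj: "inj_on f {0..<k}"
  proof (rule inj_onI)
    fix i j assume "i \<in> {0..<k}" "j \<in> {0..<k}" "f i = f j"
    then have "c (s i) = c (s j)" "s i \<in> V" "p (s i) = i" "s j \<in> V" "p (s j) = j"
      using s[of i] s[of j] unfolding f_def by auto
    then show "i = j" using pr by metis
  qed
  have "f ` {0..<k} \<subseteq> {0..<k}" unfolding f_def using c s by auto
  then have img: "f ` {0..<k} = {0..<k}" using inj by (simp add: endo_inj_surj)
  have "c v = f (p v)" if v: "v \<in> V" for v
  proof -
    have "c v \<in> f ` {0..<k}" using img c v by simp
    then obtain j where j: "j < k" "c v = f j" by auto
    have "p v = j" using pr v s[OF j(1)] j(2) unfolding f_def by metis
    then show ?thesis using j by simp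
  qed
  then show ?thesis using inj img unfolding bij_betw_def by blast
qed

lemma partite_edge_iff:
  assumes "E = {{u, v} | u v. u \<in> V \<and> v \<in> V \<and> p u \<noteq> p v}"
  shows "{u, v} \<in> E \<longleftrightarrow> u \<in> V \<and> v \<in> V \<and> p u \<noteq> p v"
  using assms by (auto simp: doubleton_eq_iff)

lemma chromatic_partite:
  fixes k :: nat
  assumes p: "p ` V = {0..<k}" and E: "E = {{u, v} | u v. u \<in> V \<and> v \<in> V \<and> p u \<noteq> p v}"
  shows "chromatic_number V E = k"
  unfolding chromatic_number_def
proof (rule Least_equality)
  have "p v < k" if "v \<in> V" for v using p that by (metis atLeastLessThan_iff imageI)
  then have "proper_colouring V E k p" unfolding proper_colouring_def using partite_edge_iff[OF E] by blast
  then show "\<exists>c. proper_colouring V E k c" by blast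
  fix q assume "\<exists>c. proper_colouring V E q c"
  then obtain c where c: "proper_colouring V E q c" by blast
  obtain s where s: "\<And>i. i < k \<Longrightarrow> s i \<in> V \<and> p (s i) = i" using class_representatives[OF p] by blast
  have "inj_on (\<lambda>i. c (s i)) {0..<k}"
  proof (rule inj_onI)
    fix i j assume ij: "i \<in> {0..<k}" "j \<in> {0..<k}" "c (s i) = c (s j)"
    show "i = j"
    proof (rule ccontr)
      assume "i \<noteq> j"
      then have "{s i, s j} \<in> E" using partite_edge_iff[OF E] s[of i] s[of j] ij by auto
      then show False using c ij s[of i] s[of j] unfolding proper_colouring_def by auto
    qed
  qed
  moreover have "(\<lambda>i. c (s i)) ` {0..<k} \<subseteq> {0..<q}" using c s unfolding proper_colouring_def by auto
  ultimately have "card {0..<k} \<le> card {0..<q}" by (intro card_inj_on_le) auto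
  then show "k \<le> q" by simp
qed

text \<open>By rigidity the classes of any k-colouring are the parts themselves in some
  order.\<close>

lemma sigma_partite:
  fixes k :: nat
  assumes p: "p ` V = {0..<k}" and E: "E = {{u, v} | u v. u \<in> V \<and> v \<in> V \<and> p u \<noteq> p v}"
  shows "sigma_graph V E = Min ((\<lambda>i. card {v\<in>V. p v = i}) ` {0..<k})"
proof -
  have "{card {v\<in>V. c v = i} | c i. proper_colouring V E k c \<and> i < k} = (\<lambda>i. card {v\<in>V. p v = i}) ` {0..<k}"
  proof (intro equalityI subsetI)
    fix x assume "x \<in> {card {v\<in>V. c v = i} | c i. proper_colouring V E k c \<and> i < k}"
    then obtain c i where ci: "x = card {v\<in>V. c v = i}" "proper_colouring V E k c" "i < k" by blast
    have "\<forall>v\<in>V. c v < k" "\<forall>u\<in>V. \<forall>v\<in>V. p u \<noteq> p v \<longrightarrow> c u \<noteq> c v"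
      using ci(2) partite_edge_iff[OF E] unfolding proper_colouring_def by auto
    then obtain f where f: "bij_betw f {0..<k} {0..<k}" "\<forall>v\<in>V. c v = f (p v)" using rigid_colouring[OF p] by blast
    have "i \<in> f ` {0..<k}" using f(1) ci(3) unfolding bij_betw_def by simp
    then obtain j where j: "j < k" "f j = i" by auto
    have pv: "p v \<in> {0..<k}" if "v \<in> V" for v using p that by blast
    have "{v\<in>V. c v = i} = {v\<in>V. p v = j}"
      using f j pv unfolding bij_betw_def inj_on_def by auto
    then show "x \<in> (\<lambda>i. card {v\<in>V. p v = i}) ` {0..<k}" using ci(1) j(1) by auto
  next
    fix x assume "x \<in> (\<lambda>i. card {v\<in>V. p v = i}) ` {0..<k}"
    then obtain i where i: "i < k" "x = card {v\<in>V. p v = i}" by auto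
    have "p v < k" if "v \<in> V" for v using p that by (metis atLeastLessThan_iff imageI)
    then have "proper_colouring V E k p" unfolding proper_colouring_def using partite_edge_iff[OF E] by blast
    then show "x \<in> {card {v\<in>V. c v = i} | c i. proper_colouring V E k c \<and> i < k}" using i by blast
  qed
  then show ?thesis unfolding sigma_graph_def chromatic_partite[OF p E] by simp
qed

lemma contains_cycle_of_cyc:
  assumes "sgraph (\<lambda>x y. {x, y} \<in> F)" "sgraph.cyc (\<lambda>x y. {x, y} \<in> F) n U" "0 < n"
  shows "contains_graph U F {0..<n} (cycle_edges n)"
proof -
  interpret sgraph "\<lambda>x y. {x, y} \<in> F" by fact
  obtain xs where xs: "length xs = n" "distinct xs" "set xs \<subseteq> U" "successively (\<lambda>x y. {x, y} \<in> F) xs" "{last xs, hd xs} \<in> F"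
    using assms(2) unfolding cyc_def by blast
  have "{xs ! i, xs ! ((i + 1) mod n)} \<in> F" if i: "i < n" for i
  proof (cases "i + 1 = n")
    case True
    then have "i = n - 1" by simp
    moreover have "xs \<noteq> []" using xs(1) assms(3) by auto
    ultimately have "last xs = xs ! i" "hd xs = xs ! 0" using xs(1) by (simp_all add: last_conv_nth hd_conv_nth)
    then show ?thesis using xs(5) True by simp
  next
    case False
    then have "Suc i < length xs" using i xs(1) by simp
    then show ?thesis using successively_nth[OF xs(4)] xs(1) by simp
  qed
  then have "\<forall>e\<in>cycle_edges n. (!) xs ` e \<in> F" unfolding cycle_edges_def by auto
  moreover have "inj_on ((!) xs) {0..<n}" using xs(1,2) by (auto simp: inj_on_def nth_eq_iff_index_eq)
  moreover have "(!) xs ` {0..<n} \<subseteq> U" using xs(1,3) by (auto dest: nth_mem)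
  ultimately show ?thesis unfolding contains_graph_def by blast
qed

lemma contains_partite_of_family:
  fixes V :: "'b set" and U :: "'a set" and k :: nat
  assumes fV: "finite V" and fU: "finite U" and p: "p ` V = {0..<k}" and E: "E = {{u, v} | u v. u \<in> V \<and> v \<in> V \<and> p u \<noteq> p v}"
    and A: "\<And>i. i < k \<Longrightarrow> A i \<subseteq> U \<and> card (A i) = card {v\<in>V. p v = i}"
    and dj: "\<And>i j. i < k \<Longrightarrow> j < k \<Longrightarrow> i \<noteq> j \<Longrightarrow> A i \<inter> A j = {} \<and> (\<forall>x\<in>A i. \<forall>y\<in>A j. {x, y} \<notin> F)"
  shows "contains_graph U (compl_edges U F) V E"
proof -
  have "\<forall>i\<in>{0..<k}. \<exists>f. bij_betw f {v\<in>V. p v = i} (A i)"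
  proof
    fix i assume "i \<in> {0..<k}"
    then have "card {v\<in>V. p v = i} = card (A i)" "finite (A i)" using A[of i] fU finite_subset by auto
    then show "\<exists>f. bij_betw f {v\<in>V. p v = i} (A i)" using fV by (intro finite_same_card_bij) auto
  qed
  from bchoice[OF this] obtain f where "\<And>i. i \<in> {0..<k} \<Longrightarrow> bij_betw (f i) {v\<in>V. p v = i} (A i)" by blast
  then have f: "\<And>i. i < k \<Longrightarrow> bij_betw (f i) {v\<in>V. p v = i} (A i)" by simp
  define g where "g = (\<lambda>v. f (p v) v)"
  have pv: "p v < k" if "v \<in> V" for v using p that by (metis atLeastLessThan_iff imageI)
  have gA: "g v \<in> A (p v)" if v: "v \<in> V" for v
    using f[OF pv[OF v]] v unfolding g_def bij_betw_def by blast
  have ne: "g u \<noteq> g v \<and> {g u, g v} \<notin> F" if uv: "u \<in> V" "v \<in> V" "p u \<noteq> p v" for u v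
  proof -
    have d: "A (p u) \<inter> A (p v) = {}" "\<forall>x\<in>A (p u). \<forall>y\<in>A (p v). {x, y} \<notin> F"
      using dj[OF pv[OF uv(1)] pv[OF uv(2)] uv(3)] by auto
    have "g u \<noteq> g v" using d(1) gA[OF uv(1)] gA[OF uv(2)] by (metis disjoint_iff)
    moreover have "{g u, g v} \<notin> F" using d(2) gA[OF uv(1)] gA[OF uv(2)] by simp
    ultimately show ?thesis by simp
  qed
  have "inj_on g V"
  proof (rule inj_onI)
    fix u v assume uv: "u \<in> V" "v \<in> V" "g u = g v"
    have e: "p u = p v" using ne uv by blast
    have "inj_on (f (p u)) {w\<in>V. p w = p u}" using f[OF pv[OF uv(1)]] unfolding bij_betw_def by blast
    then show "u = v" using uv e unfolding g_def inj_on_def by auto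
  qed
  moreover have gU: "g ` V \<subseteq> U" using gA A pv by blast
  moreover have "\<forall>e\<in>E. g ` e \<in> compl_edges U F"
  proof
    fix e assume "e \<in> E"
    then obtain u v where uv: "e = {u, v}" "u \<in> V" "v \<in> V" "p u \<noteq> p v" unfolding E by blast
    then show "g ` e \<in> compl_edges U F" using ne[OF uv(2,3,4)] gU unfolding compl_edges_def by auto
  qed
  ultimately show ?thesis unfolding contains_graph_def by blast
qed

lemma ramsey_partite_upper:
  fixes V :: "'b set" and k :: nat
  assumes fV: "finite V" and p: "p ` V = {0..<k}" and E: "E = {{u, v} | u v. u \<in> V \<and> v \<in> V \<and> p u \<noteq> p v}"
    and h: "h = card V" "0 < h" and lam: "4 * h < 2 ^ Suc lam" and n: "200000 * (h * (lam + 7) * (lam + 7)) \<le> n"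
    and i0: "i0 < k" and N: "N = (k - 1) * (n - 1) + card {v\<in>V. p v = i0}" and F: "is_graph {0..<N} F"
  shows "contains_graph {0..<N} F {0..<n} (cycle_edges n) \<or> contains_graph {0..<N} (compl_edges {0..<N} F) V E"
proof -
  have sg: "sgraph (\<lambda>x y. {x, y} \<in> F)"
  proof
    show "{y, x} \<in> F" if "{x, y} \<in> F" for x y using that by (simp add: insert_commute)
    show "{x, x} \<notin> F" for x using F unfolding is_graph_def by fastforce
  qed
  interpret sgraph "\<lambda>x y. {x, y} \<in> F" by (rule sg)
  have n0: "0 < n" using n h(2) by (cases n) auto
  show ?thesis
  proof (cases "cyc n {0..<N}")
    case True
    then show ?thesis using contains_cycle_of_cyc[OF sg _ n0] by blast
  next
    case False
    define w where "w = (\<lambda>i. card {v\<in>V. p v = i})"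
    \<comment> \<open>The part i0 goes last, since \<open>ramsey_upper\<close> takes the additive
      term from the last entry.\<close>
    define cs where "cs = filter (\<lambda>i. i \<noteq> i0) [0..<k] @ [i0]"
    have dcs: "distinct cs" and scs: "set cs = {0..<k}" unfolding cs_def using i0 by auto
    have lcs: "length cs = k" using distinct_card[OF dcs] scs by simp
    have "sum_list (map w cs) = (\<Sum>i\<in>{0..<k}. w i)" using sum_list_distinct_conv_sum_set[OF dcs] scs by simp
    also have "\<dots> = (\<Sum>i\<in>{0..<k}. \<Sum>v\<in>{v\<in>V. p v = i}. 1)" unfolding w_def by simp
    also have "\<dots> = card V" using sum.group[of V "{0..<k}" p "\<lambda>_. 1::nat"] fV p by simp
    finally have sl: "sum_list (map w cs) \<le> h" using h(1) by simp
    have "has (map w cs) {0..<N}"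
    proof (rule ramsey_upper[OF h(2) lam n _ sl _ _ False])
      show "map w cs \<noteq> []" unfolding cs_def by simp
      show "finite {0..<N}" by simp
      have "last (map w cs) = w i0" unfolding cs_def by simp
      then show "(length (map w cs) - 1) * (n - 1) + last (map w cs) \<le> card {0..<N}"
        using lcs N unfolding w_def by simp
    qed
    from has_family[OF this dcs] obtain A where A: "(\<forall>i\<in>set cs. A i \<subseteq> {0..<N} \<and> card (A i) = w i) \<and>
      (\<forall>i\<in>set cs. \<forall>j\<in>set cs. i \<noteq> j \<longrightarrow> A i \<inter> A j = {} \<and> nonadj (A i) (A j))" ..
    have "contains_graph {0..<N} (compl_edges {0..<N} F) V E"
    proof (rule contains_partite_of_family[OF fV _ p E, of _ A])
      show "finite {0..<N}" by simp
      show "A i \<subseteq> {0..<N} \<and> card (A i) = card {v\<in>V. p v = i}" if "i < k" for i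
        using A that unfolding scs w_def by simp
      show "A i \<inter> A j = {} \<and> (\<forall>x\<in>A i. \<forall>y\<in>A j. {x, y} \<notin> F)" if "i < k" "j < k" "i \<noteq> j" for i j
        using A that unfolding scs nonadj_def by simp
    qed
    then show ?thesis ..
  qed
qed

text \<open>F is a union of disjoint cliques on consecutive blocks of n - 1 integers. A cycle stays
  inside one block, which is too small for it. A copy of H in the complement would be coloured by
  the blocks with k colours; by rigidity a whole part would lie in block k - 1, where too few
  vertices are left.\<close>

lemma ramsey_partite_lower:
  fixes V :: "'b set" and k :: nat
  assumes fV: "finite V" and p: "p ` V = {0..<k}" and E: "E = {{u, v} | u v. u \<in> V \<and> v \<in> V \<and> p u \<noteq> p v}"
    and k: "1 \<le> k" and n: "2 \<le> n" and sg: "\<And>i. i < k \<Longrightarrow> s \<le> card {v\<in>V. p v = i}" "s \<le> n - 1"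
    and N: "N < (k - 1) * (n - 1) + s"
  shows "\<exists>F. is_graph {0..<N} F \<and> \<not> contains_graph {0..<N} F {0..<n} (cycle_edges n) \<and>
    \<not> contains_graph {0..<N} (compl_edges {0..<N} F) V E"
proof -
  define b where "b = (\<lambda>x. x div (n - 1))"
  define F where "F = {{x, y} | x y. x < N \<and> y < N \<and> x \<noteq> y \<and> b x = b y}"
  have n1: "0 < n - 1" using n by simp
  have inF: "{x, y} \<in> F \<longleftrightarrow> x < N \<and> y < N \<and> x \<noteq> y \<and> b x = b y" for x y
    unfolding F_def by (auto simp: doubleton_eq_iff)
  have "is_graph {0..<N} F" unfolding is_graph_def F_def by auto
  moreover have "\<not> contains_graph {0..<N} F {0..<n} (cycle_edges n)"
  proof
    assume "contains_graph {0..<N} F {0..<n} (cycle_edges n)"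
    then obtain f where f: "inj_on f {0..<n}" "\<forall>e\<in>cycle_edges n. f ` e \<in> F" unfolding contains_graph_def by blast
    have step: "b (f i) = b (f (Suc i))" if i: "Suc i < n" for i
    proof -
      have "{i, Suc i} \<in> cycle_edges n" unfolding cycle_edges_def using i by force
      then have "{f i, f (Suc i)} \<in> F" using f(2) by fastforce
      then show ?thesis using inF by blast
    qed
    have "b (f i) = b (f 0)" if "i < n" for i
      using that
    proof (induction i)
      case (Suc i) then show ?case using step[of i] by simp
    qed simp
    then have "f ` {0..<n} \<subseteq> {b (f 0) * (n - 1)..<b (f 0) * (n - 1) + (n - 1)}"
    proof -
      assume eq: "\<And>i. i < n \<Longrightarrow> b (f i) = b (f 0)"
      have "f i \<in> {b (f 0) * (n - 1)..<b (f 0) * (n - 1) + (n - 1)}" if "i < n" for i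
      proof -
        have "f i = b (f 0) * (n - 1) + f i mod (n - 1)" using eq[OF that] unfolding b_def by (metis div_mult_mod_eq)
        moreover have "f i mod (n - 1) < n - 1" using n1 by simp
        ultimately show ?thesis by simp
      qed
      then show ?thesis by auto
    qed
    then have "card (f ` {0..<n}) \<le> n - 1" using card_mono[of "{b (f 0) * (n - 1)..<b (f 0) * (n - 1) + (n - 1)}"] by fastforce
    then show False using f(1) n by (simp add: card_image)
  qed
  moreover have "\<not> contains_graph {0..<N} (compl_edges {0..<N} F) V E"
  proof
    assume "contains_graph {0..<N} (compl_edges {0..<N} F) V E"
    then obtain f where f: "inj_on f V" "f ` V \<subseteq> {0..<N}" "\<forall>e\<in>E. f ` e \<in> compl_edges {0..<N} F" unfolding contains_graph_def by blast
    \<comment> \<open>As s <= n - 1, the blocks 0 to k - 1 contain all N vertices.\<close>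
    have "N < k * (n - 1)"
    proof -
      have "k * (n - 1) = (k - 1) * (n - 1) + (n - 1)" using k by (cases k) auto
      then show ?thesis using N sg(2) by linarith
    qed
    then have "\<forall>v\<in>V. b (f v) < k" unfolding b_def using f(2) n1
      by (auto simp: less_mult_imp_div_less)
    moreover have "\<forall>u\<in>V. \<forall>v\<in>V. p u \<noteq> p v \<longrightarrow> b (f u) \<noteq> b (f v)"
    proof (intro ballI impI notI)
      fix u v assume uv: "u \<in> V" "v \<in> V" "p u \<noteq> p v" "b (f u) = b (f v)"
      have "{u, v} \<in> E" using partite_edge_iff[OF E] uv by blast
      then have "{f u, f v} \<notin> F" using f(3) unfolding compl_edges_def by fastforce
      moreover have "f u \<noteq> f v" using f(1) uv unfolding inj_on_def by blast
      ultimately show False using inF uv f(2) by auto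
    qed
    ultimately have "\<exists>g. bij_betw g {0..<k} {0..<k} \<and> (\<forall>v\<in>V. b (f v) = g (p v))"
      by (intro rigid_colouring[OF p]) auto
    then obtain g where g: "bij_betw g {0..<k} {0..<k}" "\<And>v. v \<in> V \<Longrightarrow> b (f v) = g (p v)" by blast
    have "k - 1 \<in> g ` {0..<k}" using g(1) k unfolding bij_betw_def by simp
    then obtain i where i: "i < k" "g i = k - 1" by auto
    have "f ` {v\<in>V. p v = i} \<subseteq> {(k - 1) * (n - 1)..<N}"
    proof
      fix x assume "x \<in> f ` {v\<in>V. p v = i}"
      then obtain v where v: "v \<in> V" "p v = i" "x = f v" by blast
      have "x div (n - 1) = k - 1" using g(2)[OF v(1)] v i unfolding b_def by simp
      then have "(k - 1) * (n - 1) \<le> x" by (metis div_times_less_eq_dividend)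
      then show "x \<in> {(k - 1) * (n - 1)..<N}" using f(2) v by auto
    qed
    then have "card (f ` {v\<in>V. p v = i}) \<le> N - (k - 1) * (n - 1)"
      using card_mono[of "{(k - 1) * (n - 1)..<N}"] by fastforce
    moreover have "card (f ` {v\<in>V. p v = i}) = card {v\<in>V. p v = i}"
      using f(1) by (intro card_image) (auto simp: inj_on_def)
    \<comment> \<open>For the case that block k - 1 is empty and the truncated difference is
      0.\<close>
    moreover have "{v\<in>V. p v = i} \<noteq> {}" using class_representatives[OF p] i(1) by blast
    then have "0 < card {v\<in>V. p v = i}" using fV by (simp add: card_gt_0_iff)
    ultimately show False using sg(1)[OF i(1)] N by linarith
  qed
  ultimately show ?thesis by blast
qed

text \<open>Let L = ln k. From h <= k^23 follows ln (4 h) <= 25 L, and with ln 2 >= 1/2 this gives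
  \<open>lam\<close> <= 50 L and \<open>lam\<close> + 7 <= 64 L. The square of L is absorbed by its
  fourth power: 4096 L^2 <= 20000 L^4, since L^2 >= 1/4.\<close>

lemma size_bound:
  fixes k h n :: nat and m :: real
  assumes m: "2 \<le> m" "m \<le> real k ^ 22" and h: "real h = m * real k"
    and n: "10 ^ 60 * m * real k * (ln (real k)) ^ 4 \<le> real n"
  obtains lam where "4 * h < 2 ^ Suc lam" "200000 * (h * (lam + 7) * (lam + 7)) \<le> n"
proof -
  have k2: "2 \<le> k"
  proof (rule ccontr)
    assume "\<not> 2 \<le> k"
    then have "k = 0 \<or> k = 1" by auto
    then show False using m by auto
  qed
  have hpos: "1 \<le> real h"
  proof -
    have "2 * 2 \<le> m * real k" using m(1) k2 by (intro mult_mono) auto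
    then show ?thesis using h by simp
  qed
  \<comment> \<open>The least \<open>lam\<close> with 4 h < 2 ^ (\<open>lam\<close> + 1).\<close>
  define lam where "lam = nat \<lfloor>log 2 (4 * real h)\<rfloor>"
  have l0: "0 \<le> log 2 (4 * real h)" using hpos by simp
  have lam_le: "real lam \<le> log 2 (4 * real h)" unfolding lam_def using l0 by simp
  have "log 2 (4 * real h) < real (Suc lam)" unfolding lam_def using l0 by linarith
  then have "4 * real h < 2 powr real (Suc lam)" using hpos by (simp add: log_less_iff)
  then have "real (4 * h) < real (2 ^ Suc lam)" by (simp only: powr_realpow) simp
  then have c1: "4 * h < 2 ^ Suc lam" by (simp only: of_nat_less_iff)
  let ?L = "ln (real k)"
  have ln2: "1 / 2 \<le> ln (2::real)" using ln_le_minus_one[of "1 / 2"] by (simp add: ln_div)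
  have Lk: "ln 2 \<le> ?L" using k2 by simp
  have hk: "real h \<le> real k ^ 23"
  proof -
    have "m * real k \<le> real k ^ 22 * real k" using m(2) by (intro mult_right_mono) auto
    also have "real k ^ 22 * real k = real k ^ 23" using power_Suc2[of "real k" 22] by simp
    finally show ?thesis using h by simp
  qed
  have "ln (real h) \<le> ln (real k ^ 23)" using hk hpos k2 by simp
  also have "\<dots> = 23 * ?L" using k2 by (simp add: ln_realpow)
  finally have lh: "ln (real h) \<le> 23 * ?L" .
  have "ln (4 * real h) = ln 4 + ln (real h)" using hpos by (simp add: ln_mult)
  moreover have "ln (4::real) = 2 * ln 2" using ln_realpow[of "2::real" 2] by simp
  ultimately have l4: "ln (4 * real h) \<le> 25 * ?L" using lh Lk by linarith
  have "real lam \<le> ln (4 * real h) / ln 2" using lam_le unfolding log_def .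
  also have "\<dots> \<le> (25 * ?L) / (1 / 2)" using l4 ln2 Lk by (intro frac_le) auto
  finally have "real lam \<le> 50 * ?L" by simp
  moreover have "7 \<le> 14 * ?L" using Lk ln2 by linarith
  ultimately have lb: "real lam + 7 \<le> 64 * ?L" by linarith
  have Lp: "1 / 2 \<le> ?L" using Lk ln2 by linarith
  have sq: "(real lam + 7) * (real lam + 7) \<le> (64 * ?L) * (64 * ?L)" using lb by (intro mult_mono) auto
  have L2: "1 / 4 \<le> ?L * ?L" using mult_mono[OF Lp Lp] Lp by simp
  define a where "a = ?L * ?L"
  have a: "1 / 4 \<le> a" using L2 unfolding a_def .
  then have "1 / 4 * a \<le> a * a" by (intro mult_right_mono) auto
  then have "4096 * a \<le> 20000 * (a * a)" using a by linarith
  moreover have "a * a = ?L ^ 4" unfolding a_def by (simp add: power4_eq_xxxx)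
  moreover have "(64 * ?L) * (64 * ?L) = 4096 * a" unfolding a_def by simp
  ultimately have "(real lam + 7) * (real lam + 7) \<le> 20000 * ?L ^ 4" using sq by linarith
  then have "real h * ((real lam + 7) * (real lam + 7)) \<le> real h * (20000 * ?L ^ 4)" by (intro mult_left_mono) auto
  moreover have "real h * (real lam + 7) * (real lam + 7) = real h * ((real lam + 7) * (real lam + 7))"
    by (rule mult.assoc)
  moreover have "real h * (20000 * ?L ^ 4) = 20000 * (real h * ?L ^ 4)" by simp
  ultimately have "200000 * (real h * (real lam + 7) * (real lam + 7)) \<le> 4000000000 * (real h * ?L ^ 4)" by linarith
  also have "\<dots> \<le> 10 ^ 60 * (real h * ?L ^ 4)" by (intro mult_right_mono) auto
  also have "\<dots> = 10 ^ 60 * m * real k * ?L ^ 4" using h by simp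
  finally have "200000 * (real h * (real lam + 7) * (real lam + 7)) \<le> real n" using n by linarith
  then have "real (200000 * (h * (lam + 7) * (lam + 7))) \<le> real n" by simp
  then have "200000 * (h * (lam + 7) * (lam + 7)) \<le> n" by (simp only: of_nat_le_iff)
  then show ?thesis using c1 that by blast
qed

lemma ramsey_partite:
  fixes V :: "'b set" and k :: nat
  assumes cp: "complete_k_partite k V E" and k: "1 \<le> k" and h: "h = card V"
    and lam: "4 * h < 2 ^ Suc lam" and n: "200000 * (h * (lam + 7) * (lam + 7)) \<le> n"
  shows "ramsey_number {0..<n} (cycle_edges n) V E = (chromatic_number V E - 1) * (n - 1) + sigma_graph V E"
proof -
  obtain p where fV: "finite V" and p: "p ` V = {0..<k}" and E: "E = {{u, v} | u v. u \<in> V \<and> v \<in> V \<and> p u \<noteq> p v}"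
    using cp unfolding complete_k_partite_def by blast
  let ?w = "\<lambda>i. card {v\<in>V. p v = i}"
  define s where "s = Min (?w ` {0..<k})"
  have sig: "sigma_graph V E = s" unfolding s_def by (rule sigma_partite[OF p E])
  have chi: "chromatic_number V E = k" by (rule chromatic_partite[OF p E])
  have ne: "?w ` {0..<k} \<noteq> {}" using k by simp
  have "s \<in> ?w ` {0..<k}" unfolding s_def using ne by (intro Min_in) auto
  then obtain i0 where i0: "i0 < k" "s = ?w i0" by auto
  have smin: "s \<le> ?w i" if "i < k" for i unfolding s_def using that by (intro Min_le) auto
  have "V \<noteq> {}" using p k by auto
  then have h0: "0 < h" using h fV by (simp add: card_gt_0_iff)
  have nh: "200000 * h \<le> n"
  proof -
    have "h * 1 * 1 \<le> h * (lam + 7) * (lam + 7)" by (intro mult_le_mono) simp_all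
    then show ?thesis using n by linarith
  qed
  have "?w i0 \<le> card V" using fV by (intro card_mono) auto
  then have sn: "s \<le> n - 1" "2 \<le> n" using i0(2) h nh h0 by linarith+
  let ?P = "\<lambda>N. \<forall>F. is_graph {0..<N::nat} F \<longrightarrow>
        contains_graph {0..<N} F {0..<n} (cycle_edges n) \<or> contains_graph {0..<N} (compl_edges {0..<N} F) V E"
  have "(LEAST N. ?P N) = (k - 1) * (n - 1) + s"
  proof (rule Least_equality)
    show "?P ((k - 1) * (n - 1) + s)"
    proof (intro allI impI)
      fix F assume F: "is_graph {0..<(k - 1) * (n - 1) + s} F"
      show "contains_graph {0..<(k - 1) * (n - 1) + s} F {0..<n} (cycle_edges n) \<or>
        contains_graph {0..<(k - 1) * (n - 1) + s} (compl_edges {0..<(k - 1) * (n - 1) + s} F) V E"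
        using ramsey_partite_upper[OF fV p E h h0 lam n i0(1) _ F] i0(2) by blast
    qed
    fix N assume PN: "?P N"
    show "(k - 1) * (n - 1) + s \<le> N"
    proof (rule ccontr)
      assume "\<not> (k - 1) * (n - 1) + s \<le> N"
      then have "N < (k - 1) * (n - 1) + s" by simp
      from ramsey_partite_lower[OF fV p E k sn(2) smin sn(1) this] show False using PN by blast
    qed
  qed
  then show ?thesis unfolding ramsey_number_def chi sig .
qed

theorem theorem6p1:
  shows "\<exists>C'::real. C' > 0 \<and>
    (\<forall>(k::nat) (m::real) (V::nat set) (E::nat set set) (n::nat).
       C' \<le> m \<and> m \<le> real k ^ 22 \<and>
       complete_k_partite k V E \<and> real (card V) = m * real k \<and>
       real n \<ge> 10^60 * m * real k * (ln (real k)) ^ 4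
       \<longrightarrow> ramsey_number {0..<n} (cycle_edges n) V E
             = (chromatic_number V E - 1) * (n - 1) + sigma_graph V E)"
\<comment> \<open>The value 2 together with m <= k^22 excludes k = 0 and k = 1, for which the
  logarithm would give no lower bound on n.\<close>
proof (intro exI[of _ 2] conjI allI impI)
  fix k :: nat and m :: real and V :: "nat set" and E :: "nat set set" and n :: nat
  assume A: "2 \<le> m \<and> m \<le> real k ^ 22 \<and> complete_k_partite k V E \<and> real (card V) = m * real k \<and>
    real n \<ge> 10^60 * m * real k * (ln (real k)) ^ 4"
  then obtain lam where "4 * card V < 2 ^ Suc lam" "200000 * (card V * (lam + 7) * (lam + 7)) \<le> n"
    using size_bound[of m k "card V" n] by blast
  moreover have "1 \<le> k" using A by (cases k) auto
  ultimately show "ramsey_number {0..<n} (cycle_edges n) V E = (chromatic_number V E - 1) * (n - 1) + sigma_graph V E"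
    using A by (intro ramsey_partite[where h = "card V" and lam = lam and k = k]) auto
qed simp

end
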